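(* Fix an integer $n\ge 4$, and let $$\mathcal{T}_n=\Bigl\{\bigl(\operatorname{reg}(R/J(T)),\ \deg h_{R/J(T)}(t)\bigr) : T\text{ is a tree of radius at most }2\text{ on }n\text{ vertices}\Bigr\}.$$ Define $$\mathcal{A}_n=\Bigl\{(r,d)\in\mathbb{Z}^2 : \Bigl\lceil\tfrac{n-2}{2}\Bigr\rceil\le r\le n-2,\ \ r\le d\le \min\{n-2,\,2r-1\}\Bigr\},$$ and, if $n$ is odd, $$\mathcal{B}_n=\Bigl\{(r,r-1) : r\in\mathbb{Z},\ \Bigl\lceil\tfrac{n-2}{2}\Bigr\rceil\le r\le \Bigl\lfloor\tfrac{2n-5}{3}\Bigr\rfloor\Bigr\}.$$ Then: (i) if $n$ is even, $\mathcal{T}_n=\mathcal{A}_n$; (ii) if $n$ is odd, $\mathcal{T}_n=\mathcal{A}_n\cup\mathcal{B}_n$.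
   Context: $\Bbbk$ is a field and $R=\Bbbk[x_v : v\in V(T)]$ with the standard grading. The cover ideal of a graph $T$ is $J(T)=\bigl(\prod_{v\in C}x_v : C \text{ a minimal vertex cover of } T\bigr)=\bigcap_{\{u,v\}\in E(T)}(x_u,x_v)$. $\operatorname{reg}$ is Castelnuovo–Mumford regularity: $\operatorname{reg}(R/J)=\max\{j-i:\beta_{i,j}(R/J)\ne0\}$. For a standard graded $\Bbbk$-algebra $A$ with Hilbert series $H_A(t)$, the $h$-polynomial $h_A(t)\in\mathbb{Z}[t]$ is the unique polynomial with $H_A(t)=h_A(t)/(1-t)^{\dim A}$. A tree has radius at most $2$ if it has a vertex $c$ at distance at most $2$ from every vertex. *)

theory Defs
  imports
    "HOL-Library.Poly_Mapping"
    "HOL-Computational_Algebra.Polynomial_FPS"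
    "Jordan_Normal_Form.Matrix_Kernel"
begin

section \<open>Polynomial rings, ideals and the standard grading\<close>

text \<open>
  \<open>('v, 'k) mpoly\<close> is the polynomial ring with one variable for each element of the type \<open>'v\<close>:
  a power product is an exponent vector \<open>'v \<Rightarrow>\<^sub>0 nat\<close>, a polynomial a finitely supported family of
  coefficients in \<open>'k\<close> indexed by power products.
\<close>

type_synonym ('v, 'k) mpoly = "('v \<Rightarrow>\<^sub>0 nat) \<Rightarrow>\<^sub>0 'k"

definition var :: "'v \<Rightarrow> ('v, 'k::field) mpoly" where
  "var v = Poly_Mapping.single (Poly_Mapping.single v 1) 1"

definition scal :: "'k::field \<Rightarrow> ('v, 'k) mpoly \<Rightarrow> ('v, 'k) mpoly" where
  "scal c p = Poly_Mapping.single 0 c * p"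

text \<open>
  The two module structures: over the polynomial ring itself (whose submodules are the ideals and
  whose span is the generated ideal), and over the field of coefficients.
\<close>

global_interpretation ideal: Modules.module "(*) :: ('v, 'k::field) mpoly \<Rightarrow> _"
  by unfold_locales (simp_all add: algebra_simps)

global_interpretation kvs: Vector_Spaces.vector_space
  "scal :: 'k::field \<Rightarrow> ('v, 'k) mpoly \<Rightarrow> ('v, 'k) mpoly"
proof unfold_locales
  fix a b :: 'k and x y :: "('v, 'k) mpoly"
  show "scal a (x + y) = scal a x + scal a y"
    by (simp add: scal_def distrib_left)
  show "scal (a + b) x = scal a x + scal b x"
    by (simp add: scal_def single_add distrib_right)
  show "scal a (scal b x) = scal (a * b) x"
    by (simp add: scal_def mult_single flip: mult.assoc)
  show "scal 1 x = x"
    by (simp add: scal_def)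
qed

definition prime_ideal :: "('v, 'k::field) mpoly set \<Rightarrow> bool" where
  "prime_ideal P \<longleftrightarrow> ideal.subspace P \<and> P \<noteq> UNIV \<and> (\<forall>a b. a * b \<in> P \<longrightarrow> a \<in> P \<or> b \<in> P)"

definition pp_degree :: "('v \<Rightarrow>\<^sub>0 nat) \<Rightarrow> nat" where
  "pp_degree m = (\<Sum>v\<in>Poly_Mapping.keys m. Poly_Mapping.lookup m v)"

definition homogeneous_part :: "nat \<Rightarrow> ('v, 'k::field) mpoly set" where
  "homogeneous_part d = {p. \<forall>m\<in>Poly_Mapping.keys p. pp_degree m = d}"

section \<open>Krull dimension, Hilbert series and h-polynomial of a quotient\<close>

text \<open>
  Prime ideals of \<open>R/J\<close> are identified with the prime ideals of \<open>R\<close> containing \<open>J\<close>.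
\<close>

definition krull_dim_quot :: "('v, 'k::field) mpoly set \<Rightarrow> nat" where
  "krull_dim_quot J = Sup {l. \<exists>P :: nat \<Rightarrow> ('v, 'k) mpoly set.
     (\<forall>i\<le>l. prime_ideal (P i) \<and> J \<subseteq> P i) \<and> (\<forall>i<l. P i \<subset> P (Suc i))}"

text \<open>
  \<open>quot_basis U W B\<close>: the residue classes of the elements of \<open>B\<close> are pairwise distinct and form a
  \<open>k\<close>-basis of \<open>U/(U \<inter> W)\<close>.
\<close>

definition quot_basis ::
  "('v, 'k::field) mpoly set \<Rightarrow> ('v, 'k) mpoly set \<Rightarrow> ('v, 'k) mpoly set \<Rightarrow> bool" where
  "quot_basis U W B \<longleftrightarrow> B \<subseteq> U \<and> kvs.independent B \<and> kvs.span B \<inter> W = {0} \<and>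
     (\<forall>u\<in>U. \<exists>b\<in>kvs.span B. u - b \<in> W)"

definition hilbert_fun :: "('v, 'k::field) mpoly set \<Rightarrow> nat \<Rightarrow> nat" where
  "hilbert_fun J d = (THE m. \<exists>B. finite B \<and> card B = m \<and> quot_basis (homogeneous_part d) J B)"

definition hilbert_series :: "('v, 'k::field) mpoly set \<Rightarrow> int fps" where
  "hilbert_series J = Abs_fps (\<lambda>d. int (hilbert_fun J d))"

definition h_poly :: "('v, 'k::field) mpoly set \<Rightarrow> int poly" where
  "h_poly J = (THE h. hilbert_series J * (1 - fps_X) ^ krull_dim_quot J = fps_of_poly h)"

section \<open>Minimal graded free resolutions and regularity\<close>

text \<open>
  A minimal graded free resolution
  \[ \cdots \to F_2 \to F_1 \to F_0 = R \to R/J \to 0 \]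
  of \<open>R/J\<close> for a proper homogeneous ideal \<open>J\<close> (so that \<open>F\<^sub>0 = R\<close>, with the canonical projection
  onto \<open>R/J\<close>). Here \<open>F\<^sub>i\<close> has a homogeneous basis whose degrees are listed by \<open>ds i\<close>, that is,
  \<open>F\<^sub>i = \<Oplus>\<^sub>a R(- ds i ! a)\<close>, and \<open>\<phi> i\<close> is the matrix of the differential from \<open>F\<^sub>i\<^sub>+\<^sub>1\<close> to \<open>F\<^sub>i\<close>.
  The conditions say in turn: the differentials are of degree 0; they have image in the maximal
  homogeneous ideal times their target; the image of \<open>F\<^sub>1\<close> in \<open>F\<^sub>0\<close> is \<open>J\<close>; the complex is exact
  at \<open>F\<^sub>i\<^sub>+\<^sub>1\<close>.
\<close>

definition min_graded_free_resolution ::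
  "('v, 'k::field) mpoly set \<Rightarrow> (nat \<Rightarrow> nat list) \<Rightarrow> (nat \<Rightarrow> ('v, 'k) mpoly mat) \<Rightarrow> bool" where
  "min_graded_free_resolution J ds \<phi> \<longleftrightarrow>
     ds 0 = [0] \<and>
     (\<forall>i. \<phi> i \<in> carrier_mat (length (ds i)) (length (ds (Suc i)))) \<and>
     (\<forall>i. \<forall>a<length (ds i). \<forall>b<length (ds (Suc i)). \<forall>m\<in>Poly_Mapping.keys (\<phi> i $$ (a, b)).
        pp_degree m + ds i ! a = ds (Suc i) ! b) \<and>
     (\<forall>i. \<forall>a<length (ds i). \<forall>b<length (ds (Suc i)). Poly_Mapping.lookup (\<phi> i $$ (a, b)) 0 = 0) \<and>
     {(\<phi> 0 *\<^sub>v x) $ 0 | x. x \<in> carrier_vec (length (ds 1))} = J \<and>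
     (\<forall>i. {\<phi> (Suc i) *\<^sub>v x | x. x \<in> carrier_vec (length (ds (Suc (Suc i))))} = mat_kernel (\<phi> i))"

text \<open>
  The graded Betti number \<open>\<beta>\<^sub>i\<^sub>,\<^sub>j(R/J)\<close> is the number of summands \<open>R(-j)\<close> of \<open>F\<^sub>i\<close>; minimal graded free
  resolutions being unique up to isomorphism, it does not depend on the chosen resolution.
\<close>

definition graded_betti :: "('v, 'k::field) mpoly set \<Rightarrow> nat \<Rightarrow> nat \<Rightarrow> nat" where
  "graded_betti J i j =
     count_list ((SOME ds. \<exists>\<phi>. min_graded_free_resolution J ds \<phi>) i) j"

definition regularity_quot :: "('v, 'k::field) mpoly set \<Rightarrow> int" where
  "regularity_quot J = Max {int j - int i | i j. graded_betti J i j \<noteq> 0}"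

section \<open>Graphs and cover ideals\<close>

text \<open>
  A graph on the vertex set \<open>UNIV :: 'v set\<close> is given by its set of edges.
\<close>

definition simple_graph :: "'v set set \<Rightarrow> bool" where
  "simple_graph E \<longleftrightarrow> (\<forall>e\<in>E. card e = 2)"

definition adj :: "'v set set \<Rightarrow> ('v \<times> 'v) set" where
  "adj E = {(u, v). {u, v} \<in> E}"

definition connected_graph :: "'v set set \<Rightarrow> bool" where
  "connected_graph E \<longleftrightarrow> (\<forall>u v. (u, v) \<in> (adj E)\<^sup>*)"

text \<open>
  A cycle is listed by its vertices in order, without repeating the first one at the end.
\<close>

definition graph_cycle :: "'v set set \<Rightarrow> 'v list \<Rightarrow> bool" where
  "graph_cycle E vs \<longleftrightarrow> length vs \<ge> 3 \<and> distinct vs \<and>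
     (\<forall>i. Suc i < length vs \<longrightarrow> {vs ! i, vs ! Suc i} \<in> E) \<and> {last vs, hd vs} \<in> E"

definition is_tree :: "'v set set \<Rightarrow> bool" where
  "is_tree E \<longleftrightarrow> simple_graph E \<and> connected_graph E \<and> (\<nexists>vs. graph_cycle E vs)"

definition graph_dist :: "'v set set \<Rightarrow> 'v \<Rightarrow> 'v \<Rightarrow> nat" where
  "graph_dist E u v = (LEAST l. (u, v) \<in> adj E ^^ l)"

definition radius_at_most :: "'v set set \<Rightarrow> nat \<Rightarrow> bool" where
  "radius_at_most E r \<longleftrightarrow> (\<exists>c. \<forall>v. graph_dist E c v \<le> r)"

definition vertex_cover :: "'v set set \<Rightarrow> 'v set \<Rightarrow> bool" where
  "vertex_cover E C \<longleftrightarrow> (\<forall>e\<in>E. e \<inter> C \<noteq> {})"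

definition minimal_vertex_cover :: "'v set set \<Rightarrow> 'v set \<Rightarrow> bool" where
  "minimal_vertex_cover E C \<longleftrightarrow> vertex_cover E C \<and> (\<forall>D. D \<subset> C \<longrightarrow> \<not> vertex_cover E D)"

definition cover_ideal :: "'v set set \<Rightarrow> ('v, 'k::field) mpoly set" where
  "cover_ideal E = ideal.span {\<Prod>v\<in>C. var v | C. minimal_vertex_cover E C}"

section \<open>The sets of pairs\<close>

text \<open>
  Trees on \<open>n\<close> vertices are represented on a vertex type of cardinality \<open>n\<close>; the two type arguments
  stand for the vertices and for the ground field.
\<close>

definition reg_deg_pairs :: "'v::finite itself \<Rightarrow> 'k::field itself \<Rightarrow> (int \<times> int) set" where
  "reg_deg_pairs _ _ =
     {(regularity_quot (cover_ideal E :: ('v, 'k) mpoly set),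
       int (degree (h_poly (cover_ideal E :: ('v, 'k) mpoly set)))) | E :: 'v set set.
        is_tree E \<and> radius_at_most E 2}"

definition A_set :: "nat \<Rightarrow> (int \<times> int) set" where
  "A_set n = {(r, d). \<lceil>(real n - 2) / 2\<rceil> \<le> r \<and> r \<le> int n - 2 \<and>
                      r \<le> d \<and> d \<le> min (int n - 2) (2 * r - 1)}"

definition B_set :: "nat \<Rightarrow> (int \<times> int) set" where
  "B_set n = {(r, r - 1) | r. \<lceil>(real n - 2) / 2\<rceil> \<le> r \<and> r \<le> \<lfloor>(2 * real n - 5) / 3\<rfloor>}"

end

theory Submission
  imports Defs
begin

text \<open>
  A tree of radius at most 2 consists of a root \<open>c\<close>, its children \<open>N\<close>, and the children \<open>L w\<close> of each
  \<open>w \<in> N\<close>. Write \<open>n1 = |N|\<close>, \<open>n2 = \<Sum> |L w|\<close> and let \<open>s\<close> be the number of \<open>w \<in> N\<close> with \<open>L w \<noteq> {}\<close>; then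
  \<open>n = 1 + n1 + n2\<close>. The theorem is a consequence of two formulas:
  \<open>reg (R/J) = max n2 (n1 - 1)\<close> (\<open>regularity_two_level\<close>) and
  \<open>deg h = max (n2 + s) n1 - 1\<close>, except that \<open>deg h = n1 - 2\<close> when \<open>n2 + s = n1\<close> and \<open>s\<close> is even
  (\<open>degree_h_poly_two_level\<close>). All triples with \<open>s \<le> n1\<close>, \<open>s \<le> n2\<close> and \<open>s = 0 \<longrightarrow> n2 = 0\<close> occur
  (\<open>two_level_exists\<close>). The generic case sweeps out \<open>A_set\<close>; the exceptional case forces \<open>n\<close> to be odd
  and \<open>deg h = reg (R/J) - 1\<close>, which is \<open>B_set\<close>.
  
  Regularity. A vertex set is a cover iff it contains \<open>N\<close>, or contains \<open>c\<close> and for every \<open>w \<in> N\<close> either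
  \<open>w\<close> or \<open>L w\<close>. Hence \<open>J = x\<^sub>c A + (\<Prod>w\<in>N. x\<^sub>w)\<close>, where \<open>A\<close> is the product of the ideals
  \<open>(x\<^sub>w, \<Prod>u\<in>L w. x\<^sub>u)\<close> over the \<open>w\<close> with \<open>L w \<noteq> {}\<close>. These ideals live in disjoint sets of variables,
  so \<open>A\<close> is resolved by iterated mapping cones starting from \<open>R\<close> (\<open>cone\<close>). The remaining generator is
  attached to this resolution by \<open>whisker\<close> if \<open>c\<close> has a leaf among its children; otherwise it divides a
  generator of \<open>x\<^sub>c A\<close> and replaces it (\<open>rescale_generator\<close>). The result is an explicit minimal
  resolution whose degrees can be read off. As the regularity is defined through an arbitrary
  minimal resolution, it must also be shown that the degrees occurring in each homological
  position do not depend on the resolution (\<open>min_res_degrees_unique\<close>); this is the usual comparison of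
  two resolutions by chain maps and a homotopy.
  
  The h-polynomial. A monomial lies in \<open>J\<close> iff its support is a cover, so the Hilbert series of \<open>R/J\<close> is
  the sum of \<open>(t/(1 - t))\<^bsup>|S|\<^esup>\<close> over the sets \<open>S\<close> that are not covers. The dimension is \<open>n - 2\<close>, the largest
  size of such a set (\<open>krull_dim_quot_mon_ideal\<close>). Therefore \<open>(1 - t)\<^sup>2 h\<close> equals \<open>1 - K\<close>, where \<open>K\<close> is the sum
  of \<open>t\<^bsup>|S|\<^esup> (1 - t)\<^bsup>n - |S|\<^esup>\<close> over all covers. This sum factors along the blocks \<open>{w} \<union> L w\<close> and gives
  \<open>K = t (\<Prod>w\<in>N. t + (1 - t) t\<^bsup>|L w|\<^esup>) + (1 - t) t\<^bsup>n1\<^esup>\<close>. The two summands have degrees \<open>1 + n2 + s\<close> and \<open>n1 + 1\<close>,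
  with leading coefficients \<open>(-1)\<^sup>s\<close> and \<open>-1\<close>; they cancel exactly in the exceptional case, where the next
  coefficient decides.
\<close>

section \<open>Monomials and monomial ideals\<close>

abbreviation keys :: "('a \<Rightarrow>\<^sub>0 'b::zero) \<Rightarrow> 'a set" where
  "keys \<equiv> Poly_Mapping.keys"

abbreviation lookup :: "('a \<Rightarrow>\<^sub>0 'b::zero) \<Rightarrow> 'a \<Rightarrow> 'b" where
  "lookup \<equiv> Poly_Mapping.lookup"

definition pmon :: "('v \<Rightarrow>\<^sub>0 nat) \<Rightarrow> ('v, 'k::field) mpoly" where
  "pmon t = Poly_Mapping.single t 1"

text \<open>
  If \<open>Q\<close> is closed under multiplication by power products, this is the monomial ideal spanned by the
  power products with property \<open>Q\<close>; conversely every monomial ideal is of this form, which makes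
  membership a condition on single power products.
\<close>

definition mon_ideal :: "(('v \<Rightarrow>\<^sub>0 nat) \<Rightarrow> bool) \<Rightarrow> ('v, 'k::field) mpoly set" where
  "mon_ideal Q = {p. \<forall>m\<in>keys p. Q m}"

lemma mem_mon_ideal: "p \<in> mon_ideal Q \<longleftrightarrow> (\<forall>m\<in>keys p. Q m)"
  by (simp add: mon_ideal_def)

lemma lookup_mult_keys:
  fixes a b :: "('v, 'k::field) mpoly"
  shows "lookup (a * b) k =
    (\<Sum>l\<in>keys a. \<Sum>q\<in>keys b.
       if k = l + q then lookup a l * lookup b q else 0)"
proof -
  have inner: "(\<Sum>q. lookup b q when k = l + q) =
      (\<Sum>q\<in>keys b. if k = l + q then lookup b q else 0)" for l
    by (subst Sum_any.expand_superset[of "keys b"])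
       (auto simp: in_keys_iff when_def)
  have "lookup (a * b) k =
      (\<Sum>l\<in>keys a. lookup a l *
        (\<Sum>q\<in>keys b. if k = l + q then lookup b q else 0))"
    unfolding lookup_mult inner
    by (subst Sum_any.expand_superset[of "keys a"]) (auto simp: in_keys_iff)
  then show ?thesis
    by (simp add: sum_distrib_left if_distrib cong: if_cong)
qed

lemma lookup_pmon_mult [simp]: "lookup (pmon t * p) (t + s) = lookup p s"
  by (cases "s \<in> keys p")
     (auto simp: lookup_mult_keys pmon_def in_keys_iff lookup_single)

lemma lookup_pmon_mult_eq_0: "\<nexists>s. k = t + s \<Longrightarrow> lookup (pmon t * p) k = 0"
  by (auto simp: lookup_mult_keys pmon_def)

lemma keys_pmon [simp]: "keys (pmon t) = {t}"
  by (simp add: pmon_def)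

lemma pmon_inject [simp]: "(pmon s :: ('v, 'k::field) mpoly) = pmon t \<longleftrightarrow> s = t"
  by (metis keys_pmon singleton_inject)

lemma keys_pmon_mult: "keys (pmon t * p) = (+) t ` keys p"
proof (rule Set.set_eqI)
  fix k show "k \<in> keys (pmon t * p) \<longleftrightarrow> k \<in> (+) t ` keys p"
  proof (cases "\<exists>s. k = t + s")
    case True then show ?thesis by (auto simp: in_keys_iff)
  next
    case False then show ?thesis by (auto simp: in_keys_iff lookup_pmon_mult_eq_0)
  qed
qed

lemma pmon_mult_cancel: "pmon t * p = pmon t * q \<longleftrightarrow> p = q"
proof
  assume "pmon t * p = pmon t * q"
  then have "lookup p s = lookup q s" for s
    by (metis lookup_pmon_mult)
  then show "p = q" by (simp add: poly_mapping_eqI)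
qed simp

lemma pmon_mult_eq_0_iff [simp]: "pmon t * p = 0 \<longleftrightarrow> p = 0"
  using pmon_mult_cancel[of t p 0] by simp

lemma pmon_add: "pmon (s + t) = pmon s * pmon t"
  by (simp add: pmon_def mult_single)

lemma pmon_0 [simp]: "pmon 0 = 1"
  by (simp add: pmon_def)

lemma pmon_dvdE:
  fixes p :: "('v, 'k::field) mpoly"
  assumes "\<And>m. m \<in> keys p \<Longrightarrow> \<exists>s. m = t + s"
  obtains q where "p = pmon t * q"
proof -
  have inj: "inj ((+) t)" by (simp add: inj_on_def)
  define q where "q = Poly_Mapping.map_key ((+) t) p"
  have l: "lookup q s = lookup p (t + s)" for s
    unfolding q_def by (subst Poly_Mapping.map_key.rep_eq[OF inj]) simp
  have "lookup p k = lookup (pmon t * q) k" for k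
  proof (cases "\<exists>s. k = t + s")
    case True then show ?thesis by (auto simp: l)
  next
    case False then show ?thesis using assms[of k]
      by (auto simp: lookup_pmon_mult_eq_0 in_keys_iff)
  qed
  then show ?thesis by (intro that[of q] poly_mapping_eqI)
qed

lemma poly_mapping_sum_monomials:
  "p = (\<Sum>m\<in>keys p. Poly_Mapping.single m (lookup p m))"
  by (rule poly_mapping_eqI) (auto simp: lookup_sum lookup_single when_def in_keys_iff)

text \<open>
  The product of the leading terms cannot cancel. The variables carry no order, so leading terms are
  taken with respect to the order of \<open>nat \<Rightarrow>\<^sub>0 nat\<close>, into which the power products are embedded by
  numbering the variables.
\<close>

lemma mpoly_no_zero_divisors:
  fixes a b :: "('v::finite, 'k::field) mpoly"
  assumes "a \<noteq> 0" "b \<noteq> 0"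
  shows "a * b \<noteq> 0"
proof -
  obtain \<iota> :: "'v \<Rightarrow> nat" where \<iota>: "inj \<iota>"
    using finite_imp_inj_to_nat_seg[of "UNIV :: 'v set"] by auto
  define L :: "('v \<Rightarrow>\<^sub>0 nat) \<Rightarrow> nat \<Rightarrow>\<^sub>0 nat"
    where "L m = (\<Sum>v\<in>UNIV. Poly_Mapping.single (\<iota> v) (lookup m v))" for m
  have add: "L (s + t) = L s + L t" for s t
    by (simp add: L_def lookup_add single_add sum.distrib)
  have "lookup (L m) (\<iota> u) = lookup m u" for m u
    using \<iota> by (simp add: L_def lookup_sum lookup_single when_def inj_eq)
  then have inj: "L s = L t \<Longrightarrow> s = t" for s t
    by (metis poly_mapping_eqI)
  have "\<exists>k\<in>keys p. \<forall>l\<in>keys p. L l \<le> L k"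
    if "p \<noteq> 0" for p :: "('v, 'k) mpoly"
  proof -
    have "Max (L ` keys p) \<in> L ` keys p"
      using that by (intro Max_in) auto
    then obtain k where "k \<in> keys p" "L k = Max (L ` keys p)" by auto
    then show ?thesis by (metis Max_ge finite_imageI finite_keys imageI)
  qed
  then obtain k l where k: "k \<in> keys a" "\<And>m. m \<in> keys a \<Longrightarrow> L m \<le> L k"
    and l: "l \<in> keys b" "\<And>m. m \<in> keys b \<Longrightarrow> L m \<le> L l"
    using assms by meson
  have uniq: "k + l = m + q \<longleftrightarrow> m = k \<and> q = l"
    if "m \<in> keys a" "q \<in> keys b" for m q
  proof
    assume eq: "k + l = m + q"
    then have e: "L k + L l = L m + L q" by (metis add)
    have "L m \<le> L k" "L q \<le> L l" using that k l by auto
    then have "L m = L k \<and> L q = L l" using e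
      by (metis add_le_cancel_right add_left_cancel add_left_mono antisym)
    then show "m = k \<and> q = l" using inj by blast
  qed auto
  have "lookup (a * b) (k + l) =
      (\<Sum>m\<in>keys a. \<Sum>q\<in>keys b.
       if m = k \<and> q = l then lookup a k * lookup b l else 0)"
    unfolding lookup_mult_keys by (intro sum.cong refl) (auto simp: uniq)
  also have "\<dots> = (\<Sum>m\<in>keys a.
       if m = k then lookup a k * lookup b l else 0)"
    using l(1) by (intro sum.cong refl) auto
  also have "\<dots> = lookup a k * lookup b l"
    using k(1) by simp
  finally show ?thesis using k(1) l(1) by (auto simp: in_keys_iff)
qed

lemma scal_single: "scal c (Poly_Mapping.single m a) = Poly_Mapping.single m (c * a)"
  by (simp add: scal_def mult_single)

lemma lookup_scal [simp]: "lookup (scal c p) m = c * lookup p m"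
  unfolding scal_def by (cases "m \<in> keys p")
    (auto simp: lookup_mult_keys lookup_single in_keys_iff)

lemma keys_uminus_mpoly: "keys (- p) = keys (p :: ('v, 'k::field) mpoly)"
  by (auto simp: in_keys_iff)

lemma subspace_mon_ideal:
  assumes "\<And>m t. Q m \<Longrightarrow> Q (t + m)"
  shows "ideal.subspace (mon_ideal Q)"
proof (rule ideal.subspaceI)
  fix x y c :: "('a, 'b) mpoly"
  assume x: "x \<in> mon_ideal Q"
  show "c * x \<in> mon_ideal Q" 
    using x keys_mult[of c x] assms unfolding mem_mon_ideal by blast
  assume y: "y \<in> mon_ideal Q"
  show "x + y \<in> mon_ideal Q"
    using x y keys_add[of x y] unfolding mem_mon_ideal by blast
qed (simp add: mem_mon_ideal)

lemma subspace_memI_keys: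
  assumes "ideal.subspace I" "\<And>m. m \<in> keys p \<Longrightarrow> pmon m \<in> I"
  shows "p \<in> I"
proof -
  have "Poly_Mapping.single m (lookup p m) \<in> I" if "m \<in> keys p" for m
  proof -
    have "Poly_Mapping.single m (lookup p m)
        = Poly_Mapping.single 0 (lookup p m) * pmon m"
      by (simp add: pmon_def mult_single)
    then show ?thesis using assms that ideal.subspace_scale by metis
  qed
  then have "(\<Sum>m\<in>keys p. Poly_Mapping.single m (lookup p m)) \<in> I"
    using assms(1) by (intro ideal.subspace_sum) auto
  then show ?thesis by (metis poly_mapping_sum_monomials)
qed

lemma pp_degree_superset: "finite A \<Longrightarrow> keys m \<subseteq> A \<Longrightarrow> pp_degree m = (\<Sum>v\<in>A. lookup m v)"
  unfolding pp_degree_def by (rule sum.mono_neutral_left) (auto simp: in_keys_iff)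

lemma pp_degree_add: "pp_degree (s + t) = pp_degree s + pp_degree t"
proof -
  let ?A = "keys s \<union> keys t"
  have "keys (s + t) \<subseteq> ?A" by (rule keys_add)
  then show ?thesis
    by (simp add: pp_degree_superset[of ?A] lookup_add sum.distrib)
qed

lemma pp_degree_0 [simp]: "pp_degree 0 = 0"
  by (simp add: pp_degree_def)

lemma pp_degree_single [simp]: "pp_degree (Poly_Mapping.single v n) = n"
  by (simp add: pp_degree_def)

lemma pp_degree_eq_0_iff: "pp_degree m = 0 \<longleftrightarrow> m = 0"
  unfolding pp_degree_def by (subst sum_eq_0_iff) (auto simp: in_keys_iff intro!: poly_mapping_eqI)

lemma keys_add_nat: "keys (s + t) = keys s \<union> keys (t :: 'v \<Rightarrow>\<^sub>0 nat)"
  by (auto simp: in_keys_iff lookup_add)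

definition sqf :: "'v set \<Rightarrow> ('v \<Rightarrow>\<^sub>0 nat)" where
  "sqf A = (\<Sum>v\<in>A. Poly_Mapping.single v 1)"

lemma lookup_sqf: "finite A \<Longrightarrow> lookup (sqf A) v = (if v \<in> A then 1 else 0)"
  by (simp add: sqf_def lookup_sum lookup_single when_def)

lemma keys_sqf: "finite A \<Longrightarrow> keys (sqf A) = A"
  by (auto simp: in_keys_iff lookup_sqf split: if_splits)

lemma pp_degree_sqf: "finite A \<Longrightarrow> pp_degree (sqf A) = card A"
  by (simp add: pp_degree_def keys_sqf lookup_sqf)

lemma sqf_Un: "finite A \<Longrightarrow> finite B \<Longrightarrow> A \<inter> B = {} \<Longrightarrow> sqf (A \<union> B) = sqf A + sqf B"
  by (simp add: sqf_def sum.union_disjoint)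

lemma add_dvd_iff: "(\<exists>s. m = t + s) \<longleftrightarrow> (\<forall>v. lookup t v \<le> lookup (m :: 'v \<Rightarrow>\<^sub>0 nat) v)"
proof
  assume "\<forall>v. lookup t v \<le> lookup m v"
  then have "m = t + (m - t)" by (auto intro!: poly_mapping_eqI simp: lookup_add lookup_minus)
  then show "\<exists>s. m = t + s" ..
qed (auto simp: lookup_add)

lemma sqf_dvd_iff:
  assumes "finite A"
  shows "(\<exists>s. m = sqf A + s) \<longleftrightarrow> A \<subseteq> keys m"
proof -
  have "(\<forall>v. lookup (sqf A) v \<le> lookup m v)
      \<longleftrightarrow> (\<forall>v\<in>A. lookup m v \<noteq> 0)"
    by (simp add: lookup_sqf[OF assms] Suc_le_eq) auto
  then show ?thesis unfolding add_dvd_iff by (auto simp: subset_iff in_keys_iff)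
qed

lemma var_eq_pmon: "var v = pmon (Poly_Mapping.single v 1)"
  by (simp add: var_def pmon_def)

lemma pmon_sqf: "finite A \<Longrightarrow> (\<Prod>v\<in>A. var v) = pmon (sqf A)"
  by (induction A rule: finite_induct) (auto simp: var_eq_pmon sqf_def pmon_add)

definition pfilter :: "(('v \<Rightarrow>\<^sub>0 nat) \<Rightarrow> bool) \<Rightarrow> ('v, 'k::field) mpoly \<Rightarrow> ('v, 'k) mpoly" where
  "pfilter P p = Abs_poly_mapping (\<lambda>m. if P m then lookup p m else 0)"

lemma lookup_pfilter [simp]:
  "lookup (pfilter P p) m = (if P m then lookup p m else 0)"
proof -
  have "finite {m. (if P m then lookup p m else 0) \<noteq> 0}"
    by (rule finite_subset[OF _ finite_keys[of p]]) (auto simp: in_keys_iff)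
  then show ?thesis by (simp add: pfilter_def)
qed

lemma keys_pfilter: "keys (pfilter P p) = {m \<in> keys p. P m}"
  by (auto simp: in_keys_iff split: if_splits)

lemma pfilter_add: "pfilter P (p + q) = pfilter P p + pfilter P q"
  by (rule poly_mapping_eqI) (simp add: lookup_add)

lemma pfilter_sum: "pfilter P (\<Sum>i\<in>I. f i) = (\<Sum>i\<in>I. pfilter P (f i))"
  by (rule poly_mapping_eqI) (simp add: lookup_sum)

lemma pfilter_id: "(\<And>m. m \<in> keys p \<Longrightarrow> P m) \<Longrightarrow> pfilter P p = p"
  by (rule poly_mapping_eqI) (auto simp: in_keys_iff)

lemma pfilter_0: "(\<And>m. m \<in> keys p \<Longrightarrow> \<not> P m) \<Longrightarrow> pfilter P p = 0"
  by (rule poly_mapping_eqI) (auto simp: in_keys_iff)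

lemma pfilter_split: "pfilter P p + pfilter (\<lambda>m. \<not> P m) p = p"
  by (rule poly_mapping_eqI) (simp add: lookup_add)

lemma pfilter_mult:
  assumes "\<And>l q. l \<in> keys a \<Longrightarrow> P (l + q) \<longleftrightarrow> P' q"
  shows "pfilter P (a * b) = a * pfilter P' b"
proof -
  have "pfilter P (a * b) = pfilter P (a * pfilter P' b) + pfilter P (a * pfilter (\<lambda>m. \<not> P' m) b)"
    by (metis distrib_left pfilter_add pfilter_split)
  moreover have "pfilter P (a * pfilter P' b) = a * pfilter P' b"
    using keys_mult[of a "pfilter P' b"] assms by (intro pfilter_id) (auto simp: keys_pfilter)
  moreover have "pfilter P (a * pfilter (\<lambda>m. \<not> P' m) b) = 0"
    using keys_mult[of a "pfilter (\<lambda>m. \<not> P' m) b"] assms by (intro pfilter_0) (auto simp: keys_pfilter)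
  ultimately show ?thesis by simp
qed

section \<open>Hilbert series of monomial ideals\<close>

lemma independent_pmon: "kvs.independent (pmon ` S :: ('v, 'k::field) mpoly set)"
proof (subst kvs.independent_explicit_module, intro allI impI)
  fix t and u :: "('v, 'k) mpoly \<Rightarrow> 'k" and v
  assume t: "finite t" "t \<subseteq> pmon ` S" and z: "(\<Sum>v\<in>t. scal (u v) v) = 0" and v: "v \<in> t"
  obtain m where m: "v = pmon m" using t v by blast
  have c: "lookup w m = (if w = v then 1 else 0)" if "w \<in> t" for w
    using that t by (auto simp: m pmon_def lookup_single when_def)
  have "0 = (\<Sum>w\<in>t. u w * lookup w m)"
    using arg_cong[OF z, of "\<lambda>p. lookup p m"] by (simp add: lookup_sum)
  also have "\<dots> = (\<Sum>w\<in>t. if w = v then u v else 0)"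
    by (intro sum.cong refl) (auto simp: c)
  also have "\<dots> = u v" using t v by simp
  finally show "u v = 0" by simp
qed

lemma span_pmon: "kvs.span (pmon ` S :: ('v, 'k::field) mpoly set) = {p. keys p \<subseteq> S}"
proof (intro subset_antisym)
  have "kvs.subspace {p :: ('v, 'k) mpoly. keys p \<subseteq> S}"
  proof (rule kvs.subspaceI)
    fix x y :: "('v, 'k) mpoly" and c :: 'k
    assume x: "x \<in> {p. keys p \<subseteq> S}"
    then show "scal c x \<in> {p. keys p \<subseteq> S}"
      by (auto simp: in_keys_iff)
    assume "y \<in> {p. keys p \<subseteq> S}"
    then show "x + y \<in> {p. keys p \<subseteq> S}" using x keys_add[of x y] by auto
  qed simp
  then show "kvs.span (pmon ` S) \<subseteq> {p :: ('v, 'k) mpoly. keys p \<subseteq> S}"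
    by (intro kvs.span_minimal) auto
next
  show "{p :: ('v, 'k) mpoly. keys p \<subseteq> S} \<subseteq> kvs.span (pmon ` S)"
  proof
    fix p :: "('v, 'k) mpoly" assume "p \<in> {p. keys p \<subseteq> S}"
    then have mem: "(\<Sum>m\<in>keys p. scal (lookup p m) (pmon m)) \<in> kvs.span (pmon ` S)"
      by (intro kvs.span_sum kvs.span_scale kvs.span_base) auto
    have eq: "p = (\<Sum>m\<in>keys p. scal (lookup p m) (pmon m))"
      using poly_mapping_sum_monomials[of p] by (simp add: pmon_def scal_single)
    show "p \<in> kvs.span (pmon ` S)" by (subst eq) (rule mem)
  qed
qed

lemma pp_degree_ge_lookup: "lookup m v \<le> pp_degree (m :: 'v::finite \<Rightarrow>\<^sub>0 nat)"
  using member_le_sum[of v UNIV "lookup m"] by (simp add: pp_degree_superset[of UNIV])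

lemma finite_pp_degree: "finite {m :: 'v::finite \<Rightarrow>\<^sub>0 nat. pp_degree m \<le> d}"
proof (rule finite_imageD[of lookup])
  have "lookup ` {m :: 'v \<Rightarrow>\<^sub>0 nat. pp_degree m \<le> d} \<subseteq> (UNIV \<rightarrow>\<^sub>E {..d})"
  proof (clarsimp simp: PiE_def)
    fix m :: "'v \<Rightarrow>\<^sub>0 nat" and v assume "pp_degree m \<le> d"
    then show "lookup m v \<le> d"
      using pp_degree_ge_lookup[of m v] by simp
  qed
  then show "finite (lookup ` {m :: 'v \<Rightarrow>\<^sub>0 nat. pp_degree m \<le> d})"
    by (rule finite_subset) (intro finite_PiE; simp)
qed (auto simp: inj_on_def poly_mapping_eqI)

text \<open>
  The power products of degree \<open>d\<close> outside the ideal form a basis of the quotient. Any other finite basis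
  \<open>B\<close> has the same size: deleting from a polynomial all terms in the ideal is a linear map that is
  injective on the span of \<open>B\<close>, because this span meets the ideal in 0, and it maps \<open>B\<close> to another basis
  of the span of those power products.
\<close>

lemma hilbert_fun_mon_ideal:
  "hilbert_fun (mon_ideal Q :: ('v::finite, 'k::field) mpoly set) d = card {m. pp_degree m = d \<and> \<not> Q m}"
proof -
  let ?J = "mon_ideal Q :: ('v, 'k) mpoly set" and ?U = "homogeneous_part d :: ('v, 'k) mpoly set"
  define N where "N = {m. pp_degree m = d \<and> \<not> Q m}"
  have finN: "finite N" by (rule finite_subset[OF _ finite_pp_degree[of d]]) (auto simp: N_def)
  let ?M = "pmon ` N :: ('v, 'k) mpoly set"
  have cM: "card ?M = card N" by (intro card_image) (auto simp: inj_on_def)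
  have qM: "quot_basis ?U ?J ?M"
    unfolding quot_basis_def
  proof (intro conjI ballI)
    show "?M \<subseteq> ?U" by (auto simp: homogeneous_part_def N_def)
    show "kvs.independent ?M" by (rule independent_pmon)
    show "kvs.span ?M \<inter> ?J = {0}"
    proof (rule subset_antisym; rule subsetI)
      fix p assume "p \<in> kvs.span ?M \<inter> ?J"
      then have "keys p \<subseteq> N" "\<forall>m\<in>keys p. Q m"
        by (auto simp: span_pmon mem_mon_ideal)
      then have "keys p = {}" unfolding N_def by blast
      then show "p \<in> {0}" by (simp add: poly_mapping_eqI in_keys_iff)
    qed (auto simp: span_pmon mem_mon_ideal)
    fix u assume u: "u \<in> ?U"
    have "pfilter (\<lambda>m. \<not> Q m) u \<in> kvs.span ?M"
      using u by (auto simp: span_pmon keys_pfilter N_def homogeneous_part_def)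
    moreover have "u - pfilter (\<lambda>m. \<not> Q m) u \<in> ?J"
      by (auto simp: mem_mon_ideal in_keys_iff lookup_minus split: if_splits)
    ultimately show "\<exists>b\<in>kvs.span ?M. u - b \<in> ?J" by blast
  qed
  have "card B = card N" if fin: "finite B" and q: "quot_basis ?U ?J B" for B
  proof -
    define \<pi> where "\<pi> = (pfilter (\<lambda>m. \<not> Q m) :: ('v, 'k) mpoly \<Rightarrow> _)"
    have lin: "Vector_Spaces.linear scal scal \<pi>"
      unfolding \<pi>_def by unfold_locales
        (auto simp: pfilter_add intro!: poly_mapping_eqI)
    interpret \<pi>: Vector_Spaces.linear scal scal \<pi> by (rule lin)
    have BU: "B \<subseteq> ?U" and indB: "kvs.independent B" and disj: "kvs.span B \<inter> ?J = {0}"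
      and gen: "\<And>u. u \<in> ?U \<Longrightarrow> \<exists>b\<in>kvs.span B. u - b \<in> ?J"
      using q by (simp_all add: quot_basis_def)
    have "inj_on \<pi> (kvs.span B)"
    proof (rule inj_onI)
      fix x y assume xy: "x \<in> kvs.span B" "y \<in> kvs.span B" "\<pi> x = \<pi> y"
      have "Q m" if m: "m \<in> keys (x - y)" for m
      proof (rule ccontr)
        assume "\<not> Q m"
        then have "lookup (\<pi> x) m - lookup (\<pi> y) m = lookup (x - y) m"
          by (simp add: \<pi>_def lookup_minus)
        then show False using m xy(3) by (simp add: in_keys_iff)
      qed
      then have "x - y \<in> ?J" by (simp add: mem_mon_ideal)
      moreover have "x - y \<in> kvs.span B" using xy by (intro kvs.span_diff)
      ultimately have "x - y \<in> kvs.span B \<inter> ?J" by simp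
      then have "x - y = 0" unfolding disj by simp
      then show "x = y" by simp
    qed
    then have ind: "kvs.independent (\<pi> ` B)" and inj: "inj_on \<pi> B"
      using \<pi>.independent_injective_image[OF indB] inj_on_subset[OF _ kvs.span_superset] by auto
    have "\<pi> ` B \<subseteq> kvs.span ?M"
      using BU by (auto simp: span_pmon \<pi>_def keys_pfilter N_def homogeneous_part_def)
    then have 1: "card (\<pi> ` B) \<le> card ?M"
      using kvs.independent_span_bound[OF finite_imageI[OF finN] ind] by simp
    have "?M \<subseteq> kvs.span (\<pi> ` B)"
    proof
      fix p assume p: "p \<in> ?M"
      then have "p \<in> ?U" using qM by (auto simp: quot_basis_def)
      then obtain b where b: "b \<in> kvs.span B" "p - b \<in> ?J" using gen by blast
      have "\<pi> (p - b) = 0" using b(2) by (auto simp: \<pi>_def mem_mon_ideal intro!: pfilter_0)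
      moreover have "\<pi> p = p" using p by (auto simp: \<pi>_def N_def intro!: pfilter_id)
      ultimately have "p = \<pi> b" by (simp add: \<pi>.diff)
      then show "p \<in> kvs.span (\<pi> ` B)" using b(1) by (simp add: \<pi>.span_image)
    qed
    then have "card ?M \<le> card (\<pi> ` B)"
      using kvs.independent_span_bound[OF finite_imageI[OF fin] independent_pmon] by blast
    then show ?thesis using 1 cM card_image[OF inj] by simp
  qed
  then have uniq: "m = card N" if "\<exists>B. finite B \<and> card B = m \<and> quot_basis ?U ?J B" for m
    using that by blast
  have "\<exists>B. finite B \<and> card B = card N \<and> quot_basis ?U ?J B"
    using qM cM finite_imageI[OF finN] by blast
  then show ?thesis
    unfolding hilbert_fun_def N_def[symmetric] by (rule the_equality) (rule uniq)
qed

definition support_series :: "'v set \<Rightarrow> int fps" where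
  "support_series S = Abs_fps (\<lambda>d. int (card {m. keys m = S \<and> pp_degree m = d}))"

lemma support_series_empty: "support_series ({} :: 'v set) = 1"
proof (rule fps_ext)
  fix d
  have "{m :: 'v \<Rightarrow>\<^sub>0 nat. keys m = {} \<and> pp_degree m = d} = (if d = 0 then {0} else {})"
    by (auto simp: pp_degree_def)
  then have "card {m :: 'v \<Rightarrow>\<^sub>0 nat. keys m = {} \<and> pp_degree m = d}
      = card (if d = 0 then {0 :: 'v \<Rightarrow>\<^sub>0 nat} else {})" by (rule arg_cong[where f = card])
  also have "\<dots> = (if d = 0 then 1 else 0)" by simp
  finally have c: "card {m :: 'v \<Rightarrow>\<^sub>0 nat. keys m = {} \<and> pp_degree m = d} = (if d = 0 then 1 else 0)" .
  have "fps_nth (support_series ({} :: 'v set)) d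
      = int (card {m :: 'v \<Rightarrow>\<^sub>0 nat. keys m = {} \<and> pp_degree m = d})"
    unfolding support_series_def by (rule fps_nth_Abs_fps)
  also have "\<dots> = fps_nth 1 d" unfolding c by simp
  finally show "fps_nth (support_series ({} :: 'v set)) d = fps_nth 1 d" .
qed

text \<open>
  A power product of degree \<open>d + 1\<close> and support \<open>insert v S\<close> is \<open>x\<^sub>v\<close> times one of degree \<open>d\<close> whose support
  is either \<open>insert v S\<close> or \<open>S\<close>.
\<close>

lemma support_series_insert:
  fixes v :: "'v::finite"
  assumes "v \<notin> S"
  shows "support_series (insert v S) * (1 - fps_X) = fps_X * support_series S"
proof (rule fps_ext)
  fix d
  let ?A = "\<lambda>S d. {m :: 'v \<Rightarrow>\<^sub>0 nat. keys m = S \<and> pp_degree m = d}"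
  have fin: "finite (?A S d)" for S d
    by (rule finite_subset[OF _ finite_pp_degree[of d]]) auto
  have rec: "card (?A (insert v S) (Suc e)) = card (?A (insert v S) e) + card (?A S e)" for e
  proof -
    let ?f = "\<lambda>m. Poly_Mapping.single v (1::nat) + m"
    define X Y Z where "X = ?A (insert v S) (Suc e)" and "Y = ?A (insert v S) e" and "Z = ?A S e"
    have "X = ?f ` (Y \<union> Z)"
    proof (rule subset_antisym; rule subsetI)
      fix m assume "m \<in> X"
      then have m: "keys m = insert v S" "pp_degree m = Suc e" by (simp_all add: X_def)
      then have "\<forall>u. lookup (Poly_Mapping.single v 1) u \<le> lookup m u"
        using in_keys_iff[of v m] by (simp add: lookup_single when_def Suc_le_eq)
      then obtain m' where m': "m = ?f m'" unfolding add_dvd_iff[symmetric] by blast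
      have "pp_degree m' = e" using m(2) unfolding m' by (simp add: pp_degree_add)
      moreover have "insert v S = insert v (keys m')"
        using m(1) unfolding m' keys_add_nat by simp
      then have "keys m' = insert v S \<or> keys m' = S"
        using assms by (metis insert_absorb insert_ident)
      ultimately have "m' \<in> Y \<union> Z" unfolding Y_def Z_def by simp
      then show "m \<in> ?f ` (Y \<union> Z)" unfolding m' by (rule imageI)
    next
      fix m assume "m \<in> ?f ` (Y \<union> Z)"
      then show "m \<in> X"
        by (elim imageE UnE) (simp_all add: X_def Y_def Z_def keys_add_nat pp_degree_add)
    qed
    then have "card X = card (Y \<union> Z)"
      by (simp only: card_image[OF inj_onI[OF add_left_imp_eq]])
    moreover have "finite Y" "finite Z" unfolding Y_def Z_def by (rule fin)+
    moreover have "Y \<inter> Z = {}"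
    proof (rule equals0I)
      fix m assume "m \<in> Y \<inter> Z"
      then have "keys m = insert v S \<and> keys m = S" unfolding Y_def Z_def by blast
      then show False using assms by (metis insertI1)
    qed
    ultimately show ?thesis unfolding X_def[symmetric] Y_def[symmetric] Z_def[symmetric]
      by (simp add: card_Un_disjoint)
  qed
  show "fps_nth (support_series (insert v S) * (1 - fps_X)) d = fps_nth (fps_X * support_series S) d"
  proof (cases d)
    case 0
    have "card (?A (insert v S) 0) = 0"
    proof (rule card_eq_0_iff[THEN iffD2], rule disjI1, rule equals0I)
      fix m assume m: "m \<in> ?A (insert v S) 0"
      then have "pp_degree m = 0" "v \<in> keys m" by blast+
      then show False unfolding pp_degree_eq_0_iff by (metis empty_iff keys_zero)
    qed
    then show ?thesis by (simp add: 0 support_series_def algebra_simps)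
  next
    case (Suc e)
    then show ?thesis by (simp add: support_series_def algebra_simps rec)
  qed
qed

lemma support_series_eq:
  "support_series (S :: 'v::finite set) * (1 - fps_X) ^ card S = fps_X ^ card S"
proof (induction S rule: finite_induct[OF finite])
  case (2 v S)
  have "support_series (insert v S) * (1 - fps_X) ^ card (insert v S)
      = (support_series (insert v S) * (1 - fps_X)) * (1 - fps_X) ^ card S"
    using 2 by (simp add: mult_ac)
  also have "\<dots> = fps_X * (support_series S * (1 - fps_X) ^ card S)"
    unfolding support_series_insert[OF 2(2)] by (simp add: mult_ac)
  finally show ?case using 2 by simp
qed (simp add: support_series_empty)

lemma hilbert_series_support:
  "hilbert_series (mon_ideal (\<lambda>m. C (keys m)) :: ('v::finite, 'k::field) mpoly set)
    = (\<Sum>S | \<not> C S. support_series S)"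
proof (rule fps_ext)
  fix d
  have "{m :: 'v \<Rightarrow>\<^sub>0 nat. pp_degree m = d \<and> \<not> C (keys m)}
     = (\<Union>S\<in>{S. \<not> C S}. {m. keys m = S \<and> pp_degree m = d})" by auto
  also have "card \<dots> = (\<Sum>S | \<not> C S. card {m :: 'v \<Rightarrow>\<^sub>0 nat. keys m = S \<and> pp_degree m = d})"
  proof (rule card_UN_disjoint)
    show "\<forall>S\<in>{S. \<not> C S}. finite {m :: 'v \<Rightarrow>\<^sub>0 nat. keys m = S \<and> pp_degree m = d}"
      by (intro ballI finite_subset[OF _ finite_pp_degree[of d]]) auto
  qed auto
  finally show "fps_nth (hilbert_series (mon_ideal (\<lambda>m. C (keys m)) :: ('v, 'k) mpoly set)) d
     = fps_nth (\<Sum>S | \<not> C S. support_series S) d"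
    by (simp add: hilbert_series_def hilbert_fun_mon_ideal support_series_def fps_sum_nth)
qed

definition subset_weight :: "nat \<Rightarrow> 'v set \<Rightarrow> int poly" where
  "subset_weight n S = [:0, 1:] ^ card S * [:1, -1:] ^ (n - card S)"

text \<open>
  Each support \<open>S\<close> contributes \<open>(t/(1 - t))\<^bsup>|S|\<^esup>\<close> to the Hilbert series, and the power of \<open>1 - t\<close> prescribed by
  the Krull dimension clears all denominators as long as no \<open>S\<close> is larger than the dimension.
\<close>

lemma h_poly_support:
  fixes J :: "('v::finite, 'k::field) mpoly set"
  assumes J: "J = mon_ideal (\<lambda>m. C (keys m))"
    and small: "\<And>S. \<not> C S \<Longrightarrow> card S \<le> krull_dim_quot J"
  shows "h_poly J = (\<Sum>S | \<not> C S. subset_weight (krull_dim_quot J) S)" (is "_ = ?h")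
proof -
  let ?k = "krull_dim_quot J"
  have [simp]: "fps_of_poly [:0, 1:] = (fps_X :: int fps)" "fps_of_poly [:1, -1:] = (1 - fps_X :: int fps)"
    by (simp_all add: fps_of_poly_pCons)
  have "support_series S * (1 - fps_X) ^ ?k = fps_of_poly (subset_weight ?k S)" if "\<not> C S" for S :: "'v set"
  proof -
    obtain r where "?k = card S + r" using small[OF \<open>\<not> C S\<close>] le_Suc_ex by blast
    then show ?thesis
      by (simp add: subset_weight_def fps_of_poly_mult fps_of_poly_power power_add
          support_series_eq flip: mult.assoc)
  qed
  moreover have "hilbert_series J = (\<Sum>S | \<not> C S. support_series S)"
    unfolding J by (rule hilbert_series_support)
  ultimately have "hilbert_series J * (1 - fps_X) ^ ?k = fps_of_poly ?h"
    by (simp add: sum_distrib_right fps_of_poly_sum)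
  then show ?thesis unfolding h_poly_def
    by (intro the_equality) (auto simp: fps_of_poly_eq_iff)
qed

lemma sum_subset_weight: "(\<Sum>S\<in>Pow A. [:0, 1:] ^ card S * [:1, -1:] ^ (card A - card S)) = (1 :: int poly)" (is "?s = 1")
  if "finite A"
proof -
  have e: "[:0, 1:] + [:1, -1:] = (1 :: int poly)" by simp
  have "(\<Prod>v\<in>A. 1) = (\<Prod>v\<in>A. [:0, 1:] + [:1, -1:] :: int poly)" unfolding e by (rule refl)
  also have "\<dots> = (\<Sum>S\<in>Pow A. (\<Prod>v\<in>S. [:0, 1:]) * (\<Prod>v\<in>A - S. [:1, -1:]))"
    using that by (rule prod_add)
  also have "\<dots> = (\<Sum>S\<in>Pow A. [:0, 1:] ^ card S * [:1, -1:] ^ (card A - card S))"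
  proof (rule sum.cong[OF refl])
    fix S assume "S \<in> Pow A"
    then have "finite S" "S \<subseteq> A" using that finite_subset[of S A] by auto
    then show "(\<Prod>v\<in>S. [:0, 1:]) * (\<Prod>v\<in>A - S. [:1, -1:])
        = [:0, 1:] ^ card S * [:1, -1 :: int:] ^ (card A - card S)"
      by (simp add: card_Diff_subset)
  qed
  finally show ?thesis by simp
qed

section \<open>Krull dimension\<close>

text \<open>
  Polynomials in the variables \<open>S\<close> of degree at most \<open>K\<close> in each variable: a space of dimension
  \<open>(K + 1)\<^bsup>|S|\<^esup>\<close>, against which the products of given polynomials are counted.
\<close>

definition bounded_poly :: "'v set \<Rightarrow> nat \<Rightarrow> ('v, 'k::field) mpoly \<Rightarrow> bool" where
  "bounded_poly S K p \<longleftrightarrow> (\<forall>m\<in>keys p. keys m \<subseteq> S \<and> (\<forall>v. lookup m v \<le> K))"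

lemma bounded_poly_mult:
  fixes p q :: "('v, 'k::field) mpoly"
  assumes "bounded_poly S K p" "bounded_poly S L q" shows "bounded_poly S (K + L) (p * q)"
  unfolding bounded_poly_def
proof
  fix m assume "m \<in> keys (p * q)"
  then obtain s t where m: "m = s + t" "s \<in> keys p" "t \<in> keys q"
    using keys_mult[of p q] by blast
  then have "keys s \<subseteq> S" "keys t \<subseteq> S"
    and "\<And>v. lookup s v \<le> K" "\<And>v. lookup t v \<le> L"
    using assms unfolding bounded_poly_def by blast+
  then show "keys m \<subseteq> S \<and> (\<forall>v. lookup m v \<le> K + L)"
    unfolding m(1) keys_add_nat lookup_add by (simp add: add_mono)
qed

lemma bounded_poly_1: "bounded_poly S 0 (1 :: ('v, 'k::field) mpoly)"
  by (simp add: bounded_poly_def)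

lemma bounded_poly_mono: "bounded_poly S K p \<Longrightarrow> K \<le> L \<Longrightarrow> bounded_poly S L p"
  unfolding bounded_poly_def by (meson le_trans)

lemma bounded_poly_power:
  assumes "bounded_poly S K p" shows "bounded_poly S (n * K) (p ^ n)"
proof (induction n)
  case 0
  show ?case using bounded_poly_1 by simp
next
  case (Suc n)
  show ?case using bounded_poly_mult[OF assms Suc] by simp
qed

lemma bounded_poly_prod:
  assumes "finite I" "\<And>i. i \<in> I \<Longrightarrow> bounded_poly S K (p i)"
  shows "bounded_poly S (card I * K) (\<Prod>i\<in>I. p i)"
  using assms
proof (induction I rule: finite_induct)
  case empty
  show ?case using bounded_poly_1 by simp
next
  case (insert i I)
  then show ?case using bounded_poly_mult[of S K "p i" "card I * K" "prod p I"] by simp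
qed

lemma bounded_poly_exists:
  fixes p :: "('v::finite, 'k::field) mpoly"
  assumes "\<And>m. m \<in> keys p \<Longrightarrow> keys m \<subseteq> S"
  shows "\<exists>K. bounded_poly S K p"
proof
  show "bounded_poly S (\<Sum>m\<in>keys p. pp_degree m) p"
    unfolding bounded_poly_def
  proof (intro ballI conjI allI)
    fix m v assume m: "m \<in> keys p"
    show "keys m \<subseteq> S" by (rule assms[OF m])
    have "pp_degree m \<le> (\<Sum>m\<in>keys p. pp_degree m)"
      by (rule member_le_sum[OF m]) simp_all
    then show "lookup m v \<le> (\<Sum>m\<in>keys p. pp_degree m)"
      using pp_degree_ge_lookup[of m v] by (rule order_trans[rotated])
  qed
qed

lemma card_bounded_pps:
  fixes S :: "'v::finite set"
  defines "B \<equiv> \<lambda>K. {m :: 'v \<Rightarrow>\<^sub>0 nat. keys m \<subseteq> S \<and> (\<forall>v. lookup m v \<le> K)}"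
  shows "finite (B K)" "card (B K) \<le> (K + 1) ^ card S"
proof -
  let ?f = "\<lambda>m :: 'v \<Rightarrow>\<^sub>0 nat. restrict (lookup m) S"
  have inj: "inj_on ?f (B K)"
  proof (rule inj_onI)
    fix s t assume st: "s \<in> B K" "t \<in> B K" "?f s = ?f t"
    have "lookup s v = lookup t v" for v
    proof (cases "v \<in> S")
      case True
      then show ?thesis using fun_cong[OF st(3), of v] by simp
    next
      case False
      then have "v \<notin> keys s" "v \<notin> keys t" using st(1,2) by (auto simp: B_def)
      then show ?thesis by (simp add: in_keys_iff)
    qed
    then show "s = t" by (rule poly_mapping_eqI)
  qed
  have sub: "?f ` B K \<subseteq> S \<rightarrow>\<^sub>E {..K}" by (auto simp: B_def)
  have fin: "finite (S \<rightarrow>\<^sub>E {..K})" by (intro finite_PiE) simp_all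
  show "finite (B K)" using finite_imageD[OF finite_subset[OF sub fin] inj] .
  have "card (B K) = card (?f ` B K)" using card_image[OF inj] by simp
  also have "\<dots> \<le> card (S \<rightarrow>\<^sub>E {..K})" by (rule card_mono[OF fin sub])
  also have "\<dots> = (K + 1) ^ card S" by (simp add: card_PiE)
  finally show "card (B K) \<le> (K + 1) ^ card S" .
qed

text \<open>
  More polynomials than variables are algebraically dependent, by counting: the \<open>N\<^sup>l\<close> products of powers
  below \<open>N\<close> of \<open>l\<close> polynomials lie in a space whose dimension grows only like \<open>N\<^bsup>|S|\<^esup>\<close>. The relation
  is recorded by its nonempty set \<open>E\<close> of exponent vectors and their nonzero coefficients \<open>c\<close>.
\<close>

lemma algebraic_dependence:
  fixes a :: "nat \<Rightarrow> ('v::finite, 'k::field) mpoly"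
  assumes S: "card S < l"
    and a: "\<And>i m. i < l \<Longrightarrow> m \<in> keys (a i) \<Longrightarrow> keys m \<subseteq> S"
  shows "\<exists>E c. finite E \<and> E \<noteq> {} \<and> (\<forall>e\<in>E. c e \<noteq> (0::'k)) \<and>
    (\<forall>e\<in>E. \<forall>e'\<in>E. (\<forall>i\<in>{0..<l}. e i = e' i) \<longrightarrow> e = e') \<and>
    (\<Sum>e\<in>E. scal (c e) (\<Prod>i\<in>{0..<l}. a i ^ e i)) = 0"
proof -
  have "\<forall>i. \<exists>K. i < l \<longrightarrow> bounded_poly S K (a i)" using bounded_poly_exists a by meson
  then obtain K where K: "\<And>i. i < l \<Longrightarrow> bounded_poly S (K i) (a i)" by metis
  define D where "D = (\<Sum>i<l. K i)"
  have D: "bounded_poly S D (a i)" if "i < l" for i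
    unfolding D_def using that by (intro bounded_poly_mono[OF K[OF that]] member_le_sum) simp_all
  \<comment> \<open>With this choice \<open>(l * N * D + 1) ^ card S \<le> N ^ card S * (l * D + 1) ^ card S < N ^ l\<close>.\<close>
  define N where "N = (l * D + 1) ^ card S + 1"
  define X where "X = {0..<l} \<rightarrow>\<^sub>E {..<N}"
  define f where "f e = (\<Prod>i\<in>{0..<l}. a i ^ e i)" for e
  have finX: "finite X" and cardX: "card X = N ^ l"
    unfolding X_def by (simp_all add: finite_PiE card_PiE)
  have ext: "e = e'" if "e \<in> X" "e' \<in> X" "\<forall>i\<in>{0..<l}. e i = e' i" for e e'
    using that unfolding X_def by (intro PiE_ext) auto
  have "\<exists>E c. E \<subseteq> X \<and> E \<noteq> {} \<and> (\<forall>e\<in>E. c e \<noteq> (0::'k)) \<and> (\<Sum>e\<in>E. scal (c e) (f e)) = 0"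
  proof (cases "inj_on f X")
    case False
    then obtain e e' where e: "e \<in> X" "e' \<in> X" "e \<noteq> e'" "f e = f e'" unfolding inj_on_def by blast
    \<comment> \<open>Two equal products already form a relation with coefficients 1 and -1.\<close>
    have "(\<Sum>x\<in>{e, e'}. scal (if x = e then 1 else - 1) (f x)) = 0"
      using e by (simp add: kvs.scale_minus_left)
    then show ?thesis using e
      by (intro exI[of _ "{e, e'}"] exI[of _ "\<lambda>x. if x = e then 1 else - 1"]) simp
  next
    case True
    let ?B = "{m :: 'v \<Rightarrow>\<^sub>0 nat. keys m \<subseteq> S \<and> (\<forall>v. lookup m v \<le> l * (N * D))}"
    have sub: "f ` X \<subseteq> kvs.span (pmon ` ?B)"
    proof
      fix p assume "p \<in> f ` X"
      then obtain e where e: "e \<in> X" "p = f e" by blast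
      have "bounded_poly S (N * D) (a i ^ e i)" if "i \<in> {0..<l}" for i
      proof (rule bounded_poly_mono)
        show "bounded_poly S (e i * D) (a i ^ e i)" using D that by (intro bounded_poly_power) simp
        have "e i < N" using e(1) that unfolding X_def by auto
        then show "e i * D \<le> N * D" by simp
      qed
      then have "bounded_poly S (l * (N * D)) p"
        unfolding e(2) f_def using bounded_poly_prod[of "{0..<l}" S "N * D" "\<lambda>i. a i ^ e i"] by simp
      then show "p \<in> kvs.span (pmon ` ?B)" unfolding span_pmon bounded_poly_def by blast
    qed
    have "card ?B \<le> (l * (N * D) + 1) ^ card S" by (rule card_bounded_pps(2))
    also have "\<dots> \<le> (N * (l * D + 1)) ^ card S"
      by (rule power_mono) (simp_all add: N_def algebra_simps)
    also have "\<dots> = N ^ card S * (l * D + 1) ^ card S" by (rule power_mult_distrib)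
    also have "\<dots> < N ^ card S * N" by (rule mult_strict_left_mono) (simp_all add: N_def)
    also have "\<dots> = N ^ Suc (card S)" by simp
    also have "\<dots> \<le> N ^ l" using S by (intro power_increasing) (simp_all add: N_def)
    finally have lt: "card ?B < card (f ` X)" using card_image[OF True] cardX by simp
    have "kvs.dependent (f ` X)"
    proof (rule ccontr)
      assume ind: "kvs.independent (f ` X)"
      have "card (f ` X) \<le> card (pmon ` ?B :: ('v, 'k) mpoly set)"
        using kvs.independent_span_bound[OF _ ind sub] card_bounded_pps(1)[of S] by blast
      also have "\<dots> \<le> card ?B" by (rule card_image_le[OF card_bounded_pps(1)])
      finally show False using lt by simp
    qed
    then obtain t u v where t: "finite t" "t \<subseteq> f ` X" "(\<Sum>v\<in>t. scal (u v) v) = 0" and v: "v \<in> t" "u v \<noteq> 0"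
      unfolding kvs.dependent_explicit by blast
    define E where "E = {e \<in> X. f e \<in> t \<and> u (f e) \<noteq> 0}"
    have img: "f ` E = {v \<in> t. u v \<noteq> 0}" using t(2) by (auto simp: E_def)
    have "(\<Sum>e\<in>E. scal (u (f e)) (f e)) = (\<Sum>v\<in>f ` E. scal (u v) v)"
      using inj_on_subset[OF True, of E] by (subst sum.reindex) (auto simp: E_def)
    also have "\<dots> = (\<Sum>v\<in>t. scal (u v) v)"
      unfolding img using t(1) by (intro sum.mono_neutral_left) auto
    finally have "(\<Sum>e\<in>E. scal (u (f e)) (f e)) = 0" using t(3) by simp
    moreover have "E \<noteq> {}" using v img by blast
    ultimately show ?thesis
      by (intro exI[of _ E] exI[of _ "\<lambda>e. u (f e)"]) (auto simp: E_def)
  qed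
  then obtain E c where E: "E \<subseteq> X" "E \<noteq> {}" "\<forall>e\<in>E. c e \<noteq> (0::'k)" "(\<Sum>e\<in>E. scal (c e) (f e)) = 0"
    by blast
  show ?thesis
    by (rule exI[of _ E], rule exI[of _ c], intro conjI)
      (use E finite_subset[OF E(1) finX] ext in \<open>auto simp: f_def subset_iff\<close>)
qed

lemma prime_idealD:
  assumes "prime_ideal P"
  shows "ideal.subspace P" "1 \<notin> P" "a * b \<in> P \<Longrightarrow> a \<in> P \<or> b \<in> P"
proof -
  show s: "ideal.subspace P" and "a * b \<in> P \<Longrightarrow> a \<in> P \<or> b \<in> P" using assms by (auto simp: prime_ideal_def)
  show "1 \<notin> P"
  proof
    assume "1 \<in> P"
    then have "c \<in> P" for c using ideal.subspace_scale[OF s, of 1 c] by simp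
    then show False using assms by (auto simp: prime_ideal_def)
  qed
qed

lemma mult_right_swap: "(x * y) * z = (x * z) * (y :: 'a::comm_semiring_1)"
  by (simp add: algebra_simps)

lemma prime_ideal_power:
  assumes "prime_ideal P" "a \<notin> P" "a ^ n * b \<in> P" shows "b \<in> P"
  using assms(3)
proof (induction n)
  case (Suc n)
  then have "a * (a ^ n * b) \<in> P" by (simp only: power_Suc mult.assoc)
  then have "a ^ n * b \<in> P" using prime_idealD(3)[OF assms(1)] assms(2) by blast
  then show ?case by (rule Suc.IH)
qed simp

lemma prime_ideal_prod:
  assumes "prime_ideal P" "finite A" "(\<Prod>v\<in>A. f v) \<in> P" shows "\<exists>v\<in>A. f v \<in> P"
  using assms(2,3)
proof (induction A rule: finite_induct)
  case empty
  then show ?case using prime_idealD(2)[OF assms(1)] by simp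
next
  case (insert v A)
  then show ?case using prime_idealD(3)[OF assms(1), of "f v" "prod f A"] by auto
qed

text \<open>
  Elements picked from the successive gaps of a chain of primes satisfy no algebraic relation; this is
  the elementary criterion for the Krull dimension due to Coquand and Lombardi. In a relation modulo
  \<open>P j\<close>, cancel the lowest power of \<open>a j\<close>, which is possible as \<open>a j \<notin> P j\<close>. Modulo \<open>P (Suc j)\<close>, which contains
  \<open>a j\<close>, only the terms with exactly this power survive, and they form a relation among the later elements.
\<close>

lemma chain_independent:
  fixes P :: "nat \<Rightarrow> ('v, 'k::field) mpoly set"
  assumes P: "\<And>i. i \<le> l \<Longrightarrow> prime_ideal (P i)" and sub: "\<And>i. i < l \<Longrightarrow> P i \<subseteq> P (Suc i)"
    and a: "\<And>i. i < l \<Longrightarrow> a i \<in> P (Suc i)" "\<And>i. i < l \<Longrightarrow> a i \<notin> P i"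
    and "j \<le> l" "finite E" "E \<noteq> {}" "\<And>e. e \<in> E \<Longrightarrow> c e \<noteq> (0::'k)"
    and "\<And>e e'. e \<in> E \<Longrightarrow> e' \<in> E \<Longrightarrow> (\<And>i. i \<in> {j..<l} \<Longrightarrow> e i = e' i) \<Longrightarrow> e = e'"
  shows "(\<Sum>e\<in>E. scal (c e) (\<Prod>i\<in>{j..<l}. a i ^ e i)) \<notin> P j"
  using assms(5-)
proof (induction "l - j" arbitrary: j E)
  case 0
  then have j: "j = l" by simp
  obtain e where e: "e \<in> E" using 0 by blast
  have "E = {e}" using 0(6) e unfolding j by auto
  then have eq: "(\<Sum>e\<in>E. scal (c e) (\<Prod>i\<in>{j..<l}. a i ^ e i)) = scal (c e) 1" by (simp add: j)
  show ?case
  proof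
    assume "(\<Sum>e\<in>E. scal (c e) (\<Prod>i\<in>{j..<l}. a i ^ e i)) \<in> P j"
    then have "scal (c e) 1 \<in> P j" by (simp only: eq)
    then have "scal (c e) 1 \<in> P l" by (simp only: j)
    then have "Poly_Mapping.single 0 (1 / c e) * scal (c e) 1 \<in> P l"
      using ideal.subspace_scale[OF prime_idealD(1)[OF P]] by blast
    then have "scal (1 / c e) (scal (c e) 1) \<in> P l" by (simp add: scal_def)
    then have "1 \<in> P l" using 0(5)[OF e] by simp
    then show False using prime_idealD(2)[OF P] by blast
  qed
next
  case (Suc n)
  then have jl: "j < l" by simp
  have prj: "prime_ideal (P j)" and prj1: "prime_ideal (P (Suc j))" using P jl by simp_all
  note sj1 = prime_idealD(1)[OF prj1]
  define n0 where "n0 = Min ((\<lambda>e. e j) ` E)"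
  have n0: "n0 \<le> e j" if "e \<in> E" for e using that Suc.prems(2) unfolding n0_def by simp
  define E' where "E' = {e \<in> E. e j = n0}"
  have "n0 \<in> (\<lambda>e. e j) ` E" unfolding n0_def using Suc.prems(2,3) by (intro Min_in) auto
  then have E'ne: "E' \<noteq> {}" by (auto simp: E'_def)
  define r where "r e = scal (c e) (\<Prod>i\<in>{Suc j..<l}. a i ^ e i)" for e
  have split: "scal (c e) (\<Prod>i\<in>{j..<l}. a i ^ e i) = a j ^ n0 * (a j ^ (e j - n0) * r e)" if "e \<in> E" for e
  proof -
    have "(\<Prod>i\<in>{j..<l}. a i ^ e i) = a j ^ e j * (\<Prod>i\<in>{Suc j..<l}. a i ^ e i)"
      using jl by (simp add: prod.atLeast_Suc_lessThan)
    also have "a j ^ e j = a j ^ n0 * a j ^ (e j - n0)" using n0[OF that] by (simp flip: power_add)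
    finally have "scal (c e) (\<Prod>i\<in>{j..<l}. a i ^ e i)
        = Poly_Mapping.single 0 (c e) * ((a j ^ n0 * a j ^ (e j - n0)) * (\<Prod>i\<in>{Suc j..<l}. a i ^ e i))"
      by (simp add: scal_def)
    also have "\<dots> = a j ^ n0 * (a j ^ (e j - n0) * r e)"
      unfolding r_def scal_def by (simp only: mult.assoc mult.left_commute)
    finally show ?thesis .
  qed
  show ?case
  proof
    assume "(\<Sum>e\<in>E. scal (c e) (\<Prod>i\<in>{j..<l}. a i ^ e i)) \<in> P j"
    moreover have "(\<Sum>e\<in>E. scal (c e) (\<Prod>i\<in>{j..<l}. a i ^ e i)) = a j ^ n0 * (\<Sum>e\<in>E. a j ^ (e j - n0) * r e)"
      unfolding sum_distrib_left by (intro sum.cong refl split)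
    ultimately have "(\<Sum>e\<in>E. a j ^ (e j - n0) * r e) \<in> P j"
      using prime_ideal_power[OF prj a(2)[OF jl]] by simp
    then have mem: "(\<Sum>e\<in>E. a j ^ (e j - n0) * r e) \<in> P (Suc j)" using sub[OF jl] by blast
    have "a j ^ (e j - n0) * r e \<in> P (Suc j)" if e: "e \<in> E - E'" for e
    proof -
      have "e j - n0 \<noteq> 0" using e n0[of e] by (auto simp: E'_def)
      then obtain k where k: "e j - n0 = Suc k" using not0_implies_Suc by blast
      have eq: "a j ^ (e j - n0) * r e = (a j ^ k * r e) * a j"
        unfolding k power_Suc2 by (rule mult_right_swap)
      show ?thesis unfolding eq by (rule ideal.subspace_scale[OF sj1 a(1)[OF jl]])
    qed
    then have "(\<Sum>e\<in>E - E'. a j ^ (e j - n0) * r e) \<in> P (Suc j)" by (rule ideal.subspace_sum[OF sj1])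
    moreover have "(\<Sum>e\<in>E. a j ^ (e j - n0) * r e)
        = (\<Sum>e\<in>E - E'. a j ^ (e j - n0) * r e) + (\<Sum>e\<in>E'. a j ^ (e j - n0) * r e)"
      using Suc.prems(2) by (intro sum.subset_diff) (auto simp: E'_def)
    moreover have "(\<Sum>e\<in>E'. a j ^ (e j - n0) * r e) = (\<Sum>e\<in>E'. r e)"
      by (intro sum.cong refl) (simp add: E'_def)
    ultimately have "(\<Sum>e\<in>E'. r e) \<in> P (Suc j)"
      using ideal.subspace_diff[OF sj1 mem] by fastforce
    moreover have "(\<Sum>e\<in>E'. scal (c e) (\<Prod>i\<in>{Suc j..<l}. a i ^ e i)) \<notin> P (Suc j)"
    proof (rule Suc.hyps(1))
      show "n = l - Suc j" using Suc.hyps(2) by simp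
      show "Suc j \<le> l" using jl by simp
      show "finite E'" "E' \<noteq> {}" using Suc.prems(2) E'ne by (simp_all add: E'_def)
      show "c e \<noteq> 0" if "e \<in> E'" for e using that Suc.prems(4) by (simp add: E'_def)
      fix e e' assume e: "e \<in> E'" "e' \<in> E'" and eq: "\<And>i. i \<in> {Suc j..<l} \<Longrightarrow> e i = e' i"
      show "e = e'"
      proof (rule Suc.prems(5))
        show "e \<in> E" "e' \<in> E" using e by (simp_all add: E'_def)
        show "e i = e' i" if "i \<in> {j..<l}" for i
          using e eq[of i] that by (cases "i = j") (simp_all add: E'_def)
      qed
    qed
    ultimately show False unfolding r_def by blast
  qed
qed

text \<open>
  Representatives of the gaps of the chain can be chosen in the polynomial ring on the variables outside
  \<open>P 0\<close>, since all terms that involve another variable already belong to \<open>P 0\<close>. If the chain were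
  longer than the number of these variables, the representatives would be algebraically dependent.
\<close>

lemma prime_chain_length:
  fixes P :: "nat \<Rightarrow> ('v::finite, 'k::field) mpoly set"
  assumes P: "\<And>i. i \<le> l \<Longrightarrow> prime_ideal (P i)" and sub: "\<And>i. i < l \<Longrightarrow> P i \<subset> P (Suc i)"
  shows "l \<le> card {v. var v \<notin> P 0}"
proof (rule ccontr)
  assume "\<not> l \<le> card {v. var v \<notin> P 0}"
  define S where "S = {v. var v \<notin> P 0}"
  have S: "card S < l" using \<open>\<not> _\<close> by (simp add: S_def)
  have P0: "P 0 \<subseteq> P i" if "i \<le> l" for i
    using that
  proof (induction i)
    case (Suc i)
    then show ?case using sub[of i] by auto
  qed simp
  have "\<forall>i. \<exists>b. i < l \<longrightarrow> b \<in> P (Suc i) \<and> b \<notin> P i" using sub by blast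
  then obtain b where b: "\<And>i. i < l \<Longrightarrow> b i \<in> P (Suc i)" "\<And>i. i < l \<Longrightarrow> b i \<notin> P i" by metis
  let ?K = "\<lambda>m. keys m \<subseteq> S"
  define a where "a i = pfilter ?K (b i)" for i
  have rest: "pfilter (\<lambda>m. \<not> ?K m) p \<in> P 0" for p
  proof (rule subspace_memI_keys[OF prime_idealD(1)[OF P]])
    fix m assume "m \<in> keys (pfilter (\<lambda>m. \<not> ?K m) p)"
    then obtain v where v: "v \<in> keys m" "v \<notin> S" by (auto simp: keys_pfilter)
    then obtain s where "m = sqf {v} + s" using sqf_dvd_iff[of "{v}" m] by auto
    then have eq: "pmon m = pmon s * var v"
      by (simp add: pmon_add var_eq_pmon sqf_def mult.commute)
    have "var v \<in> P 0" using v by (simp add: S_def)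
    then show "pmon m \<in> P 0" unfolding eq by (rule ideal.subspace_scale[OF prime_idealD(1)[OF P[of 0]], rotated]) simp
  qed simp
  have ab: "a i = b i - pfilter (\<lambda>m. \<not> ?K m) (b i)" "b i = a i + pfilter (\<lambda>m. \<not> ?K m) (b i)" for i
    using pfilter_split[of ?K "b i"] unfolding a_def by (simp_all add: eq_diff_eq)
  have a1: "a i \<in> P (Suc i)" if "i < l" for i
    unfolding ab(1) using that b(1)[OF that] rest P0[of "Suc i"] prime_idealD(1)[OF P, of "Suc i"]
    by (intro ideal.subspace_diff) auto
  have a2: "a i \<notin> P i" if "i < l" for i
  proof
    assume "a i \<in> P i"
    then have "b i \<in> P i"
      using that rest P0[of i] prime_idealD(1)[OF P, of i]
      by (subst ab(2)) (intro ideal.subspace_add; auto)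
    then show False using b(2)[OF that] by simp
  qed
  have keys_a: "keys m \<subseteq> S" if "m \<in> keys (a i)" for i m
    using that by (simp add: a_def keys_pfilter)
  obtain E c where E: "finite E" "E \<noteq> {}" "\<forall>e\<in>E. c e \<noteq> (0::'k)"
      "\<forall>e\<in>E. \<forall>e'\<in>E. (\<forall>i\<in>{0..<l}. e i = e' i) \<longrightarrow> e = e'"
      "(\<Sum>e\<in>E. scal (c e) (\<Prod>i\<in>{0..<l}. a i ^ e i)) = 0"
    using algebraic_dependence[OF S, of a] keys_a by blast
  have "(\<Sum>e\<in>E. scal (c e) (\<Prod>i\<in>{0..<l}. a i ^ e i)) \<notin> P 0"
  proof (rule chain_independent[OF P])
    show "P i \<subseteq> P (Suc i)" if "i < l" for i using sub[OF that] by blast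
    show "e = e'" if "e \<in> E" "e' \<in> E" "\<And>i. i \<in> {0..<l} \<Longrightarrow> e i = e' i" for e e'
      using E(4) that by blast
  qed (use a1 a2 E in auto)
  then show False unfolding E(5) using ideal.subspace_0[OF prime_idealD(1)[OF P]] by simp
qed

lemma prime_ideal_variables:
  "prime_ideal (mon_ideal (\<lambda>m. \<not> keys m \<subseteq> T) :: ('v::finite, 'k::field) mpoly set)"
  (is "prime_ideal ?P")
  unfolding prime_ideal_def
proof (intro conjI allI impI)
  show s: "ideal.subspace ?P" by (rule subspace_mon_ideal) (auto simp: keys_add_nat)
  have "1 \<notin> ?P" by (simp add: mem_mon_ideal)
  then show "?P \<noteq> UNIV" by blast
  let ?K = "\<lambda>m. keys m \<subseteq> T"
  fix a b :: "('v, 'k) mpoly" assume ab: "a * b \<in> ?P"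
  show "a \<in> ?P \<or> b \<in> ?P"
  proof (rule ccontr)
    assume "\<not> (a \<in> ?P \<or> b \<in> ?P)"
    then have nz: "pfilter ?K a \<noteq> 0" "pfilter ?K b \<noteq> 0"
      unfolding mem_mon_ideal by (metis in_keys_iff lookup_pfilter lookup_zero)+
    have in_P: "pfilter (\<lambda>m. \<not> ?K m) p \<in> ?P" for p :: "('v, 'k) mpoly"
      by (simp add: mem_mon_ideal keys_pfilter)
    have eq: "pfilter ?K a * pfilter ?K b
        = a * b - (pfilter ?K a * pfilter (\<lambda>m. \<not> ?K m) b + b * pfilter (\<lambda>m. \<not> ?K m) a)"
    proof -
      have "a * b = pfilter ?K a * b + pfilter (\<lambda>m. \<not> ?K m) a * b"
        using pfilter_split[of ?K a] by (metis distrib_right)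
      also have "pfilter ?K a * b = pfilter ?K a * pfilter ?K b + pfilter ?K a * pfilter (\<lambda>m. \<not> ?K m) b"
        using pfilter_split[of ?K b] by (metis distrib_left)
      finally show ?thesis by (simp add: mult.commute[of b])
    qed
    have "pfilter ?K a * pfilter ?K b \<in> ?P"
      unfolding eq by (intro ideal.subspace_diff[OF s ab] ideal.subspace_add[OF s] ideal.subspace_scale[OF s] in_P)
    moreover have "?K m" if m: "m \<in> keys (pfilter ?K a * pfilter ?K b)" for m
    proof -
      obtain s t where "m = s + t" "s \<in> keys (pfilter ?K a)" "t \<in> keys (pfilter ?K b)"
        using m keys_mult by blast
      then show ?thesis by (simp add: keys_pfilter keys_add_nat)
    qed
    ultimately have "keys (pfilter ?K a * pfilter ?K b) = {}" unfolding mem_mon_ideal by blast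
    then have "pfilter ?K a * pfilter ?K b = 0" by (metis in_keys_iff empty_iff poly_mapping_eqI lookup_zero)
    then show False using mpoly_no_zero_divisors nz by blast
  qed
qed

text \<open>
  If \<open>P 0\<close> is a prime above the ideal, the variables outside \<open>P 0\<close> form a set without \<open>C\<close>, because their
  product is not in \<open>P 0\<close>; this bounds the length of chains. A set \<open>S0\<close> of maximal size is exhausted by a
  chain of ideals generated by variables, starting with the variables outside \<open>S0\<close>.
\<close>

theorem krull_dim_quot_mon_ideal:
  fixes C :: "'v::finite set \<Rightarrow> bool"
  defines "J \<equiv> mon_ideal (\<lambda>m. C (keys m)) :: ('v, 'k::field) mpoly set"
  assumes mono: "\<And>S T. C S \<Longrightarrow> S \<subseteq> T \<Longrightarrow> C T"
    and le: "\<And>S. \<not> C S \<Longrightarrow> card S \<le> k" and S0: "\<not> C S0" "card S0 = k"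
  shows "krull_dim_quot J = k"
  unfolding krull_dim_quot_def
proof (rule cSup_eq_maximum)
  obtain xs where xs: "set xs = S0" "distinct xs" using finite_distinct_list[of S0] by auto
  have len: "length xs = k" using distinct_card[OF xs(2)] xs(1) S0(2) by simp
  define P where "P i = (mon_ideal (\<lambda>m. \<not> keys m \<subseteq> set (drop i xs)) :: ('v, 'k) mpoly set)" for i
  have "prime_ideal (P i) \<and> J \<subseteq> P i" for i
  proof
    show "prime_ideal (P i)" unfolding P_def by (rule prime_ideal_variables)
    show "J \<subseteq> P i"
    proof
      fix p assume p: "p \<in> J"
      show "p \<in> P i" unfolding P_def mem_mon_ideal
      proof (intro ballI notI)
        fix m assume m: "m \<in> keys p" "keys m \<subseteq> set (drop i xs)"
        have "C (keys m)" using p m(1) unfolding J_def mem_mon_ideal by blast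
        moreover have "keys m \<subseteq> S0" using m(2) set_drop_subset[of i xs] xs(1) by blast
        ultimately show False using mono S0(1) by blast
      qed
    qed
  qed
  moreover have "P i \<subset> P (Suc i)" if i: "i < k" for i
  proof
    have d: "drop i xs = xs ! i # drop (Suc i) xs" using i len by (simp add: Cons_nth_drop_Suc)
    have "distinct (drop i xs)" using xs(2) by simp
    then have n: "xs ! i \<notin> set (drop (Suc i) xs)" unfolding d by simp
    show "P i \<subseteq> P (Suc i)"
    proof
      fix p assume "p \<in> P i"
      then show "p \<in> P (Suc i)" unfolding P_def mem_mon_ideal d by (meson set_subset_Cons subset_trans)
    qed
    have "pmon (sqf {xs ! i}) \<in> P (Suc i)" "pmon (sqf {xs ! i}) \<notin> P i"
      using n by (simp_all add: P_def mem_mon_ideal keys_sqf d)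
    then show "P i \<noteq> P (Suc i)" by blast
  qed
  ultimately show "k \<in> {l. \<exists>P :: nat \<Rightarrow> ('v, 'k) mpoly set.
     (\<forall>i\<le>l. prime_ideal (P i) \<and> J \<subseteq> P i) \<and> (\<forall>i<l. P i \<subset> P (Suc i))}" by blast
next
  fix l assume "l \<in> {l. \<exists>P :: nat \<Rightarrow> ('v, 'k) mpoly set.
     (\<forall>i\<le>l. prime_ideal (P i) \<and> J \<subseteq> P i) \<and> (\<forall>i<l. P i \<subset> P (Suc i))}"
  then obtain P :: "nat \<Rightarrow> ('v, 'k) mpoly set"
    where P: "\<And>i. i \<le> l \<Longrightarrow> prime_ideal (P i)" "J \<subseteq> P 0" "\<And>i. i < l \<Longrightarrow> P i \<subset> P (Suc i)" by blast
  let ?S = "{v. var v \<notin> P 0}"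
  have "\<not> C ?S"
  proof
    assume "C ?S"
    then have "pmon (sqf ?S) \<in> J" by (simp add: J_def mem_mon_ideal keys_sqf)
    then have "(\<Prod>v\<in>?S. var v) \<in> P 0" using P(2) by (auto simp: pmon_sqf)
    then show False using prime_ideal_prod[OF P(1)[of 0], of ?S var] by simp
  qed
  then show "l \<le> k" using le[of ?S] prime_chain_length[of l P, OF P(1) P(3)] by linarith
qed

section \<open>Uniqueness of the degrees in a minimal resolution\<close>

lemma lookup_mult_0:
  fixes a b :: "('v, 'k::field) mpoly"
  shows "lookup (a * b) 0 = lookup a 0 * lookup b 0"
proof -
  have z: "0 = l + q \<longleftrightarrow> l = 0 \<and> q = 0" for l q :: "'v \<Rightarrow>\<^sub>0 nat"
    by (metis add_is_0 pp_degree_add pp_degree_eq_0_iff)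
  have "lookup (a * b) 0 = (\<Sum>l\<in>keys a. \<Sum>q\<in>keys b.
       if l = 0 \<and> q = 0 then lookup a 0 * lookup b 0 else 0)"
    unfolding lookup_mult_keys z by (intro sum.cong refl) auto
  also have "\<dots> = (\<Sum>l\<in>keys a. if l = 0 then 
       lookup a 0 * lookup b 0 else 0)"
    by (intro sum.cong refl) (auto simp: in_keys_iff)
  also have "\<dots> = lookup a 0 * lookup b 0"
    by (auto simp: in_keys_iff)
  finally show ?thesis .
qed

text \<open>
  Homogeneous maps of degree 0 between graded free modules with generators in degrees \<open>es\<close> and \<open>ds\<close>.
\<close>

definition hom_mat :: "nat list \<Rightarrow> nat list \<Rightarrow> ('v, 'k::field) mpoly mat \<Rightarrow> bool" where
  "hom_mat ds es M \<longleftrightarrow> M \<in> carrier_mat (length ds) (length es) \<and>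
     (\<forall>a<length ds. \<forall>b<length es. \<forall>m\<in>keys (M $$ (a, b)). pp_degree m + ds ! a = es ! b)"

lemma hom_matD:
  assumes "hom_mat ds es M"
  shows "M \<in> carrier_mat (length ds) (length es)"
    "a < length ds \<Longrightarrow> b < length es \<Longrightarrow> m \<in> keys (M $$ (a, b)) \<Longrightarrow> pp_degree m + ds ! a = es ! b"
  using assms by (auto simp: hom_mat_def)

lemma mat_mult_entry:
  "A \<in> carrier_mat n m \<Longrightarrow> B \<in> carrier_mat m k \<Longrightarrow> a < n \<Longrightarrow> b < k \<Longrightarrow>
    (A * B) $$ (a, b) = (\<Sum>c<m. A $$ (a, c) * B $$ (c, b))"
  by (auto simp: scalar_prod_def lessThan_atLeast0)

lemma hom_mat_mult:
  assumes "hom_mat ds es A" "hom_mat es fs B"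
  shows "hom_mat ds fs (A * B)"
  unfolding hom_mat_def
proof (intro conjI allI impI ballI)
  note c = hom_matD(1)[OF assms(1)] hom_matD(1)[OF assms(2)]
  show "A * B \<in> carrier_mat (length ds) (length fs)" using c by auto
  fix a b m assume ab: "a < length ds" "b < length fs"
    and "m \<in> keys ((A * B) $$ (a, b))"
  then have "m \<in> keys (\<Sum>c<length es. A $$ (a, c) * B $$ (c, b))"
    using mat_mult_entry[OF c ab] by simp
  then obtain c where "c < length es" "m \<in> keys (A $$ (a, c) * B $$ (c, b))"
    using Poly_Mapping.keys_sum[of "\<lambda>c. A $$ (a, c) * B $$ (c, b)" "{..<length es}"] by blast
  moreover then obtain l q where "m = l + q" "l \<in> keys (A $$ (a, c))"
      "q \<in> keys (B $$ (c, b))"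
    using keys_mult by blast
  ultimately show "pp_degree m + ds ! a = fs ! b"
    using hom_matD(2)[OF assms(1), of a c l] hom_matD(2)[OF assms(2), of c b q] ab
    by (simp add: pp_degree_add)
qed

text \<open>
  The homogeneous components of the right degrees of any solution form a homogeneous solution.
\<close>

lemma homogeneous_solution:
  assumes A: "hom_mat ds es A" and X: "hom_mat ds fs X"
    and Y: "Y \<in> carrier_mat (length es) (length fs)" and eq: "A * Y = X"
  shows "\<exists>Z. hom_mat es fs Z \<and> A * Z = X"
proof -
  note cA = hom_matD(1)[OF A] and cX = hom_matD(1)[OF X]
  define Z where "Z = mat (length es) (length fs)
    (\<lambda>(c, b). pfilter (\<lambda>m. pp_degree m + es ! c = fs ! b) (Y $$ (c, b)))"
  have cZ: "Z \<in> carrier_mat (length es) (length fs)" by (simp add: Z_def)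
  have "hom_mat es fs Z" using cZ by (auto simp: hom_mat_def Z_def keys_pfilter)
  moreover have "A * Z = X"
  proof (rule eq_matI)
    fix a b assume "a < dim_row X" "b < dim_col X"
    then have ab: "a < length ds" "b < length fs" using cX by auto
    have "(A * Z) $$ (a, b) = (\<Sum>c<length es. A $$ (a, c) * Z $$ (c, b))"
      by (rule mat_mult_entry[OF cA cZ ab])
    also have "\<dots> = (\<Sum>c<length es. pfilter (\<lambda>m. pp_degree m + ds ! a = fs ! b) (A $$ (a, c) * Y $$ (c, b)))"
    proof (intro sum.cong refl)
      fix c assume c: "c \<in> {..<length es}"
      show "A $$ (a, c) * Z $$ (c, b) = pfilter (\<lambda>m. pp_degree m + ds ! a = fs ! b) (A $$ (a, c) * Y $$ (c, b))"
        using hom_matD(2)[OF A ab(1), of c] c ab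
        by (subst pfilter_mult[where P' = "\<lambda>m. pp_degree m + es ! c = fs ! b"])
           (fastforce simp: Z_def pp_degree_add)+
    qed
    also have "\<dots> = pfilter (\<lambda>m. pp_degree m + ds ! a = fs ! b) ((A * Y) $$ (a, b))"
      by (simp add: mat_mult_entry[OF cA Y ab] pfilter_sum)
    also have "\<dots> = X $$ (a, b)"
      unfolding eq using hom_matD(2)[OF X ab] by (intro pfilter_id)
    finally show "(A * Z) $$ (a, b) = X $$ (a, b)" .
  qed (use cA cX cZ in auto)
  ultimately show ?thesis by blast
qed

lemma solve_columnwise:
  fixes A :: "'a::comm_ring_1 mat"
  assumes A: "A \<in> carrier_mat n m" and X: "X \<in> carrier_mat n k"
    and sol: "\<And>b. b < k \<Longrightarrow> \<exists>y\<in>carrier_vec m. A *\<^sub>v y = col X b"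
  shows "\<exists>Y\<in>carrier_mat m k. A * Y = X"
proof -
  obtain y where y: "\<And>b. b < k \<Longrightarrow> y b \<in> carrier_vec m \<and> A *\<^sub>v y b = col X b"
    using sol by metis
  define Y where "Y = mat m k (\<lambda>(a, b). y b $ a)"
  have Y: "Y \<in> carrier_mat m k" by (simp add: Y_def)
  have colY: "col Y b = y b" if "b < k" for b
    using y[OF that] that by (intro eq_vecI) (auto simp: Y_def)
  have "A * Y = X"
  proof (rule eq_matI)
    fix a b assume "a < dim_row X" "b < dim_col X"
    then have ab: "a < n" "b < k" using X by auto
    have "(A * Y) $$ (a, b) = (A *\<^sub>v col Y b) $ a" using A Y ab by auto
    also have "\<dots> = X $$ (a, b)" using y[OF ab(2)] colY ab X by auto
    finally show "(A * Y) $$ (a, b) = X $$ (a, b)" .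
  qed (use A X Y in auto)
  with Y show ?thesis by blast
qed

lemma min_resD:
  assumes "min_graded_free_resolution J ds \<phi>"
  shows "ds 0 = [0]"
    "hom_mat (ds i) (ds (Suc i)) (\<phi> i)"
    "a < length (ds i) \<Longrightarrow> b < length (ds (Suc i)) \<Longrightarrow> lookup (\<phi> i $$ (a, b)) 0 = 0"
    "{(\<phi> 0 *\<^sub>v x) $ 0 | x. x \<in> carrier_vec (length (ds 1))} = J"
    "{\<phi> (Suc i) *\<^sub>v x | x. x \<in> carrier_vec (length (ds (Suc (Suc i))))} = mat_kernel (\<phi> i)"
  using assms unfolding min_graded_free_resolution_def hom_mat_def by auto

lemma min_res_comp:
  assumes R: "min_graded_free_resolution J ds \<phi>"
  shows "\<phi> i * \<phi> (Suc i) = 0\<^sub>m (length (ds i)) (length (ds (Suc (Suc i))))"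
proof (rule eq_matI)
  note c = hom_matD(1)[OF min_resD(2)[OF R]]
  fix a b assume "a < dim_row (0\<^sub>m (length (ds i)) (length (ds (Suc (Suc i)))))"
    "b < dim_col (0\<^sub>m (length (ds i)) (length (ds (Suc (Suc i)))))"
  then have ab: "a < length (ds i)" "b < length (ds (Suc (Suc i)))" by auto
  have "\<phi> (Suc i) *\<^sub>v unit_vec (length (ds (Suc (Suc i)))) b \<in> mat_kernel (\<phi> i)"
    unfolding min_resD(5)[OF R, symmetric] by auto
  moreover have "\<phi> (Suc i) *\<^sub>v unit_vec (length (ds (Suc (Suc i)))) b = col (\<phi> (Suc i)) b"
    using c[of "Suc i"] ab by (intro eq_vecI) auto
  ultimately have "\<phi> i *\<^sub>v col (\<phi> (Suc i)) b = 0\<^sub>v (length (ds i))"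
    using c[of i] by (auto simp: mat_kernel_def)
  then have "(\<phi> i *\<^sub>v col (\<phi> (Suc i)) b) $ a = 0" using ab by simp
  then show "(\<phi> i * \<phi> (Suc i)) $$ (a, b) = 0\<^sub>m (length (ds i)) (length (ds (Suc (Suc i)))) $$ (a, b)"
    using c[of i] c[of "Suc i"] ab by auto
next
  note c = hom_matD(1)[OF min_resD(2)[OF R]]
  show "dim_row (\<phi> i * \<phi> (Suc i)) = dim_row (0\<^sub>m (length (ds i)) (length (ds (Suc (Suc i)))))"
    "dim_col (\<phi> i * \<phi> (Suc i)) = dim_col (0\<^sub>m (length (ds i)) (length (ds (Suc (Suc i)))))"
    using c[of i] c[of "Suc i"] by auto
qed

lemma min_res_lift:
  assumes R: "min_graded_free_resolution J ds \<phi>"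
    and X: "X \<in> carrier_mat (length (ds (Suc i))) k"
    and 0: "\<phi> i * X = 0\<^sub>m (length (ds i)) k"
  shows "\<exists>Y\<in>carrier_mat (length (ds (Suc (Suc i)))) k. \<phi> (Suc i) * Y = X"
proof (rule solve_columnwise)
  note c = hom_matD(1)[OF min_resD(2)[OF R]]
  show "\<phi> (Suc i) \<in> carrier_mat (length (ds (Suc i))) (length (ds (Suc (Suc i))))" by (rule c)
  show "X \<in> carrier_mat (length (ds (Suc i))) k" by (rule X)
  fix b assume b: "b < k"
  have "\<phi> i *\<^sub>v col X b = 0\<^sub>v (length (ds i))"
  proof (rule eq_vecI)
    fix a assume "a < dim_vec (0\<^sub>v (length (ds i)) :: ('a, 'b) mpoly vec)"
    then have a: "a < length (ds i)" by simp
    have "(\<phi> i *\<^sub>v col X b) $ a = (\<phi> i * X) $$ (a, b)"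
      using c[of i] X a b by auto
    then show "(\<phi> i *\<^sub>v col X b) $ a = 0\<^sub>v (length (ds i)) $ a"
      using a b unfolding 0 by simp
  qed (use c[of i] in auto)
  moreover have "col X b \<in> carrier_vec (length (ds (Suc i)))" using X by (intro carrier_vecI) simp
  ultimately have "col X b \<in> mat_kernel (\<phi> i)" using c[of i] by (auto simp: mat_kernel_def)
  then show "\<exists>y\<in>carrier_vec (length (ds (Suc (Suc i)))). \<phi> (Suc i) *\<^sub>v y = col X b"
    unfolding min_resD(5)[OF R, symmetric] by auto
qed

lemma min_res_lift_hom:
  assumes R: "min_graded_free_resolution J ds \<phi>"
    and X: "hom_mat (ds (Suc i)) es X"
    and 0: "\<phi> i * X = 0\<^sub>m (length (ds i)) (length es)"
  shows "\<exists>Y. hom_mat (ds (Suc (Suc i))) es Y \<and> \<phi> (Suc i) * Y = X"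
  using min_res_lift[OF R hom_matD(1)[OF X] 0] homogeneous_solution[OF min_resD(2)[OF R] X] by blast

lemma min_res_lift_base:
  assumes R: "min_graded_free_resolution J ds \<phi>" and S: "min_graded_free_resolution J ds' \<phi>'"
  shows "\<exists>Y. hom_mat (ds' 1) (ds 1) Y \<and> \<phi>' 0 * Y = \<phi> 0"
proof -
  note c = hom_matD(1)[OF min_resD(2)[OF R, of 0]] and c' = hom_matD(1)[OF min_resD(2)[OF S, of 0]]
  note d = min_resD(1)[OF R] min_resD(1)[OF S]
  have "\<exists>Y\<in>carrier_mat (length (ds' 1)) (length (ds 1)). \<phi>' 0 * Y = \<phi> 0"
  proof (rule solve_columnwise)
    show "\<phi>' 0 \<in> carrier_mat 1 (length (ds' 1))" "\<phi> 0 \<in> carrier_mat 1 (length (ds 1))"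
      using c c' d by auto
    fix b assume b: "b < length (ds 1)"
    have u: "\<phi> 0 *\<^sub>v unit_vec (length (ds 1)) b = col (\<phi> 0) b"
      using c b d by (intro eq_vecI) auto
    have "(\<phi> 0 *\<^sub>v unit_vec (length (ds 1)) b) $ 0 \<in> J"
      unfolding min_resD(4)[OF R, symmetric] by auto
    then obtain y where y: "y \<in> carrier_vec (length (ds' 1))" "(\<phi>' 0 *\<^sub>v y) $ 0 = col (\<phi> 0) b $ 0"
      unfolding u min_resD(4)[OF S, symmetric] by auto
    have "\<phi>' 0 *\<^sub>v y = col (\<phi> 0) b"
      using c c' d y by (intro eq_vecI) auto
    then show "\<exists>y\<in>carrier_vec (length (ds' 1)). \<phi>' 0 *\<^sub>v y = col (\<phi> 0) b" using y by blast
  qed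
  moreover have "hom_mat (ds' 0) (ds 1) (\<phi> 0)" using min_resD(2)[OF R, of 0] d by simp
  ultimately show ?thesis
    using homogeneous_solution[of "ds' 0" "ds' 1" "\<phi>' 0" "ds 1" "\<phi> 0"] min_resD(2)[OF S, of 0] by auto
qed

text \<open>
  Lifting the identity of \<open>R/J\<close> gives chain maps \<open>f\<close> from the first to the second resolution and \<open>g\<close> back,
  and \<open>g f\<close> is homotopic to the identity. The induction carries two consecutive components \<open>f, f'\<close> and
  \<open>g, g'\<close> with their commutation relation, and the homotopy in the form
  \<open>g f = 1 + E + \<phi>\<^sub>i h\<close>, where \<open>E\<close> is the previous homotopy composed with the differential. Of \<open>E\<close> it is
  only remembered that it is killed by \<open>\<phi>\<^sub>i\<close> and has no constant terms; the latter expresses minimality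
  of the first resolution. The degrees will be compared
  along \<open>f\<close>, which is therefore chosen homogeneous.
\<close>

lemma chain_homotopy:
  fixes J :: "('v, 'k::field) mpoly set"
  assumes R: "min_graded_free_resolution J ds \<phi>" and S: "min_graded_free_resolution J ds' \<phi>'"
  shows "\<exists>f f' g g' h E. hom_mat (ds' i) (ds i) f \<and> hom_mat (ds' (Suc i)) (ds (Suc i)) f' \<and>
    g \<in> carrier_mat (length (ds i)) (length (ds' i)) \<and>
    g' \<in> carrier_mat (length (ds (Suc i))) (length (ds' (Suc i))) \<and>
    \<phi>' i * f' = f * \<phi> i \<and> \<phi> i * g' = g * \<phi>' i \<and>
    h \<in> carrier_mat (length (ds (Suc i))) (length (ds i)) \<and>
    E \<in> carrier_mat (length (ds i)) (length (ds i)) \<and>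
    g * f = 1\<^sub>m (length (ds i)) + (E + \<phi> i * h) \<and>
    E * \<phi> i = 0\<^sub>m (length (ds i)) (length (ds (Suc i))) \<and>
    (\<forall>a<length (ds i). \<forall>b<length (ds i). lookup (E $$ (a, b)) 0 = 0)"
proof (induction i)
  case 0
  note d = min_resD(1)[OF R] min_resD(1)[OF S]
  obtain f' where f': "hom_mat (ds' 1) (ds 1) f'" "\<phi>' 0 * f' = \<phi> 0"
    using min_res_lift_base[OF R S] by blast
  obtain g' where g': "hom_mat (ds 1) (ds' 1) g'" "\<phi> 0 * g' = \<phi>' 0"
    using min_res_lift_base[OF S R] by blast
  have c: "\<phi> 0 \<in> carrier_mat 1 (length (ds 1))" "\<phi>' 0 \<in> carrier_mat 1 (length (ds' 1))"
    using hom_matD(1)[OF min_resD(2)[OF R, of 0]] hom_matD(1)[OF min_resD(2)[OF S, of 0]] d by auto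
  have "hom_mat (ds' 0) (ds 0) (1\<^sub>m 1 :: ('v, 'k) mpoly mat)"
    unfolding d by (simp add: hom_mat_def)
  then show ?case
    by - (rule exI[of _ "1\<^sub>m 1"], rule exI[of _ f'], rule exI[of _ "1\<^sub>m 1"], rule exI[of _ g'],
        rule exI[of _ "0\<^sub>m (length (ds 1)) 1"], rule exI[of _ "0\<^sub>m 1 1"],
        use f' g' c in \<open>simp add: d hom_mat_def left_mult_one_mat right_mult_zero_mat\<close>)
next
  case (Suc i)
  then obtain f f' g g' h E where f: "hom_mat (ds' i) (ds i) f" "hom_mat (ds' (Suc i)) (ds (Suc i)) f'"
    and g: "g \<in> carrier_mat (length (ds i)) (length (ds' i))"
      "g' \<in> carrier_mat (length (ds (Suc i))) (length (ds' (Suc i)))"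
    and comm: "\<phi>' i * f' = f * \<phi> i" "\<phi> i * g' = g * \<phi>' i"
    and h: "h \<in> carrier_mat (length (ds (Suc i))) (length (ds i))"
    and E: "E \<in> carrier_mat (length (ds i)) (length (ds i))"
    and gf: "g * f = 1\<^sub>m (length (ds i)) + (E + \<phi> i * h)"
    and E0: "E * \<phi> i = 0\<^sub>m (length (ds i)) (length (ds (Suc i)))" by blast
  let ?n = "length (ds i)" and ?n1 = "length (ds (Suc i))" and ?n2 = "length (ds (Suc (Suc i)))"
  let ?m = "length (ds' i)" and ?m1 = "length (ds' (Suc i))" and ?m2 = "length (ds' (Suc (Suc i)))"
  note c = hom_matD(1)[OF min_resD(2)[OF R]] hom_matD(1)[OF min_resD(2)[OF S]]
  have p: "\<phi> i \<in> carrier_mat ?n ?n1" "\<phi> (Suc i) \<in> carrier_mat ?n1 ?n2"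
    "\<phi>' i \<in> carrier_mat ?m ?m1" "\<phi>' (Suc i) \<in> carrier_mat ?m1 ?m2"
    using c by auto
  have fc: "f \<in> carrier_mat ?m ?n" "f' \<in> carrier_mat ?m1 ?n1" using f hom_matD(1) by auto
  \<comment> \<open>The map \<open>f' \<phi>\<close> takes values in the kernel of \<open>\<phi>' i\<close> and can be lifted; similarly for \<open>g' \<phi>'\<close>.\<close>
  have "\<phi>' i * (f' * \<phi> (Suc i)) = f * (\<phi> i * \<phi> (Suc i))"
    using assoc_mult_mat[OF p(3) fc(2) p(2)] assoc_mult_mat[OF fc(1) p(1) p(2)] comm(1) by simp
  then have "\<phi>' i * (f' * \<phi> (Suc i)) = 0\<^sub>m ?m ?n2"
    using fc unfolding min_res_comp[OF R] by simp
  then obtain f'' where f'': "hom_mat (ds' (Suc (Suc i))) (ds (Suc (Suc i))) f''"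
      "\<phi>' (Suc i) * f'' = f' * \<phi> (Suc i)"
    using min_res_lift_hom[OF S hom_mat_mult[OF f(2) min_resD(2)[OF R]]] by blast
  have "\<phi> i * (g' * \<phi>' (Suc i)) = g * (\<phi>' i * \<phi>' (Suc i))"
    using assoc_mult_mat[OF p(1) g(2) p(4)] assoc_mult_mat[OF g(1) p(3) p(4)] comm(2) by simp
  then have "\<phi> i * (g' * \<phi>' (Suc i)) = 0\<^sub>m ?n ?m2"
    using g unfolding min_res_comp[OF S] by simp
  then obtain g'' where g'': "g'' \<in> carrier_mat ?n2 ?m2"
      "\<phi> (Suc i) * g'' = g' * \<phi>' (Suc i)"
    using min_res_lift[OF R mult_carrier_mat[OF g(2) p(4)]] by blast
  \<comment> \<open>The matrix \<open>g' f' - 1 - h \<phi>\<close> is killed by \<open>\<phi> i\<close> because \<open>E \<phi> = 0\<close>; its lift is the next homotopy.\<close>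
  define E' where "E' = h * \<phi> i"
  have E': "E' \<in> carrier_mat ?n1 ?n1" using h p by (auto simp: E'_def)
  define X where "X = g' * f' - (1\<^sub>m ?n1 + E')"
  have X: "X \<in> carrier_mat ?n1 ?n1" using g fc E' by (auto simp: X_def)
  have a1: "\<phi> i * (g' * f') = (g * f) * \<phi> i"
    using assoc_mult_mat[OF p(1) g(2) fc(2)] assoc_mult_mat[OF g(1) p(3) fc(2)]
      assoc_mult_mat[OF g(1) fc(1) p(1)] comm by simp
  have "(g * f) * \<phi> i = \<phi> i + (E * \<phi> i + \<phi> i * h * \<phi> i)"
    unfolding gf
    using add_mult_distrib_mat[of "1\<^sub>m ?n" ?n ?n "E + \<phi> i * h" "\<phi> i" ?n1]
      add_mult_distrib_mat[of E ?n ?n "\<phi> i * h" "\<phi> i" ?n1] p E h by simp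
  also have "\<dots> = \<phi> i + \<phi> i * E'"
    unfolding E0 E'_def using p h by (simp add: assoc_mult_mat[of _ ?n ?n1 _ ?n _ ?n1])
  also have "\<dots> = \<phi> i * (1\<^sub>m ?n1 + E')"
    using mult_add_distrib_mat[OF p(1) one_carrier_mat E'] p by simp
  finally have a2: "\<phi> i * (g' * f') = \<phi> i * (1\<^sub>m ?n1 + E')" using a1 by simp
  have "\<phi> i * X = \<phi> i * (g' * f') - \<phi> i * (1\<^sub>m ?n1 + E')"
    unfolding X_def using p g fc E' by (intro mult_minus_distrib_mat[of _ ?n ?n1 _ ?n1]) auto
  also have "\<dots> = 0\<^sub>m ?n ?n1" unfolding a2 using p E' by (intro minus_r_inv_mat) auto
  finally obtain h' where h': "h' \<in> carrier_mat ?n2 ?n1" "\<phi> (Suc i) * h' = X"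
    using min_res_lift[OF R X] by blast
  have G: "g' * f' = 1\<^sub>m ?n1 + (E' + \<phi> (Suc i) * h')"
    unfolding h' X_def using g fc E' by (intro eq_matI) auto
  have "E' * \<phi> (Suc i) = h * (\<phi> i * \<phi> (Suc i))"
    unfolding E'_def using h p by (intro assoc_mult_mat) auto
  then have z: "E' * \<phi> (Suc i) = 0\<^sub>m ?n1 ?n2"
    using h unfolding min_res_comp[OF R] by simp
  have k: "lookup (E' $$ (a, b)) 0 = 0" if "a < ?n1" "b < ?n1" for a b
    unfolding E'_def mat_mult_entry[OF h p(1) that] lookup_sum lookup_mult_0
    using min_resD(3)[OF R] that by (intro sum.neutral) auto
  show ?case
    by (rule exI[of _ f'], rule exI[of _ f''], rule exI[of _ g'], rule exI[of _ g''],
        rule exI[of _ h'], rule exI[of _ E'])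
       (use f f'' g g'' h' E' G z k in auto)
qed

text \<open>
  The constant term of each diagonal entry of \<open>g f\<close> is 1, because the homotopy terms have no constant
  terms. So the column of \<open>f\<close> belonging to a generator has an entry with nonzero constant term, that is,
  \<open>f\<close> maps the generator nontrivially to a generator of the same degree.
\<close>

lemma min_res_degrees_subset:
  fixes J :: "('v, 'k::field) mpoly set"
  assumes R: "min_graded_free_resolution J ds \<phi>" and S: "min_graded_free_resolution J ds' \<phi>'"
  shows "set (ds i) \<subseteq> set (ds' i)"
proof
  fix j assume "j \<in> set (ds i)"
  then obtain a where a: "a < length (ds i)" "j = ds i ! a" by (auto simp: in_set_conv_nth)
  obtain f g h E where f: "hom_mat (ds' i) (ds i) f"
    and g: "g \<in> carrier_mat (length (ds i)) (length (ds' i))"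
    and h: "h \<in> carrier_mat (length (ds (Suc i))) (length (ds i))"
    and E: "E \<in> carrier_mat (length (ds i)) (length (ds i))"
    and gf: "g * f = 1\<^sub>m (length (ds i)) + (E + \<phi> i * h)"
    and E0: "\<forall>a<length (ds i). \<forall>b<length (ds i). lookup (E $$ (a, b)) 0 = 0"
    using chain_homotopy[OF R S, of i] by blast
  note c = hom_matD(1)[OF min_resD(2)[OF R, of i]]
  have "lookup ((\<phi> i * h) $$ (a, a)) 0 = 0"
    unfolding mat_mult_entry[OF c h a(1) a(1)] lookup_sum lookup_mult_0
    using min_resD(3)[OF R] a by (intro sum.neutral) auto
  then have "lookup ((g * f) $$ (a, a)) 0 = 1"
    unfolding gf using a c h E E0 by (simp add: lookup_add)
  then have "(\<Sum>b<length (ds' i). lookup (g $$ (a, b)) 0 * lookup (f $$ (b, a)) 0) \<noteq> 0"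
    unfolding mat_mult_entry[OF g hom_matD(1)[OF f] a(1) a(1)] lookup_sum lookup_mult_0 by simp
  then obtain b where b: "b < length (ds' i)" "lookup (f $$ (b, a)) 0 \<noteq> 0"
    by (metis (no_types, lifting) lessThan_iff mult_zero_right sum.neutral)
  then have "0 \<in> keys (f $$ (b, a))" by (simp add: in_keys_iff)
  then have "ds' i ! b = j" using hom_matD(2)[OF f b(1) a(1)] a by fastforce
  then show "j \<in> set (ds' i)" using b by auto
qed

lemma min_res_degrees_unique:
  assumes "min_graded_free_resolution J ds \<phi>" and "min_graded_free_resolution J ds' \<phi>'"
  shows "set (ds i) = set (ds' i)"
  using min_res_degrees_subset assms by (metis subset_antisym)

text \<open>
  The resolution chosen in the definition of the Betti numbers has the same degrees as the given one.
\<close>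

theorem regularity_quot_eqI:
  fixes J :: "('v, 'k::field) mpoly set"
  assumes R: "min_graded_free_resolution J ds \<phi>"
    and fin: "\<And>i. i > N \<Longrightarrow> ds i = []"
    and le: "\<And>i j. j \<in> set (ds i) \<Longrightarrow> j \<le> i + r"
    and attained: "i + r \<in> set (ds i)"
  shows "regularity_quot J = int r"
proof -
  define es where "es = (SOME ds. \<exists>\<phi> :: nat \<Rightarrow> ('v, 'k) mpoly mat. min_graded_free_resolution J ds \<phi>)"
  have "\<exists>\<psi> :: nat \<Rightarrow> ('v, 'k) mpoly mat. min_graded_free_resolution J es \<psi>"
    unfolding es_def by (rule someI[where x = ds]) (use R in blast)
  then obtain \<psi> :: "nat \<Rightarrow> ('v, 'k) mpoly mat" where S: "min_graded_free_resolution J es \<psi>" by blast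
  have same: "graded_betti J i j \<noteq> 0 \<longleftrightarrow> j \<in> set (ds i)" for i j
    unfolding graded_betti_def es_def[symmetric] min_res_degrees_unique[OF R S]
    by (simp add: count_list_0_iff)
  let ?D = "{int j - int i | i j. j \<in> set (ds i)}"
  have "?D \<subseteq> (\<Union>i\<in>{..N}. (\<lambda>j. int j - int i) ` set (ds i))"
    using fin by (fastforce simp: not_less[symmetric])
  then have "finite ?D" by (rule finite_subset) auto
  moreover have "int r \<in> ?D" using attained by force
  moreover have "x \<le> int r" if "x \<in> ?D" for x using that le by fastforce
  ultimately have "Max ?D = int r" by (intro Max_eqI) auto
  then show ?thesis unfolding regularity_quot_def same .
qed

section \<open>Resolutions as linear maps on chains\<close>

text \<open>
  Free modules are represented by functions on an index type, maps into them by their components. Working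
  with linear maps instead of matrices avoids all index calculations in the constructions below.
\<close>

definition R_linear :: "(('b \<Rightarrow> ('v, 'k::field) mpoly) \<Rightarrow> ('v, 'k) mpoly) \<Rightarrow> bool" where
  "R_linear f \<longleftrightarrow> (\<forall>x y. f (\<lambda>g. x g + y g) = f x + f y) \<and> (\<forall>a x. f (\<lambda>g. a * x g) = a * f x)"

lemma R_linear_add: "R_linear f \<Longrightarrow> f (\<lambda>g. x g + y g) = f x + f y"
  and R_linear_scale: "R_linear f \<Longrightarrow> f (\<lambda>g. a * x g) = a * f x"
  by (auto simp: R_linear_def)

lemma R_linear_zero: "R_linear f \<Longrightarrow> f (\<lambda>_. 0) = 0"
  using R_linear_scale[of f 0 "\<lambda>_. 0"] by simp

lemma R_linear_uminus: "R_linear f \<Longrightarrow> f (\<lambda>g. - x g) = - f x"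
  using R_linear_scale[of f "-1" x] by simp

lemma R_linear_diff: "R_linear f \<Longrightarrow> f (\<lambda>g. x g - y g) = f x - f y"
  using R_linear_add[of f x "\<lambda>g. - y g"] by (simp add: R_linear_uminus)

lemma R_linear_comp:
  assumes "R_linear f" shows "R_linear (\<lambda>x. f (\<lambda>g. x (h g)))"
  unfolding R_linear_def by (intro conjI allI R_linear_add[OF assms] R_linear_scale[OF assms])

lemma R_linear_const_0: "R_linear (\<lambda>_. 0)" and R_linear_eval: "R_linear (\<lambda>x. x g)"
  by (simp_all add: R_linear_def)

lemma R_linear_plus:
  assumes f: "R_linear f" and h: "R_linear h" shows "R_linear (\<lambda>x. f x + h x)"
  unfolding R_linear_def R_linear_add[OF f] R_linear_add[OF h] R_linear_scale[OF f] R_linear_scale[OF h]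
  by (intro conjI allI distrib_left[symmetric]) (simp add: add_ac)

lemma R_linear_times:
  assumes f: "R_linear f" shows "R_linear (\<lambda>x. a * f x)"
  unfolding R_linear_def R_linear_add[OF f] R_linear_scale[OF f]
  by (intro conjI allI distrib_left mult.left_commute)

lemma R_linear_neg:
  assumes f: "R_linear f" shows "R_linear (\<lambda>x. - f x)"
  using R_linear_times[OF f, of "-1"] by simp

lemma R_linear_minus:
  assumes f: "R_linear f" and h: "R_linear h" shows "R_linear (\<lambda>x. f x - h x)"
  using R_linear_plus[OF f R_linear_neg[OF h]] by simp

lemmas R_linear_intros = R_linear_const_0 R_linear_eval R_linear_plus R_linear_minus R_linear_times R_linear_neg

definition supp_on :: "'b set \<Rightarrow> ('b \<Rightarrow> ('v, 'k::field) mpoly) set" where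
  "supp_on S = {x. \<forall>g. g \<notin> S \<longrightarrow> x g = 0}"

lemma supp_on_zero: "(\<lambda>_. 0) \<in> supp_on S"
  and supp_on_add: "x \<in> supp_on S \<Longrightarrow> y \<in> supp_on S \<Longrightarrow> (\<lambda>g. x g + y g) \<in> supp_on S"
  and supp_on_diff: "x \<in> supp_on S \<Longrightarrow> y \<in> supp_on S \<Longrightarrow> (\<lambda>g. x g - y g) \<in> supp_on S"
  and supp_on_uminus: "x \<in> supp_on S \<Longrightarrow> (\<lambda>g. - x g) \<in> supp_on S"
  and supp_on_scale: "x \<in> supp_on S \<Longrightarrow> (\<lambda>g. a * x g) \<in> supp_on S"
  by (auto simp: supp_on_def)

lemmas supp_on_intros = supp_on_zero supp_on_add supp_on_diff supp_on_uminus supp_on_scale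

definition unit_at :: "'b \<Rightarrow> 'b \<Rightarrow> ('v, 'k::field) mpoly" where
  "unit_at g = (\<lambda>h. if h = g then 1 else 0)"

lemma unit_at_supp: "g \<in> S \<Longrightarrow> unit_at g \<in> supp_on S"
  by (auto simp: unit_at_def supp_on_def)

text \<open>
  A graded free resolution of the ideal \<open>M\<close> (rather than of the quotient by it). The basis elements in
  homological position \<open>i\<close> are the cells \<open>G i\<close>, of degrees \<open>\<delta> i\<close>; \<open>\<epsilon>\<close> maps chains on \<open>G 0\<close> onto the ideal, and \<open>d i\<close>
  maps chains on \<open>G (Suc i)\<close> to chains on \<open>G i\<close>. Cells are lists of numbers, so that a construction can
  form disjoint copies of the cells by prefixing a tag. Minimality is required of the maps \<open>d i\<close> only: the
  resolution of the unit ideal, where \<open>\<epsilon>\<close> is an isomorphism, is the starting point of the constructions.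
\<close>

locale ideal_resolution =
  fixes M :: "('v::finite, 'k::field) mpoly set"
    and G :: "nat \<Rightarrow> nat list set"
    and \<delta> :: "nat \<Rightarrow> nat list \<Rightarrow> nat"
    and \<epsilon> :: "(nat list \<Rightarrow> ('v, 'k) mpoly) \<Rightarrow> ('v, 'k) mpoly"
    and d :: "nat \<Rightarrow> (nat list \<Rightarrow> ('v, 'k) mpoly) \<Rightarrow> nat list \<Rightarrow> ('v, 'k) mpoly"
  assumes finite_G: "finite (G i)"
    and lin_\<epsilon>: "R_linear \<epsilon>"
    and lin_d: "R_linear (\<lambda>x. d i x g)"
    and d_supp: "x \<in> supp_on (G (Suc i)) \<Longrightarrow> d i x \<in> supp_on (G i)"
    and range_\<epsilon>: "\<epsilon> ` supp_on (G 0) = M"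
    and exact0: "x \<in> supp_on (G 0) \<Longrightarrow> \<epsilon> x = 0 \<longleftrightarrow> x \<in> d 0 ` supp_on (G (Suc 0))"
    and exact: "x \<in> supp_on (G (Suc i)) \<Longrightarrow> d i x = (\<lambda>_. 0) \<longleftrightarrow> x \<in> d (Suc i) ` supp_on (G (Suc (Suc i)))"
    and deg_\<epsilon>: "g \<in> G 0 \<Longrightarrow> m \<in> keys (\<epsilon> (unit_at g)) \<Longrightarrow> pp_degree m = \<delta> 0 g"
    and deg_d: "g \<in> G i \<Longrightarrow> h \<in> G (Suc i) \<Longrightarrow> m \<in> keys (d i (unit_at h) g) \<Longrightarrow>
      pp_degree m + \<delta> i g = \<delta> (Suc i) h"
    and min_d: "g \<in> G i \<Longrightarrow> h \<in> G (Suc i) \<Longrightarrow> lookup (d i (unit_at h) g) 0 = 0"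
begin

lemma d_add: "d i (\<lambda>g. x g + y g) = (\<lambda>g. d i x g + d i y g)"
  and d_scale: "d i (\<lambda>g. a * x g) = (\<lambda>g. a * d i x g)"
  and d_zero: "d i (\<lambda>_. 0) = (\<lambda>_. 0)"
  and d_uminus: "d i (\<lambda>g. - x g) = (\<lambda>g. - d i x g)"
  and d_diff: "d i (\<lambda>g. x g - y g) = (\<lambda>g. d i x g - d i y g)"
  using R_linear_add[OF lin_d] R_linear_scale[OF lin_d] R_linear_zero[OF lin_d] R_linear_uminus[OF lin_d]
    R_linear_diff[OF lin_d] by (intro ext; simp)+

lemma \<epsilon>_d: "x \<in> supp_on (G (Suc 0)) \<Longrightarrow> \<epsilon> (d 0 x) = 0"
  using exact0[OF d_supp] by simp

lemma \<epsilon>_mem: "x \<in> supp_on (G 0) \<Longrightarrow> \<epsilon> x \<in> M"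
  unfolding range_\<epsilon>[symmetric] by (rule imageI)

lemma \<epsilon>_memE:
  assumes "p \<in> M" obtains x where "x \<in> supp_on (G 0)" "p = \<epsilon> x"
  using assms unfolding range_\<epsilon>[symmetric] by (elim imageE)

lemma exact0E:
  assumes "x \<in> supp_on (G 0)" "\<epsilon> x = 0"
  obtains y where "y \<in> supp_on (G (Suc 0))" "x = d 0 y"
  using assms(2) unfolding exact0[OF assms(1)] by (elim imageE)

lemma exactE:
  assumes "x \<in> supp_on (G (Suc i))" "d i x = (\<lambda>_. 0)"
  obtains y where "y \<in> supp_on (G (Suc (Suc i)))" "x = d (Suc i) y"
  using assms(2) unfolding exact[OF assms(1)] by (elim imageE)

lemma d_d: "x \<in> supp_on (G (Suc (Suc i))) \<Longrightarrow> d i (d (Suc i) x) = (\<lambda>_. 0)"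
  using exact[OF d_supp] by simp

end

lemma ideal_resolution_UNIV:
  "ideal_resolution (mon_ideal (\<lambda>_. True) :: ('v::finite, 'k::field) mpoly set)
    (\<lambda>i. if i = 0 then {[]} else {}) (\<lambda>_ _. 0) (\<lambda>x. x []) (\<lambda>_ _ _. 0)"
proof unfold_locales
  show "(\<lambda>x. x []) ` supp_on (if (0::nat) = 0 then {[]} else {}) = (mon_ideal (\<lambda>_. True) :: ('v, 'k) mpoly set)"
  proof (rule subset_antisym; rule subsetI)
    fix p :: "('v, 'k) mpoly"
    have "(\<lambda>g. if g = [] then p else 0) \<in> supp_on {[]}" by (simp add: supp_on_def)
    then show "p \<in> (\<lambda>x. x []) ` supp_on (if (0::nat) = 0 then {[]} else {})"
      by (intro image_eqI[of _ _ "\<lambda>g. if g = [] then p else 0"]) simp_all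
  qed (simp add: mem_mon_ideal)
  have im: "(\<lambda>_ _. 0) ` (supp_on S :: (nat list \<Rightarrow> ('v, 'k) mpoly) set) = {\<lambda>_ :: nat list. 0 :: ('v, 'k) mpoly}" for S :: "nat list set"
    using supp_on_zero[of S] by (auto simp: image_iff)
  fix x :: "nat list \<Rightarrow> ('v, 'k) mpoly"
  show "(x [] = 0) = (x \<in> (\<lambda>_ _. 0) ` (supp_on (if Suc 0 = 0 then {[]} else {}) :: (nat list \<Rightarrow> ('v, 'k) mpoly) set))"
    if "x \<in> supp_on (if (0::nat) = 0 then {[]} else {})"
  proof -
    have z: "x g = 0" if "g \<noteq> []" for g
      using that \<open>x \<in> supp_on (if (0::nat) = 0 then {[]} else {})\<close> by (simp add: supp_on_def)
    have "x [] = 0 \<longleftrightarrow> x = (\<lambda>_. 0)"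
    proof
      assume "x [] = 0"
      then show "x = (\<lambda>_. 0)" using z by (intro ext) metis
    qed simp
    then show ?thesis unfolding im by simp
  qed
  show "((\<lambda>_. 0) = (\<lambda>_ :: nat list. 0 :: ('v, 'k) mpoly)) = (x \<in> (\<lambda>_ _. 0) ` (supp_on (if Suc (Suc i) = 0 then {[]} else {}) :: (nat list \<Rightarrow> ('v, 'k) mpoly) set))"
    if "x \<in> supp_on (if Suc i = 0 then {[]} else {})" for i
    unfolding im using that by (simp add: supp_on_def fun_eq_iff)
qed (auto simp: R_linear_def supp_on_zero unit_at_def pp_degree_def)

section \<open>Cone over a regular sequence of two monomials\<close>

text \<open>
  Chains on three disjoint copies of a set of cells, one for each summand of the cone.
\<close>

definition tri :: "(nat list \<Rightarrow> 'r) \<Rightarrow> (nat list \<Rightarrow> 'r) \<Rightarrow> (nat list \<Rightarrow> 'r) \<Rightarrow> nat list \<Rightarrow> 'r::zero" where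
  "tri a b c l = (case l of [] \<Rightarrow> 0 | t # g \<Rightarrow>
     if t = 0 then a g else if t = 1 then b g else if t = 2 then c g else 0)"

lemma tri_simps [simp]:
  "tri a b c [] = 0" "tri a b c (0 # g) = a g" "tri a b c (Suc 0 # g) = b g" "tri a b c (2 # g) = c g"
  by (simp_all add: tri_def)

lemma tri_parts: "(\<lambda>g. tri a b c (0 # g)) = a" "(\<lambda>g. tri a b c (Suc 0 # g)) = b" "(\<lambda>g. tri a b c (2 # g)) = c"
  by simp_all

lemma tri_eq_iff: "tri a b c = tri a' b' c' \<longleftrightarrow> a = a' \<and> b = b' \<and> c = c'"
proof
  assume e: "tri a b c = tri a' b' c'"
  have "a g = a' g" "b g = b' g" "c g = c' g" for g
    using fun_cong[OF e, of "0 # g"] fun_cong[OF e, of "Suc 0 # g"] fun_cong[OF e, of "2 # g"]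
    by simp_all
  then show "a = a' \<and> b = b' \<and> c = c'" by (intro conjI ext)
qed simp

lemma tri_zero: "tri (\<lambda>_. 0) (\<lambda>_. 0) (\<lambda>_. 0) = (\<lambda>_. 0)"
  by (auto simp: tri_def fun_eq_iff split: list.split)

lemma tri_eq_zero_iff: "tri a b c = (\<lambda>_. 0) \<longleftrightarrow> a = (\<lambda>_. 0) \<and> b = (\<lambda>_. 0) \<and> c = (\<lambda>_. 0)"
  using tri_eq_iff[of a b c "\<lambda>_. 0" "\<lambda>_. 0" "\<lambda>_. 0"] unfolding tri_zero .

text \<open>
  The cone for the ideal \<open>x\<^bsup>t1\<^esup> M + x\<^bsup>t2\<^esup> M\<close>: copies 0 and 1 of the resolution of \<open>M\<close> resolve the two
  summands, and copy 2, moved up by one position, resolves their intersection \<open>x\<^bsup>t1 + t2\<^esup> M\<close>.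
\<close>

definition cone_cells :: "(nat \<Rightarrow> nat list set) \<Rightarrow> nat \<Rightarrow> nat list set" where
  "cone_cells G i = (#) 0 ` G i \<union> (#) 1 ` G i \<union> (case i of 0 \<Rightarrow> {} | Suc j \<Rightarrow> (#) 2 ` G j)"

lemma in_cone_cells [simp]:
  "0 # g \<in> cone_cells G i \<longleftrightarrow> g \<in> G i" "Suc 0 # g \<in> cone_cells G i \<longleftrightarrow> g \<in> G i"
  "2 # g \<in> cone_cells G i \<longleftrightarrow> (\<exists>j. i = Suc j \<and> g \<in> G j)"
  "[] \<notin> cone_cells G i" "t > 2 \<Longrightarrow> t # g \<notin> cone_cells G i"
  by (auto simp: cone_cells_def split: nat.splits)

lemma cone_cellsE:
  assumes "l \<in> cone_cells G i"
  obtains (0) g where "l = 0 # g" "g \<in> G i" | (1) g where "l = Suc 0 # g" "g \<in> G i"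
    | (2) g j where "l = 2 # g" "i = Suc j" "g \<in> G j"
  using assms unfolding cone_cells_def by (cases i) auto

definition cone_deg where
  "cone_deg t1 t2 \<delta> i l = (case l of [] \<Rightarrow> 0 | t # g \<Rightarrow>
     if t = 0 then \<delta> i g + pp_degree t1 else if t = 1 then \<delta> i g + pp_degree t2
     else \<delta> (i - 1) g + pp_degree t1 + pp_degree t2)"

definition cone_aug :: "('v \<Rightarrow>\<^sub>0 nat) \<Rightarrow> ('v \<Rightarrow>\<^sub>0 nat) \<Rightarrow> ((nat list \<Rightarrow> ('v, 'k::field) mpoly) \<Rightarrow> ('v, 'k) mpoly) \<Rightarrow>
    (nat list \<Rightarrow> ('v, 'k) mpoly) \<Rightarrow> ('v, 'k) mpoly" where
  "cone_aug t1 t2 \<epsilon> x = pmon t1 * \<epsilon> (\<lambda>g. x (0 # g)) + pmon t2 * \<epsilon> (\<lambda>g. x (Suc 0 # g))"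

text \<open>
  In components, \<open>(a, b, c) \<mapsto> (d a + x\<^bsup>t2\<^esup> c, d b - x\<^bsup>t1\<^esup> c, - d c)\<close>. At the lowest position the third component
  has no target.
\<close>

definition cone_diff :: "('v \<Rightarrow>\<^sub>0 nat) \<Rightarrow> ('v \<Rightarrow>\<^sub>0 nat) \<Rightarrow>
    (nat \<Rightarrow> (nat list \<Rightarrow> ('v, 'k::field) mpoly) \<Rightarrow> nat list \<Rightarrow> ('v, 'k) mpoly) \<Rightarrow>
    nat \<Rightarrow> (nat list \<Rightarrow> ('v, 'k) mpoly) \<Rightarrow> nat list \<Rightarrow> ('v, 'k) mpoly" where
  "cone_diff t1 t2 d i x = tri
     (\<lambda>g. d i (\<lambda>g. x (0 # g)) g + pmon t2 * x (2 # g))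
     (\<lambda>g. d i (\<lambda>g. x (Suc 0 # g)) g - pmon t1 * x (2 # g))
     (if i = 0 then (\<lambda>_. 0) else (\<lambda>g. - d (i - 1) (\<lambda>g. x (2 # g)) g))"

text \<open>
  Chains on copy 2, which is empty in position 0.
\<close>

definition third_part :: "(nat \<Rightarrow> nat list set) \<Rightarrow> nat \<Rightarrow> (nat list \<Rightarrow> ('v, 'k::field) mpoly) set" where
  "third_part G i = (case i of 0 \<Rightarrow> {\<lambda>_. 0} | Suc j \<Rightarrow> supp_on (G j))"

lemma supp_on_cone_cells:
  "x \<in> supp_on (cone_cells G i) \<longleftrightarrow>
    (\<exists>a\<in>supp_on (G i). \<exists>b\<in>supp_on (G i). \<exists>c\<in>third_part G i. x = tri a b c)"
proof
  assume x: "x \<in> supp_on (cone_cells G i)"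
  define a b c where "a = (\<lambda>g. x (0 # g))" and "b = (\<lambda>g. x (Suc 0 # g))" and "c = (\<lambda>g. x (2 # g))"
  have "x l = tri a b c l" for l
  proof (cases l)
    case Nil
    then show ?thesis using x by (simp add: supp_on_def)
  next
    case (Cons t g)
    show ?thesis
    proof (cases "t \<le> 2")
      case True
      then have "t = 0 \<or> t = 1 \<or> t = 2" by auto
      then show ?thesis using Cons by (auto simp: a_def b_def c_def)
    next
      case False
      then have "l \<notin> cone_cells G i" using Cons by simp
      then show ?thesis using x Cons False by (simp add: supp_on_def tri_def)
    qed
  qed
  then have "x = tri a b c" by blast
  moreover have "a \<in> supp_on (G i)" "b \<in> supp_on (G i)" "c \<in> third_part G i"
    using x by (simp_all add: supp_on_def a_def b_def c_def third_part_def fun_eq_iff split: nat.splits)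
  ultimately show "\<exists>a\<in>supp_on (G i). \<exists>b\<in>supp_on (G i). \<exists>c\<in>third_part G i. x = tri a b c" by blast
next
  assume "\<exists>a\<in>supp_on (G i). \<exists>b\<in>supp_on (G i). \<exists>c\<in>third_part G i. x = tri a b c"
  then obtain a b c where abc: "a \<in> supp_on (G i)" "b \<in> supp_on (G i)" "c \<in> third_part G i"
    and x: "x = tri a b c" by blast
  show "x \<in> supp_on (cone_cells G i)"
    unfolding supp_on_def
  proof (rule CollectI, intro allI impI)
    fix l assume l: "l \<notin> cone_cells G i"
    show "x l = 0"
    proof (cases "\<exists>g. l = 0 # g \<or> l = Suc 0 # g \<or> l = 2 # g")
      case True
      then show ?thesis using l abc unfolding x
        by (cases i) (auto simp: supp_on_def third_part_def)
    next
      case False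
      then show ?thesis unfolding x tri_def by (simp split: list.split)
    qed
  qed
qed

lemma tri_supp:
  assumes "a \<in> supp_on (G i)" "b \<in> supp_on (G i)" "c \<in> third_part G i"
  shows "tri a b c \<in> supp_on (cone_cells G i)"
  unfolding supp_on_cone_cells using assms by blast

lemma supp_on_cone_cells_0E:
  assumes "x \<in> supp_on (cone_cells G 0)"
  obtains a b where "a \<in> supp_on (G 0)" "b \<in> supp_on (G 0)" "x = tri a b (\<lambda>_. 0)"
  using assms unfolding supp_on_cone_cells third_part_def by auto

lemma supp_on_cone_cells_SucE:
  assumes "x \<in> supp_on (cone_cells G (Suc i))"
  obtains a b c where "a \<in> supp_on (G (Suc i))" "b \<in> supp_on (G (Suc i))" "c \<in> supp_on (G i)" "x = tri a b c"
  using assms unfolding supp_on_cone_cells third_part_def by auto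

lemma cone_aug_tri: "cone_aug t1 t2 \<epsilon> (tri a b c) = pmon t1 * \<epsilon> a + pmon t2 * \<epsilon> b"
  by (simp add: cone_aug_def tri_parts)

lemma cone_diff_tri: "cone_diff t1 t2 d i (tri a b c) = tri (\<lambda>g. d i a g + pmon t2 * c g)
   (\<lambda>g. d i b g - pmon t1 * c g) (if i = 0 then (\<lambda>_. 0) else (\<lambda>g. - d (i - 1) c g))"
  by (simp add: cone_diff_def tri_parts)

lemma unit_at_tri:
  "unit_at (0 # g) = tri (unit_at g) (\<lambda>_. 0) (\<lambda>_. 0)"
  "unit_at (Suc 0 # g) = tri (\<lambda>_. 0) (unit_at g) (\<lambda>_. 0)"
  "unit_at (2 # g) = tri (\<lambda>_. 0) (\<lambda>_. 0) (unit_at g)"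
  by (auto simp: unit_at_def tri_def fun_eq_iff split: list.split)

lemma (in ideal_resolution) cone_diff_unit_at:
  "cone_diff t1 t2 d i (unit_at (0 # h)) = tri (d i (unit_at h)) (\<lambda>_. 0) (\<lambda>_. 0)"
  "cone_diff t1 t2 d i (unit_at (Suc 0 # h)) = tri (\<lambda>_. 0) (d i (unit_at h)) (\<lambda>_. 0)"
  "cone_diff t1 t2 d i (unit_at (2 # h)) = tri (\<lambda>g. pmon t2 * unit_at h g) (\<lambda>g. - (pmon t1 * unit_at h g))
     (if i = 0 then (\<lambda>_. 0) else (\<lambda>g. - d (i - 1) (unit_at h) g))"
  unfolding unit_at_tri cone_diff_tri d_zero by simp_all

lemma lookup_pmon_mult_0:
  assumes "t \<noteq> 0" shows "lookup (pmon t * p) 0 = 0"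
proof (rule lookup_pmon_mult_eq_0)
  show "\<nexists>s. 0 = t + s"
    using assms by (metis add_is_0 pp_degree_0 pp_degree_add pp_degree_eq_0_iff)
qed

lemma coprime_dvd:
  assumes "\<And>v. lookup t1 v = 0 \<or> lookup t2 v = 0"
    and "t1 + k = t2 + (l :: 'v \<Rightarrow>\<^sub>0 nat)"
  shows "\<exists>s. k = t2 + s"
  unfolding add_dvd_iff
proof
  fix v
  have "lookup t1 v + lookup k v = lookup t2 v + lookup l v"
    using arg_cong[OF assms(2), of "\<lambda>m. lookup m v"] by (simp add: lookup_add)
  then show "lookup t2 v \<le> lookup k v"
    using assms(1)[of v] by auto
qed

text \<open>
  Power products without a common variable form a regular sequence, so the only relations between them
  are the Koszul relations.
\<close>

lemma coprime_syzygy: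
  fixes p q :: "('v, 'k::field) mpoly"
  assumes cop: "\<And>v. lookup t1 v = 0 \<or> lookup t2 v = 0"
    and eq: "pmon t1 * p + pmon t2 * q = 0"
  obtains r where "p = pmon t2 * r" "q = - (pmon t1 * r)"
proof -
  have e: "pmon t1 * p = pmon t2 * (- q)" using eq by (simp add: eq_neg_iff_add_eq_0)
  have "\<exists>s. m = t2 + s" if "m \<in> keys p" for m
  proof -
    have "t1 + m \<in> keys (pmon t1 * p)" using that by (simp add: keys_pmon_mult)
    then obtain l where "t1 + m = t2 + l" unfolding e keys_pmon_mult by blast
    then show ?thesis by (rule coprime_dvd[OF cop])
  qed
  then obtain r where r: "p = pmon t2 * r" by (rule pmon_dvdE)
  have "pmon t2 * (pmon t1 * r) = pmon t1 * (pmon t2 * r)" by (rule mult.left_commute)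
  also have "\<dots> = pmon t2 * (- q)" using e unfolding r .
  finally have "pmon t2 * (pmon t1 * r) = pmon t2 * (- q)" .
  then have "pmon t1 * r = - q" by (simp only: pmon_mult_cancel)
  then show ?thesis using that[OF r] by simp
qed

text \<open>
  Collect the terms that satisfy \<open>P\<close> and are divisible by \<open>t1\<close>; all other terms are divisible by \<open>t2\<close>.
\<close>

lemma mon_ideal_two_monomials:
  fixes p :: "('v, 'k::field) mpoly"
  assumes "\<And>m. m \<in> keys p \<Longrightarrow> (P m \<and> (\<exists>s. m = t1 + s)) \<or> (P' m \<and> (\<exists>s. m = t2 + s))"
  obtains q r where "p = pmon t1 * q + pmon t2 * r"
    "\<And>m. m \<in> keys q \<Longrightarrow> P (t1 + m)" "\<And>m. m \<in> keys r \<Longrightarrow> P' (t2 + m)"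
proof -
  let ?A = "\<lambda>m. P m \<and> (\<exists>s. m = t1 + s)"
  have dec: "p = pfilter ?A p + pfilter (\<lambda>m. \<not> ?A m) p"
    by (rule pfilter_split[symmetric])
  obtain q where q: "pfilter ?A p = pmon t1 * q"
  proof (rule pmon_dvdE[of "pfilter ?A p" t1])
    fix m assume "m \<in> keys (pfilter ?A p)"
    then show "\<exists>s. m = t1 + s" unfolding keys_pfilter by blast
  qed
  obtain r where r: "pfilter (\<lambda>m. \<not> ?A m) p = pmon t2 * r"
  proof (rule pmon_dvdE[of "pfilter (\<lambda>m. \<not> ?A m) p" t2])
    fix m assume "m \<in> keys (pfilter (\<lambda>m. \<not> ?A m) p)"
    then show "\<exists>s. m = t2 + s" using assms[of m] unfolding keys_pfilter by blast
  qed
  show ?thesis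
  proof (rule that)
    show "p = pmon t1 * q + pmon t2 * r" using dec q r by simp
    fix m
    show "P (t1 + m)" if "m \<in> keys q"
    proof -
      have "t1 + m \<in> keys (pfilter ?A p)" unfolding q keys_pmon_mult using that by blast
      then show ?thesis by (simp add: keys_pfilter)
    qed
    show "P' (t2 + m)" if "m \<in> keys r"
    proof -
      have "t2 + m \<in> keys (pfilter (\<lambda>m. \<not> ?A m) p)" unfolding r keys_pmon_mult using that by blast
      then show ?thesis using assms[of "t2 + m"] unfolding keys_pfilter by blast
    qed
  qed
qed

text \<open>
  The invariance of \<open>Q\<close> under \<open>t1\<close> and \<open>t2\<close> says that both are nonzerodivisors modulo \<open>M\<close>; since they
  have no common variable, the two summands intersect in \<open>x\<^bsup>t1 + t2\<^esup> M\<close>. Exactness is checked directly: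
  a cycle \<open>(a, b, c)\<close> has a third component which is a boundary, for torsion reasons in the lowest
  position, and after subtracting a boundary \<open>c\<close> vanishes and \<open>a\<close>, \<open>b\<close> are cycles.
\<close>

lemma (in ideal_resolution) cone:
  assumes M: "M = mon_ideal Q"
    and Q1: "\<And>m. Q (t1 + m) \<longleftrightarrow> Q m" and Q2: "\<And>m. Q (t2 + m) \<longleftrightarrow> Q m"
    and cop: "\<And>v. lookup t1 v = 0 \<or> lookup t2 v = 0"
    and nz: "t1 \<noteq> 0" "t2 \<noteq> 0"
  shows "ideal_resolution (mon_ideal (\<lambda>m. Q m \<and> ((\<exists>s. m = t1 + s) \<or> (\<exists>s. m = t2 + s))))
    (cone_cells G) (cone_deg t1 t2 \<delta>) (cone_aug t1 t2 \<epsilon>) (cone_diff t1 t2 d)"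
proof (rule ideal_resolution.intro)
  let ?G = "cone_cells G" and ?d = "cone_diff t1 t2 d" and ?e = "cone_aug t1 t2 \<epsilon>"
  show "finite (?G i)" for i using finite_G by (auto simp: cone_cells_def split: nat.splits)
  show "R_linear ?e"
    unfolding cone_aug_def by (intro R_linear_intros R_linear_comp[OF lin_\<epsilon>])
  show "R_linear (\<lambda>x. ?d i x g)" for i g
  proof (cases "\<exists>h. g = 0 # h \<or> g = Suc 0 # h \<or> g = 2 # h")
    case True
    then obtain h where "g = 0 # h \<or> g = Suc 0 # h \<or> g = 2 # h" by blast
    then show ?thesis
      unfolding cone_diff_def
      by (elim disjE; cases "i = 0") (simp_all add: R_linear_intros R_linear_comp[OF lin_d])
  next
    case False
    then have "(\<lambda>x. ?d i x g) = (\<lambda>_. 0)"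
      unfolding cone_diff_def tri_def by (intro ext) (simp split: list.split)
    then show ?thesis by (simp only: R_linear_intros)
  qed
  show "?d i x \<in> supp_on (?G i)" if x_in: "x \<in> supp_on (?G (Suc i))" for x i
  proof -
    obtain a b c where abc: "a \<in> supp_on (G (Suc i))" "b \<in> supp_on (G (Suc i))" "c \<in> supp_on (G i)"
      and x: "x = tri a b c" using x_in by (rule supp_on_cone_cells_SucE)
    have "(if i = 0 then (\<lambda>_. 0) else (\<lambda>g. - d (i - 1) c g)) \<in> third_part G i"
      using abc(3) d_supp by (cases i) (auto simp: third_part_def intro: supp_on_intros)
    then show ?thesis unfolding x cone_diff_tri
      using abc by (intro tri_supp supp_on_intros d_supp)
  qed
  show "?e ` supp_on (?G 0) = mon_ideal (\<lambda>m. Q m \<and> ((\<exists>s. m = t1 + s) \<or> (\<exists>s. m = t2 + s)))" (is "_ = ?M'")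
  proof (rule subset_antisym; rule subsetI)
    fix p assume "p \<in> ?e ` supp_on (?G 0)"
    then obtain x where x: "x \<in> supp_on (?G 0)" "p = ?e x" by (elim imageE)
    obtain a b where ab: "a \<in> supp_on (G 0)" "b \<in> supp_on (G 0)"
      and "x = tri a b (\<lambda>_. 0)" using x(1) by (rule supp_on_cone_cells_0E)
    then have p: "p = pmon t1 * \<epsilon> a + pmon t2 * \<epsilon> b" using x(2) by (simp only: cone_aug_tri)
    show "p \<in> ?M'"
      unfolding mem_mon_ideal
    proof
      fix m assume "m \<in> keys p"
      then consider s where "m = t1 + s" "s \<in> keys (\<epsilon> a)"
        | s where "m = t2 + s" "s \<in> keys (\<epsilon> b)"
        using keys_add[of "pmon t1 * \<epsilon> a" "pmon t2 * \<epsilon> b"] unfolding p keys_pmon_mult by blast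
      then show "Q m \<and> ((\<exists>s. m = t1 + s) \<or> (\<exists>s. m = t2 + s))"
      proof cases
        case 1
        then show ?thesis using \<epsilon>_mem[OF ab(1)] Q1 unfolding M mem_mon_ideal by blast
      next
        case 2
        then show ?thesis using \<epsilon>_mem[OF ab(2)] Q2 unfolding M mem_mon_ideal by blast
      qed
    qed
  next
    fix p :: "('v, 'k) mpoly" assume "p \<in> ?M'"
    then have "\<And>m. m \<in> keys p \<Longrightarrow> (Q m \<and> (\<exists>s. m = t1 + s)) \<or> (Q m \<and> (\<exists>s. m = t2 + s))"
      unfolding mem_mon_ideal by blast
    then obtain q r where p: "p = pmon t1 * q + pmon t2 * r"
      and q: "\<And>m. m \<in> keys q \<Longrightarrow> Q (t1 + m)"
      and r: "\<And>m. m \<in> keys r \<Longrightarrow> Q (t2 + m)"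
      using mon_ideal_two_monomials[of p Q t1 Q t2] by metis
    have "q \<in> M" using q unfolding M mem_mon_ideal Q1 by (rule ballI)
    moreover have "r \<in> M" using r unfolding M mem_mon_ideal Q2 by (rule ballI)
    ultimately obtain a b where ab: "a \<in> supp_on (G 0)" "b \<in> supp_on (G 0)" "q = \<epsilon> a" "r = \<epsilon> b"
      by (metis \<epsilon>_memE)
    have "tri a b (\<lambda>_. 0) \<in> supp_on (?G 0)" using ab by (intro tri_supp) (simp_all add: third_part_def)
    moreover have "p = ?e (tri a b (\<lambda>_. 0))" unfolding cone_aug_tri p ab ..
    ultimately show "p \<in> ?e ` supp_on (?G 0)" by (intro image_eqI)
  qed
  show "?e x = 0 \<longleftrightarrow> x \<in> ?d 0 ` supp_on (?G (Suc 0))" if x_in: "x \<in> supp_on (?G 0)" for x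
  proof -
    obtain a b where ab: "a \<in> supp_on (G 0)" "b \<in> supp_on (G 0)" and x: "x = tri a b (\<lambda>_. 0)"
      using x_in by (rule supp_on_cone_cells_0E)
    show ?thesis
    proof
      assume "?e x = 0"
      then obtain r where r: "\<epsilon> a = pmon t2 * r" "\<epsilon> b = - (pmon t1 * r)"
        unfolding x cone_aug_tri using coprime_syzygy[OF cop] by metis
      have "pmon t2 * r \<in> mon_ideal Q" using \<epsilon>_mem[OF ab(1)] unfolding r(1) M .
      then have "r \<in> mon_ideal Q" by (simp add: mem_mon_ideal keys_pmon_mult Q2)
      then obtain c where c: "c \<in> supp_on (G 0)" "r = \<epsilon> c" using \<epsilon>_memE unfolding M by blast
      have z: "\<epsilon> (\<lambda>g. a g - pmon t2 * c g) = 0" "\<epsilon> (\<lambda>g. b g + pmon t1 * c g) = 0"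
        using r c by (simp_all add: R_linear_add[OF lin_\<epsilon>] R_linear_diff[OF lin_\<epsilon>] R_linear_scale[OF lin_\<epsilon>])
      obtain a' where a': "a' \<in> supp_on (G (Suc 0))" "(\<lambda>g. a g - pmon t2 * c g) = d 0 a'"
        by (rule exact0E[OF supp_on_diff[OF ab(1) supp_on_scale[OF c(1)]] z(1)])
      obtain b' where b': "b' \<in> supp_on (G (Suc 0))" "(\<lambda>g. b g + pmon t1 * c g) = d 0 b'"
        by (rule exact0E[OF supp_on_add[OF ab(2) supp_on_scale[OF c(1)]] z(2)])
      have "a = (\<lambda>g. d 0 a' g + pmon t2 * c g)" "b = (\<lambda>g. d 0 b' g - pmon t1 * c g)"
        using fun_cong[OF a'(2)] fun_cong[OF b'(2)] by (simp_all add: fun_eq_iff algebra_simps)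
      then have "x = ?d 0 (tri a' b' c)" unfolding cone_diff_tri x by simp
      moreover have "tri a' b' c \<in> supp_on (?G (Suc 0))"
        using a' b' c by (intro tri_supp) (simp_all add: third_part_def)
      ultimately show "x \<in> ?d 0 ` supp_on (?G (Suc 0))" by (rule image_eqI)
    next
      assume "x \<in> ?d 0 ` supp_on (?G (Suc 0))"
      then obtain a' b' c where abc: "a' \<in> supp_on (G (Suc 0))" "b' \<in> supp_on (G (Suc 0))" "c \<in> supp_on (G 0)"
        and "x = ?d 0 (tri a' b' c)" by (elim imageE supp_on_cone_cells_SucE) blast
      then have e: "a = (\<lambda>g. d 0 a' g + pmon t2 * c g)" "b = (\<lambda>g. d 0 b' g - pmon t1 * c g)"
        unfolding x cone_diff_tri tri_eq_iff by simp_all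
      have "\<epsilon> a = pmon t2 * \<epsilon> c" "\<epsilon> b = - (pmon t1 * \<epsilon> c)"
        unfolding e R_linear_add[OF lin_\<epsilon>] R_linear_diff[OF lin_\<epsilon>] R_linear_scale[OF lin_\<epsilon>]
          \<epsilon>_d[OF abc(1)] \<epsilon>_d[OF abc(2)] by simp_all
      then show "?e x = 0"
        unfolding x cone_aug_tri by (simp add: mult.left_commute[of "pmon t1" "pmon t2"])
    qed
  qed
  show "?d i x = (\<lambda>_. 0) \<longleftrightarrow> x \<in> ?d (Suc i) ` supp_on (?G (Suc (Suc i)))"
    if x_in: "x \<in> supp_on (?G (Suc i))" for x i
  proof -
    obtain a b c where abc: "a \<in> supp_on (G (Suc i))" "b \<in> supp_on (G (Suc i))" "c \<in> supp_on (G i)"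
      and x: "x = tri a b c" using x_in by (rule supp_on_cone_cells_SucE)
    show ?thesis
    proof
      assume "?d i x = (\<lambda>_. 0)"
      then have z: "(\<lambda>g. d i a g + pmon t2 * c g) = (\<lambda>_. 0)" "(\<lambda>g. d i b g - pmon t1 * c g) = (\<lambda>_. 0)"
        and z3: "(if i = 0 then (\<lambda>_. 0) else (\<lambda>g. - d (i - 1) c g)) = (\<lambda>_. 0)"
        unfolding x cone_diff_tri tri_eq_zero_iff by simp_all
      have "c \<in> d i ` supp_on (G (Suc i))"
      proof (cases i)
        case 0
        have "\<epsilon> (\<lambda>g. d 0 a g + pmon t2 * c g) = pmon t2 * \<epsilon> c"
          using abc 0 by (simp add: R_linear_add[OF lin_\<epsilon>] R_linear_scale[OF lin_\<epsilon>] \<epsilon>_d)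
        then have "\<epsilon> c = 0" using z(1) 0 R_linear_zero[OF lin_\<epsilon>] by simp
        then show ?thesis using exact0 abc 0 by simp
      next
        case (Suc j)
        then have "(\<lambda>g. - d j c g) = (\<lambda>_. 0)" using z3 by simp
        then have "d j c = (\<lambda>_. 0)" by (simp add: fun_eq_iff)
        then show ?thesis using exact[of c j] abc Suc by simp
      qed
      then obtain c' where c': "c' \<in> supp_on (G (Suc i))" "c = d i c'" by blast
      have y1: "d i (\<lambda>g. a g + pmon t2 * c' g) = (\<lambda>_. 0)"
        using z(1) unfolding d_add d_scale c'(2) .
      have y2: "d i (\<lambda>g. b g - pmon t1 * c' g) = (\<lambda>_. 0)"
        using z(2) unfolding d_diff d_scale c'(2) .
      obtain a' where a': "a' \<in> supp_on (G (Suc (Suc i)))" "(\<lambda>g. a g + pmon t2 * c' g) = d (Suc i) a'"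
        by (rule exactE[OF supp_on_add[OF abc(1) supp_on_scale[OF c'(1)]] y1])
      obtain b' where b': "b' \<in> supp_on (G (Suc (Suc i)))" "(\<lambda>g. b g - pmon t1 * c' g) = d (Suc i) b'"
        by (rule exactE[OF supp_on_diff[OF abc(2) supp_on_scale[OF c'(1)]] y2])
      have "a = (\<lambda>g. d (Suc i) a' g + pmon t2 * - c' g)" "b = (\<lambda>g. d (Suc i) b' g - pmon t1 * - c' g)"
        unfolding a'(2)[symmetric] b'(2)[symmetric] by simp_all
      moreover have "c = (\<lambda>g. - d i (\<lambda>g. - c' g) g)" unfolding c'(2) d_uminus by simp
      ultimately have "x = ?d (Suc i) (tri a' b' (\<lambda>g. - c' g))" unfolding cone_diff_tri x by simp
      moreover have "tri a' b' (\<lambda>g. - c' g) \<in> supp_on (?G (Suc (Suc i)))"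
        using a' b' supp_on_uminus[OF c'(1)] by (intro tri_supp) (simp_all add: third_part_def)
      ultimately show "x \<in> ?d (Suc i) ` supp_on (?G (Suc (Suc i)))" by (rule image_eqI)
    next
      assume "x \<in> ?d (Suc i) ` supp_on (?G (Suc (Suc i)))"
      then obtain a' b' c' where abc': "a' \<in> supp_on (G (Suc (Suc i)))" "b' \<in> supp_on (G (Suc (Suc i)))"
          "c' \<in> supp_on (G (Suc i))"
        and "x = ?d (Suc i) (tri a' b' c')" by (elim imageE supp_on_cone_cells_SucE) blast
      then have e: "a = (\<lambda>g. d (Suc i) a' g + pmon t2 * c' g)" "b = (\<lambda>g. d (Suc i) b' g - pmon t1 * c' g)"
          "c = (\<lambda>g. - d i c' g)"
        unfolding x cone_diff_tri tri_eq_iff by simp_all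
      have "(\<lambda>g. d i a g + pmon t2 * c g) = (\<lambda>_. 0)" "(\<lambda>g. d i b g - pmon t1 * c g) = (\<lambda>_. 0)"
        unfolding e d_add d_diff d_scale d_uminus d_d[OF abc'(1)] d_d[OF abc'(2)] by simp_all
      moreover have "(if i = 0 then (\<lambda>_. 0) else (\<lambda>g. - d (i - 1) c g)) = (\<lambda>_. 0)"
        using abc' d_d unfolding e d_uminus by (cases i) simp_all
      ultimately show "?d i x = (\<lambda>_. 0)" unfolding x cone_diff_tri tri_eq_zero_iff by (intro conjI)
    qed
  qed
  show "pp_degree m = cone_deg t1 t2 \<delta> 0 g"
    if g: "g \<in> ?G 0" and m: "m \<in> keys (?e (unit_at g))" for g m
    using g
  proof (cases rule: cone_cellsE)
    case (0 g')
    then show ?thesis using m deg_\<epsilon>[of g']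
      by (auto simp: cone_deg_def unit_at_tri cone_aug_tri R_linear_zero[OF lin_\<epsilon>] keys_pmon_mult pp_degree_add)
  next
    case (1 g')
    then show ?thesis using m deg_\<epsilon>[of g']
      by (auto simp: cone_deg_def unit_at_tri cone_aug_tri R_linear_zero[OF lin_\<epsilon>] keys_pmon_mult pp_degree_add)
  qed simp
  show "pp_degree m + cone_deg t1 t2 \<delta> i g = cone_deg t1 t2 \<delta> (Suc i) h"
    if g: "g \<in> ?G i" and h: "h \<in> ?G (Suc i)" and m: "m \<in> keys (?d i (unit_at h) g)" for g h m i
    using h
  proof (cases rule: cone_cellsE)
    case (0 h')
    from g show ?thesis
      by (cases rule: cone_cellsE) (use 0 m deg_d[of _ i h'] in \<open>simp_all add: cone_deg_def cone_diff_unit_at\<close>)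
  next
    case (1 h')
    from g show ?thesis
      by (cases rule: cone_cellsE) (use 1 m deg_d[of _ i h'] in \<open>simp_all add: cone_deg_def cone_diff_unit_at\<close>)
  next
    case (2 h' i')
    then have h': "h = 2 # h'" "h' \<in> G i" by simp_all
    from g show ?thesis
    proof (cases rule: cone_cellsE)
      case (0 g')
      then show ?thesis using h' m
        by (cases "g' = h'") (simp_all add: cone_deg_def cone_diff_unit_at unit_at_def[of h'])
    next
      case (1 g')
      then show ?thesis using h' m
        by (cases "g' = h'") (simp_all add: cone_deg_def cone_diff_unit_at unit_at_def[of h'] keys_uminus_mpoly)
    next
      case (2 g' j)
      then show ?thesis using h' m deg_d[of g' j h']
        by (simp add: cone_deg_def cone_diff_unit_at keys_uminus_mpoly)
    qed
  qed
  show "lookup (?d i (unit_at h) g) 0 = 0"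
    if g: "g \<in> ?G i" and h: "h \<in> ?G (Suc i)" for g h i
    using h
  proof (cases rule: cone_cellsE)
    case (0 h')
    from g show ?thesis
      by (cases rule: cone_cellsE) (use 0 min_d[of _ i h'] in \<open>simp_all add: cone_diff_unit_at\<close>)
  next
    case (1 h')
    from g show ?thesis
      by (cases rule: cone_cellsE) (use 1 min_d[of _ i h'] in \<open>simp_all add: cone_diff_unit_at\<close>)
  next
    case (2 h' i')
    then have h': "h = 2 # h'" "h' \<in> G i" by simp_all
    note z = lookup_pmon_mult_0[OF nz(1)] lookup_pmon_mult_0[OF nz(2)]
    from g show ?thesis
    proof (cases rule: cone_cellsE)
      case (2 g' j)
      then show ?thesis using h' min_d[of g' j h'] by (simp add: cone_diff_unit_at)
    qed (use h' z in \<open>simp_all add: cone_diff_unit_at\<close>)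
  qed
qed

section \<open>Adding one generator\<close>

text \<open>
  Chains on the given cells, marked by the tag 0, and one additional cell \<open>[1]\<close>.
\<close>

definition duo :: "(nat list \<Rightarrow> 'r) \<Rightarrow> 'r \<Rightarrow> nat list \<Rightarrow> 'r::zero" where
  "duo a y l = (case l of [] \<Rightarrow> 0 | t # g \<Rightarrow> if t = 0 then a g else if l = [Suc 0] then y else 0)"

lemma duo_simps [simp]: "duo a y [] = 0" "duo a y (0 # g) = a g" "duo a y [Suc 0] = y"
  by (simp_all add: duo_def)

lemma duo_parts: "(\<lambda>g. duo a y (0 # g)) = a"
  by simp

lemma duo_eq_iff: "duo a y = duo a' y' \<longleftrightarrow> a = a' \<and> y = y'"
proof
  assume e: "duo a y = duo a' y'"
  have "a g = a' g" for g using fun_cong[OF e, of "0 # g"] by simp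
  moreover have "y = y'" using fun_cong[OF e, of "[Suc 0]"] by simp
  ultimately show "a = a' \<and> y = y'" by (intro conjI ext)
qed simp

lemma duo_zero: "duo (\<lambda>_. 0) 0 = (\<lambda>_. 0)"
  by (intro ext) (simp add: duo_def split: list.split)

lemma duo_eq_zero_iff: "duo a y = (\<lambda>_. 0) \<longleftrightarrow> a = (\<lambda>_. 0) \<and> y = 0"
  using duo_eq_iff[of a y "\<lambda>_. 0" 0] unfolding duo_zero .

text \<open>
  For the ideal \<open>x\<^bsup>t1\<^esup> M + (x\<^bsup>t2\<^esup>)\<close> with \<open>t2 = t0 + tP\<close>, where \<open>x\<^bsup>t0\<^esup>\<close> is the generator of \<open>M\<close> at the cell \<open>g0\<close>: one
  new generator, and one new syzygy which expresses that \<open>x\<^bsup>t1\<^esup>\<close> times the new generator is \<open>x\<^bsup>tP\<^esup>\<close> times the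
  one at \<open>g0\<close>. In the picture of a cellular resolution an edge is attached at the vertex \<open>g0\<close>.
\<close>

definition whisker_cells :: "(nat \<Rightarrow> nat list set) \<Rightarrow> nat \<Rightarrow> nat list set" where
  "whisker_cells G i = (#) 0 ` G i \<union> (if i \<le> 1 then {[Suc 0]} else {})"

definition whisker_deg where
  "whisker_deg t1 t2 \<delta> i l = (case l of [] \<Rightarrow> 0 | t # g \<Rightarrow>
     if t = 0 then \<delta> i g + pp_degree t1 else pp_degree t2 + (if i = 0 then 0 else pp_degree t1))"

definition whisker_aug :: "('v \<Rightarrow>\<^sub>0 nat) \<Rightarrow> ('v \<Rightarrow>\<^sub>0 nat) \<Rightarrow> ((nat list \<Rightarrow> ('v, 'k::field) mpoly) \<Rightarrow> ('v, 'k) mpoly) \<Rightarrow>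
    (nat list \<Rightarrow> ('v, 'k) mpoly) \<Rightarrow> ('v, 'k) mpoly" where
  "whisker_aug t1 t2 \<epsilon> x = pmon t1 * \<epsilon> (\<lambda>g. x (0 # g)) + pmon t2 * x [Suc 0]"

definition whisker_diff :: "('v \<Rightarrow>\<^sub>0 nat) \<Rightarrow> ('v \<Rightarrow>\<^sub>0 nat) \<Rightarrow> nat list \<Rightarrow>
    (nat \<Rightarrow> (nat list \<Rightarrow> ('v, 'k::field) mpoly) \<Rightarrow> nat list \<Rightarrow> ('v, 'k) mpoly) \<Rightarrow>
    nat \<Rightarrow> (nat list \<Rightarrow> ('v, 'k) mpoly) \<Rightarrow> nat list \<Rightarrow> ('v, 'k) mpoly" where
  "whisker_diff t1 tP g0 d i x = (if i = 0
     then duo (\<lambda>g. d 0 (\<lambda>g. x (0 # g)) g - pmon tP * (unit_at g0 g * x [Suc 0])) (pmon t1 * x [Suc 0])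
     else duo (d i (\<lambda>g. x (0 # g))) 0)"

lemma whisker_cellsE:
  assumes "l \<in> whisker_cells G i"
  obtains (0) g where "l = 0 # g" "g \<in> G i" | (1) "l = [Suc 0]" "i \<le> 1"
  using assms unfolding whisker_cells_def by (auto split: if_splits)

lemma duo_supp:
  assumes "a \<in> supp_on (G i)" "i \<le> 1 \<or> y = 0"
  shows "duo a y \<in> supp_on (whisker_cells G i)"
  unfolding supp_on_def
proof (rule CollectI, intro allI impI)
  fix l assume l: "l \<notin> whisker_cells G i"
  consider (0) g where "l = 0 # g" | (1) "l = [Suc 0]" | (2) "\<nexists>g. l = 0 # g" "l \<noteq> [Suc 0]" by blast
  then show "duo a y l = 0"
  proof cases
    case 0
    then show ?thesis using l assms(1) by (simp add: whisker_cells_def supp_on_def image_iff)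
  next
    case 1
    then show ?thesis using l assms(2) by (simp add: whisker_cells_def split: if_splits)
  next
    case 2
    then show ?thesis by (simp add: duo_def split: list.split)
  qed
qed

lemma supp_on_whisker_cellsE:
  assumes x: "x \<in> supp_on (whisker_cells G i)"
  obtains a y where "a \<in> supp_on (G i)" "i \<le> 1 \<or> y = 0" "x = duo a y"
proof (rule that)
  have z: "x l = 0" if "l \<notin> whisker_cells G i" for l using x that by (simp add: supp_on_def)
  show "(\<lambda>g. x (0 # g)) \<in> supp_on (G i)"
    unfolding supp_on_def by (rule CollectI, intro allI impI z) (simp add: whisker_cells_def image_iff)
  show "i \<le> 1 \<or> x [Suc 0] = 0"
    using z[of "[Suc 0]"] by (cases "i \<le> 1") (simp_all add: whisker_cells_def image_iff)
  show "x = duo (\<lambda>g. x (0 # g)) (x [Suc 0])"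
  proof
    fix l
    consider (0) g where "l = 0 # g" | (1) "l = [Suc 0]" | (2) "\<nexists>g. l = 0 # g" "l \<noteq> [Suc 0]" by blast
    then show "x l = duo (\<lambda>g. x (0 # g)) (x [Suc 0]) l"
    proof cases
      case 2
      then have "l \<notin> whisker_cells G i" by (simp add: whisker_cells_def image_iff)
      then have "x l = 0" by (rule z)
      with 2 show ?thesis by (simp add: duo_def split: list.split)
    qed simp_all
  qed
qed

lemma whisker_aug_duo: "whisker_aug t1 t2 \<epsilon> (duo a y) = pmon t1 * \<epsilon> a + pmon t2 * y"
  by (simp add: whisker_aug_def duo_parts)

lemma whisker_diff_duo:
  "whisker_diff t1 tP g0 d 0 (duo a y) = duo (\<lambda>g. d 0 a g - pmon tP * (unit_at g0 g * y)) (pmon t1 * y)"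
  "whisker_diff t1 tP g0 d (Suc i) (duo a y) = duo (d (Suc i) a) 0"
  by (simp_all add: whisker_diff_def duo_parts)

lemma unit_at_duo:
  "unit_at (0 # g) = duo (unit_at g) 0" "unit_at [Suc 0] = duo (\<lambda>_. 0) 1"
  by (auto simp: unit_at_def duo_def fun_eq_iff split: list.split)

lemma unit_at_self [simp]: "unit_at g g = 1"
  by (simp add: unit_at_def)

lemma unit_at_other: "h \<noteq> g \<Longrightarrow> unit_at g h = 0"
  by (simp add: unit_at_def)

lemma (in ideal_resolution) \<epsilon>_unit_at_scale: "\<epsilon> (\<lambda>g. unit_at g0 g * y) = y * \<epsilon> (unit_at g0)"
proof -
  have "(\<lambda>g. unit_at g0 g * y) = (\<lambda>g. y * unit_at g0 g)" by (simp add: mult.commute)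
  then show ?thesis by (simp only: R_linear_scale[OF lin_\<epsilon>])
qed

lemma ring_whisker_1: "(a :: 'a::comm_ring_1) * (0 - b * (y * c)) + (c * b) * (a * y) = 0"
  by (simp add: algebra_simps)

lemma ring_whisker_2: "((c :: 'a::comm_ring_1) * b) * r + b * (- r * c) = 0"
  by (simp add: algebra_simps)

lemma mon_ideal_sum_eq:
  fixes M :: "('v, 'k::field) mpoly set"
  assumes M: "M = mon_ideal Q" and Q1: "\<And>m. Q (t1 + m) \<longleftrightarrow> Q m"
  shows "{pmon t1 * q + pmon t2 * r | q r. q \<in> M} = mon_ideal (\<lambda>m. (Q m \<and> (\<exists>s. m = t1 + s)) \<or> (\<exists>s. m = t2 + s))"
    (is "?L = ?M'")
proof (rule subset_antisym; rule subsetI)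
  fix p assume "p \<in> ?L"
  then obtain q r where p: "p = pmon t1 * q + pmon t2 * r" and q: "q \<in> M" by blast
  show "p \<in> ?M'" unfolding mem_mon_ideal
  proof
    fix m assume "m \<in> keys p"
    then consider s where "m = t1 + s" "s \<in> keys q" | s where "m = t2 + s" "s \<in> keys r"
      using keys_add[of "pmon t1 * q" "pmon t2 * r"] unfolding p keys_pmon_mult by blast
    then show "(Q m \<and> (\<exists>s. m = t1 + s)) \<or> (\<exists>s. m = t2 + s)"
    proof cases
      case 1
      then show ?thesis using q Q1 unfolding M mem_mon_ideal by blast
    next
      case 2
      then show ?thesis by blast
    qed
  qed
next
  fix p :: "('v, 'k) mpoly" assume "p \<in> ?M'"
  then have "\<And>m. m \<in> keys p \<Longrightarrow> (Q m \<and> (\<exists>s. m = t1 + s)) \<or> (True \<and> (\<exists>s. m = t2 + s))"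
    unfolding mem_mon_ideal by blast
  then obtain q r where p: "p = pmon t1 * q + pmon t2 * r"
    and q: "\<And>m. m \<in> keys q \<Longrightarrow> Q (t1 + m)"
    using mon_ideal_two_monomials[of p Q t1 "\<lambda>_. True" t2] by metis
  have "q \<in> M" using q unfolding M mem_mon_ideal Q1 by (rule ballI)
  then show "p \<in> ?L" using p by blast
qed

text \<open>
  The intersection of \<open>x\<^bsup>t1\<^esup> M\<close> with the new principal ideal is generated by \<open>x\<^bsup>t1 + t2\<^esup>\<close>, as \<open>x\<^bsup>t1\<^esup>\<close> is prime to \<open>x\<^bsup>t2\<^esup>\<close>
  and \<open>x\<^bsup>t2\<^esup> \<in> M\<close>; so one new syzygy suffices. The condition \<open>tP \<noteq> 0\<close> keeps the resolution minimal.
\<close>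

lemma (in ideal_resolution) whisker:
  assumes M: "M = mon_ideal Q" and Q1: "\<And>m. Q (t1 + m) \<longleftrightarrow> Q m"
    and g0: "g0 \<in> G 0" "\<epsilon> (unit_at g0) = pmon t0"
    and cop: "\<And>v. lookup t1 v = 0 \<or> lookup (t0 + tP) v = 0"
    and nz: "t1 \<noteq> 0" "tP \<noteq> 0"
  shows "ideal_resolution (mon_ideal (\<lambda>m. (Q m \<and> (\<exists>s. m = t1 + s)) \<or> (\<exists>s. m = (t0 + tP) + s)))
    (whisker_cells G) (whisker_deg t1 (t0 + tP) \<delta>) (whisker_aug t1 (t0 + tP) \<epsilon>) (whisker_diff t1 tP g0 d)"
proof (rule ideal_resolution.intro)
  let ?G = "whisker_cells G" and ?d = "whisker_diff t1 tP g0 d" and ?e = "whisker_aug t1 (t0 + tP) \<epsilon>"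
  show "finite (?G i)" for i using finite_G by (simp add: whisker_cells_def)
  show "R_linear ?e"
    unfolding whisker_aug_def by (intro R_linear_intros R_linear_comp[OF lin_\<epsilon>])
  show "R_linear (\<lambda>x. ?d i x g)" for i g
  proof -
    consider (0) h where "g = 0 # h" | (1) "g = [Suc 0]" | (2) "\<nexists>h. g = 0 # h" "g \<noteq> [Suc 0]" by blast
    then show ?thesis
    proof cases
      case 0
      then show ?thesis
        by (cases i) (simp_all add: whisker_diff_def R_linear_intros R_linear_comp[OF lin_d])
    next
      case 1
      then show ?thesis by (cases i) (simp_all add: whisker_diff_def R_linear_intros)
    next
      case 2
      then have "(\<lambda>x. ?d i x g) = (\<lambda>_. 0)"
        by (intro ext) (simp add: whisker_diff_def duo_def split: list.split)
      then show ?thesis by (simp only: R_linear_const_0)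
    qed
  qed
  have uz: "unit_at g0 g = (0 :: ('v, 'k) mpoly)" if "g \<notin> G 0" for g
    using that g0(1) by (intro unit_at_other) blast
  have supp_tail: "(\<lambda>g. pmon tP * (unit_at g0 g * y)) \<in> supp_on (G 0)" for y :: "('v, 'k) mpoly"
    using uz by (simp add: supp_on_def)
  show "?d i x \<in> supp_on (?G i)" if x_in: "x \<in> supp_on (?G (Suc i))" for x i
  proof -
    obtain a y where a: "a \<in> supp_on (G (Suc i))" and x: "x = duo a y"
      using x_in by (rule supp_on_whisker_cellsE)
    show ?thesis
    proof (cases i)
      case 0
      show ?thesis unfolding x 0 whisker_diff_duo
        using a 0 by (intro duo_supp supp_on_diff d_supp supp_tail) simp_all
    next
      case (Suc j)
      show ?thesis unfolding x Suc whisker_diff_duo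
        using a Suc by (intro duo_supp d_supp) simp_all
    qed
  qed
  show "?e ` supp_on (?G 0) = mon_ideal (\<lambda>m. (Q m \<and> (\<exists>s. m = t1 + s)) \<or> (\<exists>s. m = (t0 + tP) + s))"
    unfolding mon_ideal_sum_eq[of M Q t1 "t0 + tP", OF M Q1, symmetric]
  proof (rule subset_antisym; rule subsetI)
    fix p assume "p \<in> ?e ` supp_on (?G 0)"
    then obtain x where x: "x \<in> supp_on (?G 0)" "p = ?e x" by (elim imageE)
    obtain a y where a: "a \<in> supp_on (G 0)" and "x = duo a y"
      using x(1) by (rule supp_on_whisker_cellsE)
    then have "p = pmon t1 * \<epsilon> a + pmon (t0 + tP) * y" using x(2) by (simp only: whisker_aug_duo)
    then show "p \<in> {pmon t1 * q + pmon (t0 + tP) * r |q r. q \<in> M}" using \<epsilon>_mem[OF a] by blast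
  next
    fix p assume "p \<in> {pmon t1 * q + pmon (t0 + tP) * r |q r. q \<in> M}"
    then obtain q r where p: "p = pmon t1 * q + pmon (t0 + tP) * r" and "q \<in> M" by blast
    then obtain a where a: "a \<in> supp_on (G 0)" "q = \<epsilon> a" using \<epsilon>_memE by blast
    have "p = ?e (duo a r)" unfolding whisker_aug_duo p a ..
    moreover have "duo a r \<in> supp_on (?G 0)" using a by (intro duo_supp) simp_all
    ultimately show "p \<in> ?e ` supp_on (?G 0)" by (rule image_eqI)
  qed
  show "?e x = 0 \<longleftrightarrow> x \<in> ?d 0 ` supp_on (?G (Suc 0))" if x_in: "x \<in> supp_on (?G 0)" for x
  proof -
    obtain a y where a: "a \<in> supp_on (G 0)" and x: "x = duo a y"
      using x_in by (rule supp_on_whisker_cellsE)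
    show ?thesis
    proof
      assume "?e x = 0"
      then obtain r where r: "\<epsilon> a = pmon (t0 + tP) * r" "y = - (pmon t1 * r)"
        unfolding x whisker_aug_duo using coprime_syzygy[OF cop] by metis
      have z: "\<epsilon> (\<lambda>g. a g + pmon tP * (unit_at g0 g * - r)) = 0"
        unfolding R_linear_add[OF lin_\<epsilon>] R_linear_scale[OF lin_\<epsilon>] \<epsilon>_unit_at_scale g0(2) r(1) pmon_add
        by (rule ring_whisker_2)
      obtain a' where a': "a' \<in> supp_on (G (Suc 0))" "(\<lambda>g. a g + pmon tP * (unit_at g0 g * - r)) = d 0 a'"
        by (rule exact0E[OF supp_on_add[OF a supp_tail] z])
      have "x = ?d 0 (duo a' (- r))"
        unfolding whisker_diff_duo x a'(2)[symmetric] r(2) by simp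
      moreover have "duo a' (- r) \<in> supp_on (?G (Suc 0))" using a' by (intro duo_supp) simp_all
      ultimately show "x \<in> ?d 0 ` supp_on (?G (Suc 0))" by (rule image_eqI)
    next
      assume "x \<in> ?d 0 ` supp_on (?G (Suc 0))"
      then obtain a' y' where a': "a' \<in> supp_on (G (Suc 0))" and "x = ?d 0 (duo a' y')"
        by (elim imageE supp_on_whisker_cellsE) blast
      then have e: "a = (\<lambda>g. d 0 a' g - pmon tP * (unit_at g0 g * y'))" "y = pmon t1 * y'"
        unfolding x whisker_diff_duo duo_eq_iff by simp_all
      show "?e x = 0"
        unfolding x whisker_aug_duo e R_linear_diff[OF lin_\<epsilon>] R_linear_scale[OF lin_\<epsilon>] \<epsilon>_unit_at_scale
          g0(2) \<epsilon>_d[OF a'] pmon_add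
        by (rule ring_whisker_1)
    qed
  qed
  show "?d i x = (\<lambda>_. 0) \<longleftrightarrow> x \<in> ?d (Suc i) ` supp_on (?G (Suc (Suc i)))"
    if x_in: "x \<in> supp_on (?G (Suc i))" for x i
  proof -
    obtain a y where a: "a \<in> supp_on (G (Suc i))" "Suc i \<le> 1 \<or> y = 0" and x: "x = duo a y"
      using x_in by (rule supp_on_whisker_cellsE)
    have l: "?d i x = (\<lambda>_. 0) \<longleftrightarrow> y = 0 \<and> d i a = (\<lambda>_. 0)"
    proof (cases i)
      case 0
      show ?thesis unfolding x 0 whisker_diff_duo duo_eq_zero_iff pmon_mult_eq_0_iff by auto
    next
      case (Suc j)
      show ?thesis using a(2) unfolding x Suc whisker_diff_duo duo_eq_zero_iff by simp
    qed
    show ?thesis unfolding l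
    proof
      assume z: "y = 0 \<and> d i a = (\<lambda>_. 0)"
      then obtain a' where a': "a' \<in> supp_on (G (Suc (Suc i)))" "a = d (Suc i) a'"
        using exactE[OF a(1)] by blast
      have "x = ?d (Suc i) (duo a' 0)" unfolding x whisker_diff_duo using z a' by simp
      moreover have "duo a' 0 \<in> supp_on (?G (Suc (Suc i)))" using a' by (intro duo_supp) simp_all
      ultimately show "x \<in> ?d (Suc i) ` supp_on (?G (Suc (Suc i)))" by (rule image_eqI)
    next
      assume "x \<in> ?d (Suc i) ` supp_on (?G (Suc (Suc i)))"
      then obtain a' y' where a': "a' \<in> supp_on (G (Suc (Suc i)))" and "x = ?d (Suc i) (duo a' y')"
        by (elim imageE supp_on_whisker_cellsE) blast
      then have "a = d (Suc i) a'" "y = 0" unfolding x whisker_diff_duo duo_eq_iff by simp_all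
      then show "y = 0 \<and> d i a = (\<lambda>_. 0)" using d_d[OF a'] by simp
    qed
  qed
  have deg_g0: "\<delta> 0 g0 = pp_degree t0" using deg_\<epsilon>[OF g0(1), of t0] unfolding g0(2) by simp
  have u0: "?d 0 (unit_at (0 # h)) = duo (d 0 (unit_at h)) 0" for h
    unfolding unit_at_duo whisker_diff_duo by simp
  have u1: "?d 0 (unit_at [Suc 0]) = duo (\<lambda>g. - (pmon tP * unit_at g0 g)) (pmon t1)"
    unfolding unit_at_duo whisker_diff_duo d_zero by simp
  have u2: "?d (Suc i) (unit_at (0 # h)) = duo (d (Suc i) (unit_at h)) 0" for h i
    unfolding unit_at_duo whisker_diff_duo by simp
  show "pp_degree m = whisker_deg t1 (t0 + tP) \<delta> 0 g"
    if g: "g \<in> ?G 0" and m: "m \<in> keys (?e (unit_at g))" for g m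
    using g
  proof (cases rule: whisker_cellsE)
    case (0 g')
    then show ?thesis using m deg_\<epsilon>[of g']
      by (auto simp: whisker_deg_def unit_at_duo whisker_aug_duo keys_pmon_mult pp_degree_add)
  next
    case 1
    then show ?thesis using m
      by (simp add: whisker_deg_def unit_at_duo whisker_aug_duo R_linear_zero[OF lin_\<epsilon>])
  qed
  show "pp_degree m + whisker_deg t1 (t0 + tP) \<delta> i g = whisker_deg t1 (t0 + tP) \<delta> (Suc i) h"
    if g: "g \<in> ?G i" and h: "h \<in> ?G (Suc i)" and m: "m \<in> keys (?d i (unit_at h) g)" for g h m i
    using h
  proof (cases rule: whisker_cellsE)
    case (0 h')
    have e: "?d i (unit_at h) = duo (d i (unit_at h')) 0" using u0 u2 0 by (cases i) simp_all
    from g show ?thesis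
    proof (cases rule: whisker_cellsE)
      case g: (0 g')
      show ?thesis using m deg_d[of g' i h' m] g 0 unfolding e by (simp add: whisker_deg_def)
    next
      case 1
      show ?thesis using m unfolding e 1 by simp
    qed
  next
    case 1
    then have i: "i = 0" by simp
    from g show ?thesis
    proof (cases rule: whisker_cellsE)
      case g: (0 g')
      have "m \<in> keys (pmon tP * unit_at g0 g' :: ('v, 'k) mpoly)"
        using m unfolding g 1 i u1 by (simp add: keys_uminus_mpoly)
      then have "g' = g0" "m = tP" by (cases "g' = g0"; simp add: unit_at_other)+
      then show ?thesis unfolding g 1 i by (simp add: whisker_deg_def deg_g0 pp_degree_add)
    next
      case g: 1
      have "m = t1" using m unfolding g 1 i u1 by simp
      then show ?thesis unfolding g 1 i by (simp add: whisker_deg_def)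
    qed
  qed
  show "lookup (?d i (unit_at h) g) 0 = 0"
    if g: "g \<in> ?G i" and h: "h \<in> ?G (Suc i)" for g h i
    using h
  proof (cases rule: whisker_cellsE)
    case (0 h')
    have e: "?d i (unit_at h) = duo (d i (unit_at h')) 0" using u0 u2 0 by (cases i) simp_all
    from g show ?thesis
      by (cases rule: whisker_cellsE) (use min_d[of _ i h'] 0 e in simp_all)
  next
    case 1
    then have i: "i = 0" by simp
    have z: "lookup (pmon t1 :: ('v, 'k) mpoly) 0 = 0"
      using lookup_pmon_mult_0[OF nz(1), of "1 :: ('v, 'k) mpoly"] by simp
    from g show ?thesis
      by (cases rule: whisker_cellsE) (use 1 i u1 z lookup_pmon_mult_0[OF nz(2)] in simp_all)
  qed
qed

section \<open>Replacing one generator by a divisor\<close>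

text \<open>
  If \<open>x\<^bsup>t0\<^esup>\<close> is the generator of \<open>M\<close> at \<open>g0\<close>, then in \<open>x\<^bsup>t1\<^esup> M + (x\<^bsup>t0\<^esup>)\<close> the generator \<open>x\<^bsup>t1 + t0\<^esup>\<close> of \<open>x\<^bsup>t1\<^esup> M\<close> becomes
  redundant. The cells stay the same; at \<open>g0\<close> the generator loses the factor \<open>x\<^bsup>t1\<^esup>\<close> and the coefficients
  of the syzygies gain it.
\<close>

definition rescale :: "('v \<Rightarrow>\<^sub>0 nat) \<Rightarrow> nat list \<Rightarrow> (nat list \<Rightarrow> ('v, 'k::field) mpoly) \<Rightarrow> nat list \<Rightarrow> ('v, 'k) mpoly" where
  "rescale t g0 x = (\<lambda>g. if g = g0 then pmon t * x g else x g)"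

definition rescale_aug :: "('v \<Rightarrow>\<^sub>0 nat) \<Rightarrow> ('v \<Rightarrow>\<^sub>0 nat) \<Rightarrow> nat list \<Rightarrow>
    ((nat list \<Rightarrow> ('v, 'k::field) mpoly) \<Rightarrow> ('v, 'k) mpoly) \<Rightarrow> (nat list \<Rightarrow> ('v, 'k) mpoly) \<Rightarrow> ('v, 'k) mpoly" where
  "rescale_aug t1 t0 g0 \<epsilon> x = pmon t1 * \<epsilon> (\<lambda>g. if g = g0 then 0 else x g) + pmon t0 * x g0"

definition rescale_diff :: "('v \<Rightarrow>\<^sub>0 nat) \<Rightarrow> nat list \<Rightarrow>
    (nat \<Rightarrow> (nat list \<Rightarrow> ('v, 'k::field) mpoly) \<Rightarrow> nat list \<Rightarrow> ('v, 'k) mpoly) \<Rightarrow>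
    nat \<Rightarrow> (nat list \<Rightarrow> ('v, 'k) mpoly) \<Rightarrow> nat list \<Rightarrow> ('v, 'k) mpoly" where
  "rescale_diff t1 g0 d i x = (if i = 0 then rescale t1 g0 (d 0 x) else d i x)"

definition rescale_deg where
  "rescale_deg t1 g0 \<delta> i g = \<delta> i g + (if i = 0 \<and> g = g0 then 0 else pp_degree t1)"

lemma R_linear_mask:
  assumes f: "R_linear f" shows "R_linear (\<lambda>x. f (\<lambda>g. if g = g0 then 0 else x g))"
proof -
  have e: "(\<lambda>g. if g = g0 then 0 else x g + y g) = (\<lambda>g. (if g = g0 then 0 else x g) + (if g = g0 then 0 else y g))"
    "(\<lambda>g. if g = g0 then 0 else a * x g) = (\<lambda>g. a * (if g = g0 then 0 else x g))" 
    for x y :: "'a \<Rightarrow> ('b, 'c) mpoly" and a by (simp_all add: fun_eq_iff)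
  show ?thesis unfolding R_linear_def e R_linear_add[OF f] R_linear_scale[OF f] by simp
qed

lemma rescale_supp: "x \<in> supp_on S \<Longrightarrow> rescale t g0 x \<in> supp_on S"
  by (simp add: supp_on_def rescale_def)

lemma rescale_eq_0_iff: "rescale t g0 x = (\<lambda>_. 0) \<longleftrightarrow> x = (\<lambda>_. 0)"
proof
  assume e: "rescale t g0 x = (\<lambda>_. 0)"
  have "x g = 0" for g using fun_cong[OF e, of g] by (simp add: rescale_def split: if_splits)
  then show "x = (\<lambda>_. 0)" by (rule ext)
qed (simp add: rescale_def fun_eq_iff)

lemma ring_rescale: "(a :: 'a::comm_ring_1) * x + b * (a * y) = a * (x + y * b)"
  by (simp add: algebra_simps)

text \<open>
  Rescaling chains translates the new augmentation into the old one multiplied by \<open>x\<^bsup>t1\<^esup>\<close>.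
\<close>

lemma (in ideal_resolution) rescale_aug_rescale:
  assumes "\<epsilon> (unit_at g0) = pmon t0"
  shows "rescale_aug t1 t0 g0 \<epsilon> (rescale t1 g0 x) = pmon t1 * \<epsilon> x"
proof -
  let ?x = "\<lambda>g. if g = g0 then 0 else x g"
  have "x = (\<lambda>g. ?x g + unit_at g0 g * x g0)" by (auto simp: unit_at_def fun_eq_iff)
  then have "\<epsilon> x = \<epsilon> (\<lambda>g. ?x g + unit_at g0 g * x g0)" by (rule arg_cong)
  also have "\<dots> = \<epsilon> ?x + x g0 * pmon t0"
    unfolding R_linear_add[OF lin_\<epsilon>] \<epsilon>_unit_at_scale assms ..
  finally have e: "\<epsilon> x = \<epsilon> ?x + x g0 * pmon t0" .
  have m: "(\<lambda>g. if g = g0 then 0 else rescale t1 g0 x g) = ?x" by (simp add: rescale_def fun_eq_iff)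
  have r: "rescale t1 g0 x g0 = pmon t1 * x g0" by (simp add: rescale_def)
  show ?thesis unfolding rescale_aug_def e m r by (rule ring_rescale)
qed

text \<open>
  In a syzygy of the new generators the coefficient at \<open>g0\<close> is divisible by \<open>x\<^bsup>t1\<^esup>\<close>, because \<open>x\<^bsup>t1\<^esup>\<close> divides all
  other generators and is prime to \<open>x\<^bsup>t0\<^esup>\<close>. So the new syzygies are exactly the rescaled old ones.
\<close>

lemma (in ideal_resolution) rescale_generator:
  assumes M: "M = mon_ideal Q" and Q1: "\<And>m. Q (t1 + m) \<longleftrightarrow> Q m"
    and g0: "g0 \<in> G 0" "\<epsilon> (unit_at g0) = pmon t0"
    and cop: "\<And>v. lookup t1 v = 0 \<or> lookup t0 v = 0"
    and nz: "t1 \<noteq> 0"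
  shows "ideal_resolution (mon_ideal (\<lambda>m. (Q m \<and> (\<exists>s. m = t1 + s)) \<or> (\<exists>s. m = t0 + s)))
    G (rescale_deg t1 g0 \<delta>) (rescale_aug t1 t0 g0 \<epsilon>) (rescale_diff t1 g0 d)"
proof (rule ideal_resolution.intro)
  let ?d = "rescale_diff t1 g0 d" and ?e = "rescale_aug t1 t0 g0 \<epsilon>"
  note d0 = rescale_diff_def[of t1 g0 d 0, simplified]
  have dS: "?d (Suc i) x = d (Suc i) x" for i x by (simp add: rescale_diff_def)
  show "finite (G i)" for i by (rule finite_G)
  show lin: "R_linear ?e"
    unfolding rescale_aug_def by (intro R_linear_intros R_linear_mask[OF lin_\<epsilon>])
  show "R_linear (\<lambda>x. ?d i x g)" for i g
    unfolding rescale_diff_def rescale_def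
    by (cases "i = 0"; cases "g = g0") (simp_all add: R_linear_intros lin_d)
  show "?d i x \<in> supp_on (G i)" if x_in: "x \<in> supp_on (G (Suc i))" for x i
    using d_supp[OF x_in] rescale_supp by (auto simp: rescale_diff_def)
  show "?e ` supp_on (G 0) = mon_ideal (\<lambda>m. (Q m \<and> (\<exists>s. m = t1 + s)) \<or> (\<exists>s. m = t0 + s))"
    unfolding mon_ideal_sum_eq[of M Q t1 t0, OF M Q1, symmetric]
  proof (rule subset_antisym; rule subsetI)
    fix p assume "p \<in> ?e ` supp_on (G 0)"
    then obtain x where x: "x \<in> supp_on (G 0)" "p = ?e x" by (elim imageE)
    have "(\<lambda>g. if g = g0 then 0 else x g) \<in> supp_on (G 0)" using x(1) by (simp add: supp_on_def)
    then show "p \<in> {pmon t1 * q + pmon t0 * r |q r. q \<in> M}"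
      using \<epsilon>_mem unfolding x(2) rescale_aug_def by blast
  next
    fix p assume "p \<in> {pmon t1 * q + pmon t0 * r |q r. q \<in> M}"
    then obtain q r where p: "p = pmon t1 * q + pmon t0 * r" and "q \<in> M" by blast
    then obtain a where a: "a \<in> supp_on (G 0)" "q = \<epsilon> a" using \<epsilon>_memE by blast
    have "(\<lambda>g. if g = g0 then 0 else r * unit_at g0 g) = (\<lambda>_. 0)" by (simp add: unit_at_def fun_eq_iff)
    then have "?e (\<lambda>g. r * unit_at g0 g) = pmon t0 * r"
      by (simp add: rescale_aug_def R_linear_zero[OF lin_\<epsilon>])
    then have "p = ?e (\<lambda>g. rescale t1 g0 a g + r * unit_at g0 g)"
      unfolding R_linear_add[OF lin] rescale_aug_rescale[OF g0(2)] p a by simp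
    moreover have "(\<lambda>g. rescale t1 g0 a g + r * unit_at g0 g) \<in> supp_on (G 0)"
      by (rule supp_on_add[OF rescale_supp[OF a(1)] supp_on_scale[OF unit_at_supp[OF g0(1)]]])
    ultimately show "p \<in> ?e ` supp_on (G 0)" by (rule image_eqI)
  qed
  show "?e x = 0 \<longleftrightarrow> x \<in> ?d 0 ` supp_on (G (Suc 0))" if x_in: "x \<in> supp_on (G 0)" for x
  proof
    assume ex: "?e x = 0"
    obtain r where r: "x g0 = - (pmon t1 * r)"
      by (rule coprime_syzygy[OF cop ex[unfolded rescale_aug_def]])
    define x' where "x' = (\<lambda>g. if g = g0 then - r else x g)"
    have x: "x = rescale t1 g0 x'" using r by (simp add: x'_def rescale_def fun_eq_iff)
    have x': "x' \<in> supp_on (G 0)" using x_in g0(1) by (auto simp: supp_on_def x'_def)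
    have "\<epsilon> x' = 0" using ex unfolding x rescale_aug_rescale[OF g0(2)] by simp
    then obtain z where z: "z \<in> supp_on (G (Suc 0))" "x' = d 0 z" by (rule exact0E[OF x'])
    have "x = ?d 0 z" unfolding x z(2) d0 ..
    then show "x \<in> ?d 0 ` supp_on (G (Suc 0))" using z(1) by (rule image_eqI)
  next
    assume "x \<in> ?d 0 ` supp_on (G (Suc 0))"
    then obtain z where z: "z \<in> supp_on (G (Suc 0))" "x = ?d 0 z" by (elim imageE)
    show "?e x = 0" unfolding z(2) d0 rescale_aug_rescale[OF g0(2)] \<epsilon>_d[OF z(1)] by simp
  qed
  show "?d i x = (\<lambda>_. 0) \<longleftrightarrow> x \<in> ?d (Suc i) ` supp_on (G (Suc (Suc i)))"
    if x_in: "x \<in> supp_on (G (Suc i))" for x i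
  proof -
    have "?d i x = (\<lambda>_. 0) \<longleftrightarrow> d i x = (\<lambda>_. 0)"
      by (cases i) (simp_all add: d0 dS rescale_eq_0_iff)
    then show ?thesis unfolding exact[OF x_in] dS .
  qed
  have deg_g0: "\<delta> 0 g0 = pp_degree t0" using deg_\<epsilon>[OF g0(1), of t0] unfolding g0(2) by simp
  have eu0: "?e (unit_at g0) = pmon t0"
  proof -
    have "(\<lambda>g. if g = g0 then 0 else unit_at g0 g) = (\<lambda>_. 0 :: ('v, 'k) mpoly)" by (simp add: unit_at_def fun_eq_iff)
    then show ?thesis by (simp add: rescale_aug_def R_linear_zero[OF lin_\<epsilon>])
  qed
  have eu: "?e (unit_at g) = pmon t1 * \<epsilon> (unit_at g)" if "g \<noteq> g0" for g
  proof -
    have "(\<lambda>h. if h = g0 then 0 else unit_at g h) = (unit_at g :: _ \<Rightarrow> ('v, 'k) mpoly)"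
      using that by (auto simp: unit_at_def fun_eq_iff)
    then show ?thesis using that by (simp add: rescale_aug_def unit_at_other)
  qed
  show "pp_degree m = rescale_deg t1 g0 \<delta> 0 g"
    if g: "g \<in> G 0" and m: "m \<in> keys (?e (unit_at g))" for g m
  proof (cases "g = g0")
    case True
    then show ?thesis using m deg_g0 unfolding True eu0 by (simp add: rescale_deg_def)
  next
    case False
    then show ?thesis using m deg_\<epsilon>[OF g] unfolding eu[OF False]
      by (auto simp: rescale_deg_def keys_pmon_mult pp_degree_add)
  qed
  show "pp_degree m + rescale_deg t1 g0 \<delta> i g = rescale_deg t1 g0 \<delta> (Suc i) h"
    if g: "g \<in> G i" and h: "h \<in> G (Suc i)" and m: "m \<in> keys (?d i (unit_at h) g)" for g h m i
    using m deg_d[OF g h]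
    by (cases "i = 0 \<and> g = g0") 
       (auto simp: rescale_deg_def rescale_diff_def rescale_def keys_pmon_mult pp_degree_add split: if_splits)
  show "lookup (?d i (unit_at h) g) 0 = 0"
    if g: "g \<in> G i" and h: "h \<in> G (Suc i)" for g h i
    using min_d[OF g h] lookup_pmon_mult_0[OF nz]
    by (auto simp: rescale_diff_def rescale_def)
qed

section \<open>Resolution of the cover ideal\<close>

lemma lookup_disjoint_sqf:
  fixes A B :: "'v::finite set"
  assumes "A \<inter> B = {}"
  shows "lookup (sqf A) v = 0 \<or> lookup (sqf B) v = 0"
  using assms by (auto simp: lookup_sqf)

lemma sqf_nonzero: "finite A \<Longrightarrow> A \<noteq> {} \<Longrightarrow> sqf A \<noteq> 0"
  by (metis keys_sqf keys_zero)

text \<open>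
  The product of the ideals \<open>(x\<^sub>w, \<Prod>u\<in>L w. x\<^sub>u)\<close> for \<open>w \<in> W\<close>, resolved by one cone for each \<open>w\<close>. The cells \<open>g0\<close> and
  \<open>g1\<close> are the generators obtained by always choosing \<open>x\<^sub>w\<close>, respectively the product over \<open>L w\<close>: the first
  is the one to which the last generator of the cover ideal is attached, the second has the largest degree.
\<close>

lemma fan_resolution:
  fixes L :: "'v::finite \<Rightarrow> 'v set"
  assumes "\<And>w. w \<in> W \<Longrightarrow> L w \<noteq> {}"
    and "\<And>w. w \<in> W \<Longrightarrow> L w \<inter> W = {}"
    and "\<And>w w'. w \<in> W \<Longrightarrow> w' \<in> W \<Longrightarrow> w \<noteq> w' \<Longrightarrow> L w \<inter> L w' = {}"
  shows "\<exists>G \<delta> \<epsilon> d g0 g1. ideal_resolution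
      (mon_ideal (\<lambda>m. \<forall>w\<in>W. w \<in> keys m \<or> L w \<subseteq> keys m) :: ('v, 'k::field) mpoly set) G \<delta> \<epsilon> d \<and>
    g0 \<in> G 0 \<and> \<epsilon> (unit_at g0) = pmon (sqf W) \<and>
    g1 \<in> G 0 \<and> \<delta> 0 g1 = (\<Sum>w\<in>W. card (L w)) \<and> (W \<noteq> {} \<longrightarrow> g1 \<noteq> g0) \<and>
    (\<forall>i. \<forall>g\<in>G i. \<delta> i g \<le> i + (\<Sum>w\<in>W. card (L w))) \<and> (\<forall>i>card W. G i = {})"
  using finite[of W] assms
proof (induction W rule: finite_induct)
  case empty
  have e: "(unit_at [] :: nat list \<Rightarrow> ('v, 'k) mpoly) [] = pmon (sqf {})" by (simp add: sqf_def)
  have m: "(\<lambda>m. \<forall>w\<in>{}. w \<in> keys m \<or> L w \<subseteq> keys m) = (\<lambda>m :: 'v \<Rightarrow>\<^sub>0 nat. True)" by simp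
  show ?case unfolding m
    by (rule exI, rule exI, rule exI, rule exI, rule exI[of _ "[]"], rule exI[of _ "[]"], rule conjI,
        rule ideal_resolution_UNIV) (use e in simp)
next
  case (insert w W)
  let ?Q = "\<lambda>m :: 'v \<Rightarrow>\<^sub>0 nat. \<forall>w\<in>W. w \<in> keys m \<or> L w \<subseteq> keys m"
  let ?n = "\<Sum>w\<in>W. card (L w)"
  have "\<exists>G \<delta> \<epsilon> d g0 g1. ideal_resolution (mon_ideal ?Q :: ('v, 'k) mpoly set) G \<delta> \<epsilon> d \<and>
    g0 \<in> G 0 \<and> \<epsilon> (unit_at g0) = pmon (sqf W) \<and>
    g1 \<in> G 0 \<and> \<delta> 0 g1 = ?n \<and> (W \<noteq> {} \<longrightarrow> g1 \<noteq> g0) \<and>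
    (\<forall>i. \<forall>g\<in>G i. \<delta> i g \<le> i + ?n) \<and> (\<forall>i>card W. G i = {})"
  proof (rule insert.IH)
    show "L u \<noteq> {}" if "u \<in> W" for u using insert.prems(1) that by simp
    show "L u \<inter> W = {}" if "u \<in> W" for u using insert.prems(2)[of u] that by auto
    show "L u \<inter> L u' = {}" if "u \<in> W" "u' \<in> W" "u \<noteq> u'" for u u' using insert.prems(3) that by simp
  qed
  then obtain G \<delta> \<epsilon> d g0 g1 where R: "ideal_resolution (mon_ideal ?Q :: ('v, 'k) mpoly set) G \<delta> \<epsilon> d"
    and g0: "g0 \<in> G 0" "\<epsilon> (unit_at g0) = pmon (sqf W)"
    and g1: "g1 \<in> G 0" "\<delta> 0 g1 = ?n"
    and le: "\<And>i g. g \<in> G i \<Longrightarrow> \<delta> i g \<le> i + ?n" and fin: "\<And>i. i > card W \<Longrightarrow> G i = {}"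
    by blast
  interpret ideal_resolution "mon_ideal ?Q :: ('v, 'k) mpoly set" G \<delta> \<epsilon> d by (rule R)
  let ?t1 = "sqf {w}" and ?t2 = "sqf (L w)"
  have Lw: "L w \<noteq> {}" "w \<notin> L w" "L w \<inter> W = {}"
    using insert.prems(1)[of w] insert.prems(2)[of w] by auto
  have Lw': "w \<notin> L u" "L w \<inter> L u = {}" if "u \<in> W" for u
    using insert.prems(2)[of u] insert.prems(3)[of w u] that insert.hyps(2) by auto
  have Q1: "?Q (?t1 + m) \<longleftrightarrow> ?Q m" for m
    unfolding keys_add_nat keys_sqf[OF finite] using insert.hyps(2) Lw' by (intro ball_cong refl) blast
  have Q2: "?Q (?t2 + m) \<longleftrightarrow> ?Q m" for m
    unfolding keys_add_nat keys_sqf[OF finite] using Lw(3) Lw' by (intro ball_cong refl) blast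
  have C: "ideal_resolution (mon_ideal (\<lambda>m. ?Q m \<and> ((\<exists>s. m = ?t1 + s) \<or> (\<exists>s. m = ?t2 + s))) :: ('v, 'k) mpoly set)
    (cone_cells G) (cone_deg ?t1 ?t2 \<delta>) (cone_aug ?t1 ?t2 \<epsilon>) (cone_diff ?t1 ?t2 d)"
  proof (rule cone[OF refl Q1 Q2])
    show "lookup ?t1 v = 0 \<or> lookup ?t2 v = 0" for v
      using Lw by (intro lookup_disjoint_sqf) simp
    show "?t1 \<noteq> 0" "?t2 \<noteq> 0" using Lw(1) by (simp_all add: sqf_nonzero)
  qed
  have Q': "(\<lambda>m. ?Q m \<and> ((\<exists>s. m = ?t1 + s) \<or> (\<exists>s. m = ?t2 + s)))
      = (\<lambda>m. \<forall>w\<in>insert w W. w \<in> keys m \<or> L w \<subseteq> keys m)"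
    unfolding sqf_dvd_iff[OF finite] by auto
  have deg: "pp_degree ?t1 = 1" "pp_degree ?t2 = card (L w)" by (simp_all add: pp_degree_sqf)
  have card_pos: "card (L w) \<ge> 1" using Lw(1) by (simp add: Suc_le_eq card_gt_0_iff)
  have sum: "(\<Sum>w\<in>insert w W. card (L w)) = card (L w) + ?n" using insert.hyps by simp
  have e0: "cone_aug ?t1 ?t2 \<epsilon> (unit_at (0 # g0)) = pmon (sqf (insert w W))"
  proof -
    have "sqf (insert w W) = ?t1 + sqf W"
      using insert.hyps sqf_Un[of "{w}" W] by simp
    then show ?thesis
      unfolding unit_at_tri cone_aug_tri g0(2) R_linear_zero[OF lin_\<epsilon>] by (simp add: pmon_add)
  qed
  have le': "cone_deg ?t1 ?t2 \<delta> i g \<le> i + (card (L w) + ?n)" if "g \<in> cone_cells G i" for i g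
    using that
  proof (cases rule: cone_cellsE)
    case (0 h)
    then show ?thesis using le[of h i] card_pos by (simp add: cone_deg_def deg)
  next
    case (1 h)
    then show ?thesis using le[of h i] card_pos by (simp add: cone_deg_def deg)
  next
    case (2 h j)
    then show ?thesis using le[of h j] card_pos by (simp add: cone_deg_def deg)
  qed
  have fin': "cone_cells G i = {}" if "i > card (insert w W)" for i
  proof -
    have "i > Suc (card W)" using that insert.hyps by simp
    then show ?thesis using fin[of i] fin[of "i - 1"] by (cases i) (simp_all add: cone_cells_def)
  qed
  have d1: "cone_deg ?t1 ?t2 \<delta> 0 (Suc 0 # g1) = card (L w) + ?n"
    using g1 by (simp add: cone_deg_def deg)
  show ?case
    unfolding sum
    by (rule exI[of _ "cone_cells G"], rule exI[of _ "cone_deg ?t1 ?t2 \<delta>"], rule exI[of _ "cone_aug ?t1 ?t2 \<epsilon>"],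
        rule exI[of _ "cone_diff ?t1 ?t2 d"], rule exI[of _ "0 # g0"], rule exI[of _ "Suc 0 # g1"],
        intro conjI allI ballI impI)
      (use C[unfolded Q'] g0 g1 e0 le' fin' d1 in simp_all)
qed

text \<open>
  The ideal \<open>J\<close> is \<open>x\<^sub>c A + (\<Prod>w\<in>N. x\<^sub>w)\<close> with \<open>A\<close> from \<open>fan_resolution\<close>. The set \<open>P\<close> of leaves in \<open>N\<close> decides
  how the last generator is attached. For \<open>P \<noteq> {}\<close> it is a new generator of degree \<open>|N|\<close>. For \<open>P = {}\<close> it
  replaces the generator at \<open>g0\<close>, and then \<open>|N| \<le> n2\<close>, so that the maximum is \<open>n2\<close> and is attained at \<open>g1\<close>.
\<close>

lemma star_resolution:
  fixes L :: "'v::finite \<Rightarrow> 'v set" and N :: "'v set" and c :: 'v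
  defines "J \<equiv> mon_ideal (\<lambda>m. (c \<in> keys m \<and> (\<forall>w\<in>N. w \<in> keys m \<or> L w \<subseteq> keys m))
     \<or> N \<subseteq> keys m) :: ('v, 'k::field) mpoly set"
    and "n2 \<equiv> \<Sum>w\<in>N. card (L w)"
  assumes c: "c \<notin> N" "\<And>w. w \<in> N \<Longrightarrow> c \<notin> L w" and N: "N \<noteq> {}"
    and LN: "\<And>w. w \<in> N \<Longrightarrow> L w \<inter> N = {}"
    and LL: "\<And>w w'. w \<in> N \<Longrightarrow> w' \<in> N \<Longrightarrow> w \<noteq> w' \<Longrightarrow> L w \<inter> L w' = {}"
  shows "\<exists>G \<delta> \<epsilon> d. ideal_resolution J G \<delta> \<epsilon> d \<and> (\<forall>g\<in>G 0. lookup (\<epsilon> (unit_at g)) 0 = 0) \<and>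
    (\<forall>i. \<forall>g\<in>G i. \<delta> i g \<le> Suc i + max n2 (card N - 1)) \<and>
    (\<exists>i. \<exists>g\<in>G i. \<delta> i g = Suc i + max n2 (card N - 1)) \<and> (\<exists>n. \<forall>i>n. G i = {})"
proof -
  define W where "W = {w \<in> N. L w \<noteq> {}}"
  define P where "P = N - W"
  let ?Q = "\<lambda>m :: 'v \<Rightarrow>\<^sub>0 nat. \<forall>w\<in>W. w \<in> keys m \<or> L w \<subseteq> keys m"
  have WN: "W \<subseteq> N" by (auto simp: W_def)
  have n2: "n2 = (\<Sum>w\<in>W. card (L w))"
    unfolding n2_def W_def by (rule sum.mono_neutral_right) auto
  have "\<exists>G \<delta> \<epsilon> d g0 g1. ideal_resolution (mon_ideal ?Q :: ('v, 'k) mpoly set) G \<delta> \<epsilon> d \<and>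
    g0 \<in> G 0 \<and> \<epsilon> (unit_at g0) = pmon (sqf W) \<and>
    g1 \<in> G 0 \<and> \<delta> 0 g1 = (\<Sum>w\<in>W. card (L w)) \<and> (W \<noteq> {} \<longrightarrow> g1 \<noteq> g0) \<and>
    (\<forall>i. \<forall>g\<in>G i. \<delta> i g \<le> i + (\<Sum>w\<in>W. card (L w))) \<and> (\<forall>i>card W. G i = {})"
  proof (rule fan_resolution)
    show "L w \<noteq> {}" if "w \<in> W" for w using that by (simp add: W_def)
    show "L w \<inter> W = {}" if "w \<in> W" for w using LN[of w] that by (auto simp: W_def)
    show "L w \<inter> L w' = {}" if "w \<in> W" "w' \<in> W" "w \<noteq> w'" for w w' using LL[of w w'] that by (simp add: W_def)
  qed
  then obtain G \<delta> \<epsilon> d g0 g1 where R: "ideal_resolution (mon_ideal ?Q :: ('v, 'k) mpoly set) G \<delta> \<epsilon> d"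
    and g0: "g0 \<in> G 0" "\<epsilon> (unit_at g0) = pmon (sqf W)"
    and g1: "g1 \<in> G 0" "\<delta> 0 g1 = n2" "W \<noteq> {} \<Longrightarrow> g1 \<noteq> g0"
    and le: "\<And>i g. g \<in> G i \<Longrightarrow> \<delta> i g \<le> i + n2" and fin: "\<And>i. i > card W \<Longrightarrow> G i = {}"
    unfolding n2 by blast
  interpret ideal_resolution "mon_ideal ?Q :: ('v, 'k) mpoly set" G \<delta> \<epsilon> d by (rule R)
  let ?t1 = "sqf {c}"
  have Q1: "?Q (?t1 + m) \<longleftrightarrow> ?Q m" for m
    unfolding keys_add_nat keys_sqf[OF finite] using c WN by (intro ball_cong refl) blast
  have t1: "?t1 \<noteq> 0" by (simp add: sqf_nonzero)
  have deg: "pp_degree ?t1 = 1" by (simp add: pp_degree_sqf)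
  have QN: "?Q m \<longleftrightarrow> (\<forall>w\<in>N. w \<in> keys m \<or> L w \<subseteq> keys m)" for m
    unfolding W_def by blast
  have J: "J = mon_ideal (\<lambda>m. (?Q m \<and> (\<exists>s. m = ?t1 + s)) \<or> (\<exists>s. m = sqf N + s))"
    unfolding J_def QN sqf_dvd_iff[OF finite] by (intro arg_cong[of _ _ mon_ideal] ext) auto
  have cop: "lookup ?t1 v = 0 \<or> lookup (sqf N) v = 0" for v
    using c(1) by (intro lookup_disjoint_sqf) simp
  show ?thesis
  proof (cases "P = {}")
    case False
    have N_eq: "sqf N = sqf W + sqf P"
      using sqf_Un[of W P] WN by (simp add: P_def Un_absorb1 Un_Diff_cancel)
    have tP: "sqf P \<noteq> 0" using False by (simp add: sqf_nonzero)
    let ?e = "whisker_aug ?t1 (sqf W + sqf P) \<epsilon>" and ?\<delta> = "whisker_deg ?t1 (sqf W + sqf P) \<delta>"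
    have C: "ideal_resolution J (whisker_cells G) ?\<delta> ?e (whisker_diff ?t1 (sqf P) g0 d)"
      unfolding J N_eq by (rule whisker[OF refl Q1 g0 cop[unfolded N_eq] t1 tP])
    have dN: "pp_degree (sqf W + sqf P) = card N" unfolding N_eq[symmetric] by (simp add: pp_degree_sqf)
    have cN: "card N > 0" using N by (simp add: card_gt_0_iff)
    have min: "lookup (?e (unit_at g)) 0 = 0" if "g \<in> whisker_cells G 0" for g
      using that
    proof (cases rule: whisker_cellsE)
      case (0 h)
      then show ?thesis by (simp add: lookup_pmon_mult_0 t1 unit_at_duo whisker_aug_duo)
    next
      case 1
      have "sqf W + sqf P \<noteq> 0" unfolding N_eq[symmetric] using N by (simp add: sqf_nonzero)
      then show ?thesis using lookup_pmon_mult_0[of "sqf W + sqf P" 1] 1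
        by (simp add: unit_at_duo whisker_aug_duo R_linear_zero[OF lin_\<epsilon>])
    qed
    have le': "?\<delta> i g \<le> Suc i + max n2 (card N - 1)" if "g \<in> whisker_cells G i" for i g
      using that
    proof (cases rule: whisker_cellsE)
      case (0 h)
      then show ?thesis using le[of h i] by (simp add: whisker_deg_def deg)
    next
      case 1
      have "card N - 1 \<le> max n2 (card N - 1)" by simp
      then show ?thesis using cN 1 by (auto simp: whisker_deg_def deg dN simp del: max.cobounded2)
    qed
    have att: "\<exists>i. \<exists>g\<in>whisker_cells G i. ?\<delta> i g = Suc i + max n2 (card N - 1)"
    proof (cases "n2 \<ge> card N - 1")
      case True
      then show ?thesis using g1
        by (intro exI[of _ 0] bexI[of _ "0 # g1"]) (simp_all add: whisker_cells_def whisker_deg_def deg)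
    next
      case False
      then show ?thesis using cN
        by (intro exI[of _ 0] bexI[of _ "[Suc 0]"]) (simp_all add: whisker_cells_def whisker_deg_def dN)
    qed
    have fin': "\<forall>i>Suc (card W). whisker_cells G i = {}"
      using fin by (simp add: whisker_cells_def)
    show ?thesis using C min le' att fin' by blast
  next
    case True
    then have W: "W = N" using WN by (auto simp: P_def)
    let ?e = "rescale_aug ?t1 (sqf W) g0 \<epsilon>" and ?\<delta> = "rescale_deg ?t1 g0 \<delta>"
    have C: "ideal_resolution J G ?\<delta> ?e (rescale_diff ?t1 g0 d)"
      unfolding J W[symmetric] by (rule rescale_generator[OF refl Q1 g0 cop[folded W] t1])
    have "card (L w) \<ge> 1" if "w \<in> W" for w using that by (simp add: W_def Suc_le_eq card_gt_0_iff)
    then have "card N \<le> n2" using sum_mono[of W "\<lambda>_. 1" "\<lambda>w. card (L w)"] unfolding n2 W[symmetric] by simp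
    then have mx: "max n2 (card N - 1) = n2" by simp
    have W0: "W \<noteq> {}" using N W by simp
    have min: "lookup (?e (unit_at g)) 0 = 0" if "g \<in> G 0" for g
      unfolding rescale_aug_def lookup_add using W0 by (simp add: lookup_pmon_mult_0 sqf_nonzero)
    have le': "?\<delta> i g \<le> Suc i + n2" if "g \<in> G i" for i g
      using le[OF that] by (auto simp: rescale_deg_def deg)
    have att: "\<exists>i. \<exists>g\<in>G i. ?\<delta> i g = Suc i + n2"
      using g1 W0 by (intro exI[of _ 0] bexI[of _ g1]) (simp_all add: rescale_deg_def deg)
    show ?thesis unfolding mx using C min le' att fin by blast
  qed
qed

section \<open>From cells to matrices\<close>

lemma R_linear_sum:
  assumes f: "R_linear f" and "finite S"
  shows "f (\<lambda>g. \<Sum>b\<in>S. y b * x b g) = (\<Sum>b\<in>S. y b * f (x b))"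
  using assms(2)
proof (induction S rule: finite_induct)
  case empty
  then show ?case by (simp add: R_linear_zero[OF f])
next
  case (insert b S)
  then show ?case by (simp add: R_linear_add[OF f] R_linear_scale[OF f])
qed

text \<open>
  An arbitrary enumeration of a finite set of cells, which numbers the rows and columns of the matrices.
\<close>

definition cell_list :: "nat list set \<Rightarrow> nat list list" where
  "cell_list S = (SOME xs. distinct xs \<and> set xs = S)"

lemma cell_list: "finite S \<Longrightarrow> distinct (cell_list S) \<and> set (cell_list S) = S"
  unfolding cell_list_def by (rule someI_ex) (metis finite_distinct_list)

definition chain_of_vec :: "nat list set \<Rightarrow> ('v, 'k::field) mpoly vec \<Rightarrow> nat list \<Rightarrow> ('v, 'k) mpoly" where
  "chain_of_vec S v = (\<lambda>g. \<Sum>b<length (cell_list S). v $ b * unit_at (cell_list S ! b) g)"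

definition vec_of_chain :: "nat list set \<Rightarrow> (nat list \<Rightarrow> ('v, 'k::field) mpoly) \<Rightarrow> ('v, 'k) mpoly vec" where
  "vec_of_chain S x = vec (length (cell_list S)) (\<lambda>b. x (cell_list S ! b))"

context
  fixes S :: "nat list set" assumes fin: "finite S"
begin

lemma cell_list_mem: "b < length (cell_list S) \<Longrightarrow> cell_list S ! b \<in> S"
  using cell_list[OF fin] nth_mem by blast

lemma chain_of_vec_supp: "chain_of_vec S v \<in> supp_on S"
proof -
  have "chain_of_vec S v g = 0" if "g \<notin> S" for g
    unfolding chain_of_vec_def
    by (rule sum.neutral) (use that cell_list_mem unit_at_other in \<open>metis lessThan_iff mult_zero_right\<close>)
  then show ?thesis by (simp add: supp_on_def)
qed

lemma chain_of_vec_nth: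
  assumes "b < length (cell_list S)"
  shows "chain_of_vec S v (cell_list S ! b) = v $ b"
proof -
  have "chain_of_vec S v (cell_list S ! b) = (\<Sum>a<length (cell_list S). if a = b then v $ b else 0)"
    unfolding chain_of_vec_def using assms cell_list[OF fin]
    by (intro sum.cong refl) (auto simp: unit_at_def nth_eq_iff_index_eq)
  then show ?thesis using assms by simp
qed

lemma vec_of_chain_of_vec: "v \<in> carrier_vec (length (cell_list S)) \<Longrightarrow> vec_of_chain S (chain_of_vec S v) = v"
  unfolding vec_of_chain_def by (intro eq_vecI) (auto simp: chain_of_vec_nth)

lemma chain_of_vec_of_chain:
  assumes "x \<in> supp_on S" shows "chain_of_vec S (vec_of_chain S x) = x"
proof
  fix g
  show "chain_of_vec S (vec_of_chain S x) g = x g"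
  proof (cases "g \<in> S")
    case True
    then obtain b where "b < length (cell_list S)" "g = cell_list S ! b"
      using cell_list[OF fin] by (metis in_set_conv_nth)
    then show ?thesis by (simp add: chain_of_vec_nth vec_of_chain_def)
  next
    case False
    then show ?thesis using assms chain_of_vec_supp[of "vec_of_chain S x"] by (simp add: supp_on_def)
  qed
qed

lemma vec_of_chain_carrier: "vec_of_chain S x \<in> carrier_vec (length (cell_list S))"
  by (simp add: vec_of_chain_def)

lemma vec_of_chain_zero_iff:
  assumes "x \<in> supp_on S" shows "vec_of_chain S x = 0\<^sub>v (length (cell_list S)) \<longleftrightarrow> x = (\<lambda>_. 0)"
proof
  assume "vec_of_chain S x = 0\<^sub>v (length (cell_list S))"
  then have "x = chain_of_vec S (0\<^sub>v (length (cell_list S)))" using chain_of_vec_of_chain[OF assms] by simp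
  then show "x = (\<lambda>_. 0)" by (simp add: chain_of_vec_def)
qed (simp add: vec_of_chain_def zero_vec_def)

lemma R_linear_chain_of_vec:
  "R_linear f \<Longrightarrow> f (chain_of_vec S v) = (\<Sum>b<length (cell_list S). v $ b * f (unit_at (cell_list S ! b)))"
  unfolding chain_of_vec_def by (rule R_linear_sum) simp_all

end

context ideal_resolution
begin

text \<open>
  The resolution of the quotient: position 0 is the ring itself with its generator in degree 0, and the
  resolution of the ideal is moved up by one.
\<close>

definition res_degs :: "nat \<Rightarrow> nat list" where
  "res_degs i = (case i of 0 \<Rightarrow> [0] | Suc j \<Rightarrow> map (\<delta> j) (cell_list (G j)))"

definition res_mat :: "nat \<Rightarrow> ('v, 'k) mpoly mat" where
  "res_mat i = (case i of 0 \<Rightarrow> mat 1 (length (cell_list (G 0))) (\<lambda>(a, b). \<epsilon> (unit_at (cell_list (G 0) ! b)))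
     | Suc j \<Rightarrow> mat (length (cell_list (G j))) (length (cell_list (G (Suc j))))
         (\<lambda>(a, b). d j (unit_at (cell_list (G (Suc j)) ! b)) (cell_list (G j) ! a)))"

lemma set_res_degs: "set (res_degs (Suc i)) = \<delta> i ` G i"
  using cell_list[OF finite_G] by (simp add: res_degs_def)

lemma length_res_degs: "length (res_degs (Suc i)) = length (cell_list (G i))"
  by (simp add: res_degs_def)

lemma res_mat_0_vec:
  assumes "v \<in> carrier_vec (length (cell_list (G 0)))"
  shows "res_mat 0 *\<^sub>v v = vec 1 (\<lambda>_. \<epsilon> (chain_of_vec (G 0) v))"
  using assms R_linear_chain_of_vec[OF finite_G lin_\<epsilon>, of 0 v]
  by (intro eq_vecI) (auto simp: res_mat_def scalar_prod_def lessThan_atLeast0 mult.commute)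

lemma res_mat_Suc_vec:
  assumes "v \<in> carrier_vec (length (cell_list (G (Suc i))))"
  shows "res_mat (Suc i) *\<^sub>v v = vec_of_chain (G i) (d i (chain_of_vec (G (Suc i)) v))"
proof (rule eq_vecI)
  fix a assume "a < dim_vec (vec_of_chain (G i) (d i (chain_of_vec (G (Suc i)) v)))"
  then have a: "a < length (cell_list (G i))" by (simp add: vec_of_chain_def)
  have "(res_mat (Suc i) *\<^sub>v v) $ a = (\<Sum>b<length (cell_list (G (Suc i))).
      v $ b * d i (unit_at (cell_list (G (Suc i)) ! b)) (cell_list (G i) ! a))"
    using assms a by (auto simp: res_mat_def scalar_prod_def lessThan_atLeast0 mult.commute)
  also have "\<dots> = d i (chain_of_vec (G (Suc i)) v) (cell_list (G i) ! a)"
    using R_linear_chain_of_vec[OF finite_G lin_d] by simp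
  finally show "(res_mat (Suc i) *\<^sub>v v) $ a = vec_of_chain (G i) (d i (chain_of_vec (G (Suc i)) v)) $ a"
    using a by (simp add: vec_of_chain_def)
qed (simp add: res_mat_def vec_of_chain_def)

lemma image_res_mat_Suc:
  "{res_mat (Suc i) *\<^sub>v x | x. x \<in> carrier_vec (length (cell_list (G (Suc i))))}
    = vec_of_chain (G i) ` d i ` supp_on (G (Suc i))"
proof (rule subset_antisym; rule subsetI)
  fix u assume "u \<in> {res_mat (Suc i) *\<^sub>v x | x. x \<in> carrier_vec (length (cell_list (G (Suc i))))}"
  then obtain x where x: "x \<in> carrier_vec (length (cell_list (G (Suc i))))" "u = res_mat (Suc i) *\<^sub>v x" by blast
  show "u \<in> vec_of_chain (G i) ` d i ` supp_on (G (Suc i))"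
    unfolding x(2) res_mat_Suc_vec[OF x(1)] by (intro imageI chain_of_vec_supp finite_G)
next
  fix u assume "u \<in> vec_of_chain (G i) ` d i ` supp_on (G (Suc i))"
  then obtain y where y: "y \<in> supp_on (G (Suc i))" "u = vec_of_chain (G i) (d i y)" by blast
  have "u = res_mat (Suc i) *\<^sub>v vec_of_chain (G (Suc i)) y"
    unfolding res_mat_Suc_vec[OF vec_of_chain_carrier[OF finite_G]] chain_of_vec_of_chain[OF finite_G y(1)] y(2) ..
  then show "u \<in> {res_mat (Suc i) *\<^sub>v x | x. x \<in> carrier_vec (length (cell_list (G (Suc i))))}"
    using vec_of_chain_carrier[OF finite_G] by blast
qed

lemma kernel_as_chains:
  assumes ker: "\<And>x. x \<in> carrier_vec (length (cell_list (G i))) \<Longrightarrow>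
     x \<in> K \<longleftrightarrow> chain_of_vec (G i) x \<in> Z" and K: "K \<subseteq> carrier_vec (length (cell_list (G i)))"
    and Z: "Z \<subseteq> supp_on (G i)"
  shows "K = vec_of_chain (G i) ` Z"
proof (rule subset_antisym; rule subsetI)
  fix x assume x: "x \<in> K"
  then have c: "x \<in> carrier_vec (length (cell_list (G i)))" using K by blast
  show "x \<in> vec_of_chain (G i) ` Z"
    by (rule image_eqI[of _ _ "chain_of_vec (G i) x"])
       (use x ker[OF c] vec_of_chain_of_vec[OF finite_G c] in simp_all)
next
  fix x assume "x \<in> vec_of_chain (G i) ` Z"
  then obtain y where y: "y \<in> Z" "x = vec_of_chain (G i) y" by blast
  have c: "x \<in> carrier_vec (length (cell_list (G i)))" unfolding y(2) by (rule vec_of_chain_carrier[OF finite_G])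
  have "chain_of_vec (G i) x = y" unfolding y(2) using y(1) Z by (intro chain_of_vec_of_chain[OF finite_G]) blast
  then show "x \<in> K" using ker[OF c] y(1) by simp
qed

theorem min_graded_free_resolution_res:
  assumes min0: "\<And>g. g \<in> G 0 \<Longrightarrow> lookup (\<epsilon> (unit_at g)) 0 = 0"
  shows "min_graded_free_resolution M res_degs res_mat"
  unfolding min_graded_free_resolution_def
proof (intro conjI allI impI ballI)
  note mem = cell_list_mem[OF finite_G]
  have len: "length (res_degs i) = (case i of 0 \<Rightarrow> 1 | Suc j \<Rightarrow> length (cell_list (G j)))" for i
    by (simp add: res_degs_def split: nat.split)
  show "res_degs 0 = [0]" by (simp add: res_degs_def)
  show "res_mat i \<in> carrier_mat (length (res_degs i)) (length (res_degs (Suc i)))" for i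
    unfolding len by (cases i) (simp_all add: res_mat_def)
  show "pp_degree m + res_degs i ! a = res_degs (Suc i) ! b"
    if "a < length (res_degs i)" "b < length (res_degs (Suc i))" "m \<in> keys (res_mat i $$ (a, b))" for i a b m
  proof (cases i)
    case 0
    then show ?thesis using that deg_\<epsilon>[OF mem[of b 0], of m] unfolding len
      by (simp add: res_mat_def res_degs_def)
  next
    case (Suc j)
    then show ?thesis using that deg_d[OF mem[of a j] mem[of b "Suc j"], of m] unfolding len
      by (simp add: res_mat_def res_degs_def)
  qed
  show "lookup (res_mat i $$ (a, b)) 0 = 0"
    if "a < length (res_degs i)" "b < length (res_degs (Suc i))" for i a b
  proof (cases i)
    case 0
    then show ?thesis using that min0[OF mem[of b 0]] unfolding len by (simp add: res_mat_def)
  next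
    case (Suc j)
    then show ?thesis using that min_d[OF mem[of a j] mem[of b "Suc j"]] unfolding len by (simp add: res_mat_def)
  qed
  show "{(res_mat 0 *\<^sub>v x) $ 0 | x. x \<in> carrier_vec (length (res_degs 1))} = M"
  proof (rule subset_antisym; rule subsetI)
    fix p assume "p \<in> {(res_mat 0 *\<^sub>v x) $ 0 | x. x \<in> carrier_vec (length (res_degs 1))}"
    then obtain x where x: "x \<in> carrier_vec (length (cell_list (G 0)))" "p = (res_mat 0 *\<^sub>v x) $ 0"
      by (auto simp: length_res_degs)
    show "p \<in> M" unfolding x(2) res_mat_0_vec[OF x(1)]
      using \<epsilon>_mem[OF chain_of_vec_supp[OF finite_G]] by simp
  next
    fix p assume "p \<in> M"
    then obtain x where x: "x \<in> supp_on (G 0)" "p = \<epsilon> x" by (rule \<epsilon>_memE)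
    have "p = (res_mat 0 *\<^sub>v vec_of_chain (G 0) x) $ 0"
      unfolding res_mat_0_vec[OF vec_of_chain_carrier[OF finite_G]] chain_of_vec_of_chain[OF finite_G x(1)] x(2) by simp
    then show "p \<in> {(res_mat 0 *\<^sub>v x) $ 0 | x. x \<in> carrier_vec (length (res_degs 1))}"
      using vec_of_chain_carrier[OF finite_G, of 0 x] by (auto simp: length_res_degs)
  qed
  show "{res_mat (Suc i) *\<^sub>v x | x. x \<in> carrier_vec (length (res_degs (Suc (Suc i))))} = mat_kernel (res_mat i)" for i
    unfolding length_res_degs image_res_mat_Suc
  proof (rule sym, rule kernel_as_chains)
    show "d i ` supp_on (G (Suc i)) \<subseteq> supp_on (G i)" using d_supp by blast
    show "mat_kernel (res_mat i) \<subseteq> carrier_vec (length (cell_list (G i)))"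
      by (cases i) (auto simp: mat_kernel_def res_mat_def)
    fix x :: "('v, 'k) mpoly vec" assume x: "x \<in> carrier_vec (length (cell_list (G i)))"
    note s = chain_of_vec_supp[OF finite_G]
    show "x \<in> mat_kernel (res_mat i) \<longleftrightarrow> chain_of_vec (G i) x \<in> d i ` supp_on (G (Suc i))"
    proof (cases i)
      case 0
      have "x \<in> mat_kernel (res_mat 0) \<longleftrightarrow> \<epsilon> (chain_of_vec (G 0) x) = 0"
        using x 0 res_mat_0_vec[of x] by (auto simp: mat_kernel_def res_mat_def vec_eq_iff)
      then show ?thesis unfolding 0 exact0[OF s] .
    next
      case (Suc j)
      have "x \<in> mat_kernel (res_mat (Suc j)) \<longleftrightarrow> res_mat (Suc j) *\<^sub>v x = 0\<^sub>v (length (cell_list (G j)))"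
        using x Suc by (auto simp: mat_kernel_def res_mat_def)
      also have "\<dots> \<longleftrightarrow> d j (chain_of_vec (G (Suc j)) x) = (\<lambda>_. 0)"
        using x Suc res_mat_Suc_vec vec_of_chain_zero_iff[OF finite_G d_supp[OF s]] by simp
      finally show ?thesis unfolding Suc exact[OF s] .
    qed
  qed
qed

lemma regularity_quot_res:
  assumes min0: "\<And>g. g \<in> G 0 \<Longrightarrow> lookup (\<epsilon> (unit_at g)) 0 = 0"
    and le: "\<And>i g. g \<in> G i \<Longrightarrow> \<delta> i g \<le> Suc i + r"
    and attained: "g \<in> G i" "\<delta> i g = Suc i + r"
    and fin: "\<And>i. i > n \<Longrightarrow> G i = {}"
  shows "regularity_quot M = int r"
proof (rule regularity_quot_eqI[OF min_graded_free_resolution_res[OF min0]])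
  show "res_degs k = []" if "k > Suc n" for k
    using that fin[of "k - 1"] set_res_degs[of "k - 1"] by (cases k) auto
  show "j \<le> k + r" if "j \<in> set (res_degs k)" for k j
    using that le by (cases k) (auto simp: set_res_degs res_degs_def[of 0])
  show "Suc i + r \<in> set (res_degs (Suc i))"
    using attained unfolding set_res_degs by (metis imageI)
qed

end

section \<open>Cover ideals are monomial ideals\<close>

lemma vertex_cover_mono: "vertex_cover E S \<Longrightarrow> S \<subseteq> T \<Longrightarrow> vertex_cover E T"
  unfolding vertex_cover_def by blast

lemma minimal_vertex_cover_below:
  fixes S :: "'v::finite set"
  assumes "vertex_cover E S"
  obtains C where "C \<subseteq> S" "minimal_vertex_cover E C"
proof -
  obtain C where C: "vertex_cover E C" "C \<subseteq> S" "\<And>D. vertex_cover E D \<Longrightarrow> D \<subseteq> C \<Longrightarrow> C = D"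
    using finite_has_minimal2[of "{C. vertex_cover E C}" S] assms by auto
  have "minimal_vertex_cover E C"
    unfolding minimal_vertex_cover_def using C(1,3) by blast
  then show ?thesis using that C(2) by blast
qed

text \<open>
  Every cover contains a minimal one, so a power product is a multiple of a generator iff its support is
  a cover.
\<close>

lemma cover_ideal_eq_mon_ideal:
  "(cover_ideal E :: ('v::finite, 'k::field) mpoly set) = mon_ideal (\<lambda>m. vertex_cover E (keys m))"
  (is "_ = ?M")
proof (rule subset_antisym)
  have s: "ideal.subspace ?M"
  proof (rule subspace_mon_ideal)
    fix m t :: "'v \<Rightarrow>\<^sub>0 nat" assume "vertex_cover E (keys m)"
    then show "vertex_cover E (keys (t + m))"
      unfolding keys_add_nat by (rule vertex_cover_mono) blast
  qed
  have "(\<Prod>v\<in>C. var v) \<in> ?M" if "minimal_vertex_cover E C" for C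
    using that by (simp add: pmon_sqf mem_mon_ideal keys_sqf minimal_vertex_cover_def)
  then show "cover_ideal E \<subseteq> ?M"
    unfolding cover_ideal_def by (intro ideal.span_minimal[OF _ s]) blast
  show "?M \<subseteq> cover_ideal E"
  proof
    fix p :: "('v, 'k) mpoly" assume p: "p \<in> ?M"
    have sp: "ideal.subspace (cover_ideal E :: ('v, 'k) mpoly set)"
      unfolding cover_ideal_def by (rule ideal.subspace_span)
    show "p \<in> cover_ideal E"
    proof (rule subspace_memI_keys[OF sp])
      fix m assume "m \<in> keys p"
      then have "vertex_cover E (keys m)" using p unfolding mem_mon_ideal by blast
      then obtain C where C: "C \<subseteq> keys m" "minimal_vertex_cover E C"
        by (rule minimal_vertex_cover_below)
      obtain s where "m = sqf C + s" using C(1) sqf_dvd_iff[of C m] by auto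
      then have eq: "(pmon m :: ('v, 'k) mpoly) = pmon s * pmon (sqf C)"
        by (simp add: pmon_add mult.commute)
      have "(\<Prod>v\<in>C. var v) \<in> (cover_ideal E :: ('v, 'k) mpoly set)"
        unfolding cover_ideal_def using C(2) by (intro ideal.span_base) blast
      then have "pmon (sqf C) \<in> (cover_ideal E :: ('v, 'k) mpoly set)" by (simp add: pmon_sqf)
      then show "pmon m \<in> (cover_ideal E :: ('v, 'k) mpoly set)" unfolding eq by (rule ideal.subspace_scale[OF sp])
    qed
  qed
qed

section \<open>Trees of radius two\<close>

text \<open>
  A rooted tree of height at most 2, given by the parent of each vertex, where the root is its own parent.
\<close>

definition two_level :: "'v \<Rightarrow> ('v \<Rightarrow> 'v) \<Rightarrow> bool" where
  "two_level c par \<longleftrightarrow> par c = c \<and> (\<forall>v. par (par v) = c)"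

definition parent_edges :: "'v \<Rightarrow> ('v \<Rightarrow> 'v) \<Rightarrow> 'v set set" where
  "parent_edges c par = {{v, par v} | v. v \<noteq> c}"

lemma graph_cycle_3:
  "distinct [a, b, c] \<Longrightarrow> {a, b} \<in> E \<Longrightarrow> {b, c} \<in> E \<Longrightarrow> {c, a} \<in> E \<Longrightarrow> graph_cycle E [a, b, c]"
  by (auto simp: graph_cycle_def less_Suc_eq)

lemma graph_cycle_4:
  "distinct [a, b, c, d] \<Longrightarrow> {a, b} \<in> E \<Longrightarrow> {b, c} \<in> E \<Longrightarrow> {c, d} \<in> E \<Longrightarrow> {d, a} \<in> E \<Longrightarrow>
    graph_cycle E [a, b, c, d]"
  by (auto simp: graph_cycle_def less_Suc_eq)

lemma graph_cycle_5:
  "distinct [a, b, c, d, e] \<Longrightarrow> {a, b} \<in> E \<Longrightarrow> {b, c} \<in> E \<Longrightarrow> {c, d} \<in> E \<Longrightarrow> {d, e} \<in> E \<Longrightarrow> {e, a} \<in> E \<Longrightarrow>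
    graph_cycle E [a, b, c, d, e]"
  by (auto simp: graph_cycle_def less_Suc_eq)

text \<open>
  Let \<open>c\<close> be a centre, and assign to each vertex at distance 2 one of its neighbours adjacent to \<open>c\<close>. An edge
  that does not join a vertex to its parent would close a cycle of length 3, 4 or 5.
\<close>

lemma tree_radius_2_two_level:
  assumes "is_tree E" "radius_at_most E 2"
  obtains c par where "two_level c par" "E = parent_edges c par"
proof -
  have simple: "\<And>e. e \<in> E \<Longrightarrow> card e = 2" and conn: "\<And>u v. (u, v) \<in> (adj E)\<^sup>*"
    and acyc: "\<And>vs. \<not> graph_cycle E vs"
    using assms(1) by (auto simp: is_tree_def simple_graph_def connected_graph_def)
  obtain c where c: "\<And>v. graph_dist E c v \<le> 2" using assms(2) by (auto simp: radius_at_most_def)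
  have noloop: "a \<noteq> b" if "{a, b} \<in> E" for a b using simple[OF that] by auto
  have sym: "{b, a} \<in> E" if "{a, b} \<in> E" for a b using that by (simp add: insert_commute)
  have reach: "v = c \<or> {c, v} \<in> E \<or> (\<exists>w. {c, w} \<in> E \<and> {w, v} \<in> E)" for v
  proof -
    obtain l where "(c, v) \<in> adj E ^^ l" using conn[of c v] rtrancl_imp_relpow by metis
    then have "(c, v) \<in> adj E ^^ graph_dist E c v" unfolding graph_dist_def by (rule LeastI)
    moreover have "graph_dist E c v = 0 \<or> graph_dist E c v = Suc 0 \<or> graph_dist E c v = Suc (Suc 0)"
      using c[of v] by linarith
    ultimately show ?thesis by (auto simp: adj_def)
  qed
  define par where "par v = (if v = c \<or> {c, v} \<in> E then c else SOME w. {c, w} \<in> E \<and> {w, v} \<in> E)" for v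
  have par1: "par v = c" if "v = c \<or> {c, v} \<in> E" for v using that by (simp add: par_def)
  have par2: "{c, par v} \<in> E" "{par v, v} \<in> E" if "v \<noteq> c" "{c, v} \<notin> E" for v
  proof -
    have "\<exists>w. {c, w} \<in> E \<and> {w, v} \<in> E" using reach[of v] that by blast
    then have "{c, SOME w. {c, w} \<in> E \<and> {w, v} \<in> E} \<in> E \<and> {SOME w. {c, w} \<in> E \<and> {w, v} \<in> E, v} \<in> E"
      by (rule someI_ex)
    then show "{c, par v} \<in> E" "{par v, v} \<in> E" using that by (simp_all add: par_def)
  qed
  have "two_level c par"
    unfolding two_level_def using par1 par2 by metis
  moreover have "E = parent_edges c par"
  proof (rule subset_antisym; rule subsetI)
    fix e assume "e \<in> parent_edges c par"
    then obtain v where v: "v \<noteq> c" "e = {v, par v}" unfolding parent_edges_def by blast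
    show "e \<in> E" unfolding v(2)
      using par1[of v] par2(2)[of v] v(1) by (cases "{c, v} \<in> E") (simp_all add: insert_commute)
  next
    fix e assume e: "e \<in> E"
    have edge: "par a = b \<or> par b = a" if ab: "{a, b} \<in> E" for a b
    proof (rule ccontr)
      assume "\<not> (par a = b \<or> par b = a)"
      then have np: "par a \<noteq> b" "par b \<noteq> a" by simp_all
      have "a \<noteq> b" by (rule noloop[OF ab])
      have ac: "a \<noteq> c" using np(2) par1[of b] ab by blast
      have bc: "b \<noteq> c" using np(1) par1[of a] sym[OF ab] by blast
      show False
      proof (cases "{c, a} \<in> E"; cases "{c, b} \<in> E")
        assume "{c, a} \<in> E" "{c, b} \<in> E"
        then have "graph_cycle E [c, a, b]" using ac bc \<open>a \<noteq> b\<close> ab sym by (intro graph_cycle_3) auto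
        then show False using acyc by blast
      next
        assume l: "{c, a} \<in> E" "{c, b} \<notin> E"
        have "graph_cycle E [c, a, b, par b]"
          using l ac bc \<open>a \<noteq> b\<close> ab np par2[OF bc l(2)] noloop[OF par2(1)[OF bc l(2)]] noloop[OF par2(2)[OF bc l(2)]] sym
          by (intro graph_cycle_4) auto
        then show False using acyc by blast
      next
        assume l: "{c, a} \<notin> E" "{c, b} \<in> E"
        have "graph_cycle E [c, b, a, par a]"
          using l ac bc \<open>a \<noteq> b\<close> ab np par2[OF ac l(1)] noloop[OF par2(1)[OF ac l(1)]] noloop[OF par2(2)[OF ac l(1)]] sym
          by (intro graph_cycle_4) auto
        then show False using acyc by blast
      next
        assume l: "{c, a} \<notin> E" "{c, b} \<notin> E"
        note pa = par2[OF ac l(1)] and pb = par2[OF bc l(2)]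
        show False
        proof (cases "par a = par b")
          case True
          then have "graph_cycle E [par a, a, b]"
            using pa pb \<open>a \<noteq> b\<close> ab np noloop[OF pa(2)] noloop[OF pb(2)] sym by (intro graph_cycle_3) auto
          then show False using acyc by blast
        next
          case False
          then have "graph_cycle E [c, par a, a, b, par b]"
            using pa pb \<open>a \<noteq> b\<close> ab np ac bc l noloop[OF pa(1)] noloop[OF pa(2)] noloop[OF pb(1)] noloop[OF pb(2)] sym
            by (intro graph_cycle_5) auto
          then show False using acyc by blast
        qed
      qed
    qed
    obtain a b where ab: "e = {a, b}" "a \<noteq> b" using simple[OF e] by (auto simp: card_2_iff)
    have "par c = c" using par1 by simp
    then have "(par a = b \<and> a \<noteq> c) \<or> (par b = a \<and> b \<noteq> c)"
      using edge[of a b] e ab by auto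
    then show "e \<in> parent_edges c par"
      unfolding parent_edges_def using ab by (auto simp: insert_commute)
  qed
  ultimately show ?thesis by (rule that)
qed

context
  fixes c :: "'v" and par :: "'v \<Rightarrow> 'v"
  assumes two: "two_level c par"
begin

lemma par_c: "par c = c" and par_par: "par (par v) = c"
  using two by (auto simp: two_level_def)

lemma par_neq: "v \<noteq> c \<Longrightarrow> par v \<noteq> v"
  using par_par[of v] by auto

lemma in_parent_edges: "{x, y} \<in> parent_edges c par \<longleftrightarrow> (x \<noteq> c \<and> y = par x) \<or> (y \<noteq> c \<and> x = par y)"
  by (auto simp: parent_edges_def doubleton_eq_iff)

text \<open>
  In a cycle, both neighbours of a vertex of maximal depth would have to be its parent.
\<close>

lemma two_level_is_tree: "is_tree (parent_edges c par)"
proof -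
  let ?E = "parent_edges c par"
  have "simple_graph ?E"
    unfolding simple_graph_def parent_edges_def using par_neq by (auto simp: card_2_iff)
  moreover have "connected_graph ?E"
    unfolding connected_graph_def
  proof (intro allI)
    have symm: "sym ((adj ?E)\<^sup>*)" by (rule sym_rtrancl) (auto simp: sym_def adj_def insert_commute)
    have step: "(v, par v) \<in> (adj ?E)\<^sup>*" for v
      using par_c in_parent_edges[of v "par v"] by (cases "v = c") (auto simp: adj_def)
    have root: "(v, c) \<in> (adj ?E)\<^sup>*" for v
      using rtrancl_trans[OF step[of v] step[of "par v"]] unfolding par_par .
    fix u v show "(u, v) \<in> (adj ?E)\<^sup>*"
      using rtrancl_trans[OF root[of u] symD[OF symm root[of v]]] .
  qed
  moreover have "\<not> graph_cycle ?E vs" for vs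
  proof
    assume cyc: "graph_cycle ?E vs"
    define n where "n = length vs"
    have n3: "n \<ge> 3" and dist: "distinct vs" using cyc by (auto simp: graph_cycle_def n_def)
    define nxt where "nxt i = (if Suc i = n then 0 else Suc i)" for i
    define prv where "prv i = (if i = 0 then n - 1 else i - 1)" for i
    have vs_ne: "vs \<noteq> []" using n3 by (auto simp: n_def)
    have e: "{vs ! i, vs ! nxt i} \<in> ?E" if "i < n" for i
    proof (cases "Suc i = n")
      case True
      then have "i = n - 1" "nxt i = 0" by (simp_all add: nxt_def)
      then have "vs ! i = last vs" "vs ! nxt i = hd vs"
        using vs_ne by (simp_all add: n_def last_conv_nth hd_conv_nth)
      then show ?thesis using cyc by (simp add: graph_cycle_def)
    next
      case False
      then show ?thesis using cyc that by (simp add: graph_cycle_def nxt_def n_def)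
    qed
    define depth where "depth v = (if v = c then 0 else if par v = c then 1 else (2::nat))" for v
    have dpar: "depth (par v) < depth v" if "v \<noteq> c" for v
      using that par_par[of v] par_c by (auto simp: depth_def)
    obtain i where i: "i < n" and imax: "\<And>j. j < n \<Longrightarrow> depth (vs ! j) \<le> depth (vs ! i)"
    proof -
      have "finite (depth ` set vs)" "depth ` set vs \<noteq> {}" using vs_ne by auto
      then have "Max (depth ` set vs) \<in> depth ` set vs" by (rule Max_in)
      then obtain i where i: "i < n" "Max (depth ` set vs) = depth (vs ! i)" by (auto simp: n_def in_set_conv_nth)
      have "depth (vs ! j) \<le> Max (depth ` set vs)" if "j < n" for j
        using that by (intro Max_ge) (auto simp: n_def)
      then show ?thesis using that[OF i(1)] unfolding i(2) by blast
    qed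
    have up: "vs ! j = par (vs ! i)" if j: "j < n" "{vs ! i, vs ! j} \<in> ?E" for j
    proof (rule ccontr)
      assume "vs ! j \<noteq> par (vs ! i)"
      then have "vs ! j \<noteq> c" "vs ! i = par (vs ! j)" using j(2) in_parent_edges by auto
      then have "depth (vs ! i) < depth (vs ! j)" using dpar by metis
      then show False using imax[OF j(1)] by simp
    qed
    have nx: "nxt i < n" and pv: "prv i < n" "nxt (prv i) = i" and ne: "nxt i \<noteq> prv i"
      using i n3 by (auto simp: nxt_def prv_def)
    have "vs ! nxt i = par (vs ! i)" using up[OF nx e[OF i]] .
    moreover have "vs ! prv i = par (vs ! i)"
      using up[OF pv(1)] e[OF pv(1)] unfolding pv(2) by (simp add: insert_commute)
    ultimately have "vs ! nxt i = vs ! prv i" by simp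
    then show False using nth_eq_iff_index_eq[OF dist] nx pv(1) ne by (simp add: n_def)
  qed
  ultimately show ?thesis unfolding is_tree_def by blast
qed

lemma two_level_radius: "radius_at_most (parent_edges c par) 2"
  unfolding radius_at_most_def
proof (intro exI[of _ c] allI)
  fix v
  let ?R = "adj (parent_edges c par)"
  have step: "(par u, u) \<in> ?R" if "u \<noteq> c" for u using that by (simp add: adj_def in_parent_edges)
  have "\<exists>l\<le>2. (c, v) \<in> ?R ^^ l"
  proof (cases "v = c \<or> par v = c")
    case True
    then show ?thesis
    proof
      assume "v = c" then show ?thesis by (intro exI[of _ 0]) simp
    next
      assume p: "par v = c"
      show ?thesis
      proof (cases "v = c")
        case True then show ?thesis by (intro exI[of _ 0]) simp
      next
        case False
        then show ?thesis using step[of v] p by (intro exI[of _ "Suc 0"]) simp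
      qed
    qed
  next
    case False
    then have "(c, par v) \<in> ?R" "(par v, v) \<in> ?R" using step[of v] step[of "par v"] par_par by auto
    then have "(c, v) \<in> ?R ^^ Suc (Suc 0)" by auto
    then show ?thesis by (intro exI[of _ "Suc (Suc 0)"]) simp
  qed
  then obtain l where l: "l \<le> 2" "(c, v) \<in> ?R ^^ l" by blast
  have "graph_dist (parent_edges c par) c v \<le> l" unfolding graph_dist_def using l(2) by (rule Least_le)
  then show "graph_dist (parent_edges c par) c v \<le> 2" using l(1) by simp
qed

end

definition children :: "'v \<Rightarrow> ('v \<Rightarrow> 'v) \<Rightarrow> 'v \<Rightarrow> 'v set" where
  "children c par w = {v. v \<noteq> c \<and> par v = w}"

context
  fixes c :: "'v::finite" and par :: "'v \<Rightarrow> 'v"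
  assumes two: "two_level c par"
begin

lemma vertex_cover_parent_edges:
  "vertex_cover (parent_edges c par) S \<longleftrightarrow> (c \<in> S \<and> (\<forall>w\<in>children c par c. w \<in> S \<or> children c par w \<subseteq> S)) \<or> (children c par c) \<subseteq> S"
proof -
  have v: "vertex_cover (parent_edges c par) S \<longleftrightarrow> (\<forall>v. v \<noteq> c \<longrightarrow> v \<in> S \<or> par v \<in> S)"
    by (auto simp: vertex_cover_def parent_edges_def)
  have p: "par v = c \<or> par v \<in> (children c par c)" for v
    using par_par[OF two, of v] by (auto simp: children_def)
  show ?thesis unfolding v
  proof
    assume a: "\<forall>v. v \<noteq> c \<longrightarrow> v \<in> S \<or> par v \<in> S"
    show "(c \<in> S \<and> (\<forall>w\<in>children c par c. w \<in> S \<or> children c par w \<subseteq> S)) \<or> (children c par c) \<subseteq> S"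
      using a unfolding children_def by blast
  next
    assume a: "(c \<in> S \<and> (\<forall>w\<in>children c par c. w \<in> S \<or> children c par w \<subseteq> S)) \<or> (children c par c) \<subseteq> S"
    show "\<forall>v. v \<noteq> c \<longrightarrow> v \<in> S \<or> par v \<in> S"
    proof (intro allI impI)
      fix v assume "v \<noteq> c"
      then have "v \<in> children c par (par v)" by (simp add: children_def)
      then show "v \<in> S \<or> par v \<in> S" using a p[of v] \<open>v \<noteq> c\<close> by (cases "par v = c") auto
    qed
  qed
qed

lemma children_facts:
  "c \<notin> (children c par c)" "c \<notin> children c par w" "w \<in> (children c par c) \<Longrightarrow> children c par w \<inter> (children c par c) = {}" "w \<noteq> w' \<Longrightarrow> children c par w \<inter> children c par w' = {}"
  "w \<in> (children c par c) \<Longrightarrow> w \<notin> children c par w" "w \<in> (children c par c) \<Longrightarrow> w' \<in> (children c par c) \<Longrightarrow> w' \<notin> children c par w"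
  by (auto simp: children_def)

lemma UNIV_two_level: "UNIV = insert c (\<Union>w\<in>children c par c. insert w (children c par w))"
proof -
  have "v = c \<or> v \<in> (children c par c) \<or> v \<in> children c par (par v) \<and> par v \<in> (children c par c)" for v
    using par_par[OF two, of v] by (auto simp: children_def)
  then show ?thesis by blast
qed

lemma card_two_level: "card (UNIV :: 'v set) = 1 + card (children c par c) + (\<Sum>w\<in>children c par c. card (children c par w))"
proof -
  have "card (\<Union>w\<in>children c par c. insert w (children c par w)) = (\<Sum>w\<in>children c par c. card (insert w (children c par w)))"
  proof (rule card_UN_disjoint)
    show "\<forall>i\<in>children c par c. \<forall>j\<in>children c par c. i \<noteq> j \<longrightarrow> insert i (children c par i) \<inter> insert j (children c par j) = {}"
      by (auto simp: children_def)
  qed simp_all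
  also have "\<dots> = (\<Sum>w\<in>children c par c. 1 + card (children c par w))" using children_facts(5) by (intro sum.cong refl) simp
  also have "\<dots> = card (children c par c) + (\<Sum>w\<in>children c par c. card (children c par w))" by (simp only: sum.distrib) simp
  finally have u: "card (\<Union>w\<in>children c par c. insert w (children c par w)) = card (children c par c) + (\<Sum>w\<in>children c par c. card (children c par w))" .
  have "c \<notin> (\<Union>w\<in>children c par c. insert w (children c par w))" by (auto simp: children_def)
  then have "card (insert c (\<Union>w\<in>children c par c. insert w (children c par w))) = Suc (card (\<Union>w\<in>children c par c. insert w (children c par w)))"
    by simp
  then show ?thesis unfolding UNIV_two_level[symmetric] u by simp
qed

lemma N_nonempty: "card (UNIV :: 'v set) \<ge> 2 \<Longrightarrow> (children c par c) \<noteq> {}"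
  using card_two_level by (cases "(children c par c) = {}") auto

text \<open>
  The degrees are read off from the explicit resolution of \<open>star_resolution\<close>, with the root as \<open>c\<close>, its children
  as \<open>N\<close>, and their children as \<open>L\<close>.
\<close>

theorem regularity_two_level:
  assumes "card (UNIV :: 'v set) \<ge> 2"
  shows "regularity_quot (cover_ideal (parent_edges c par) :: ('v, 'k::field) mpoly set)
    = int (max (\<Sum>w\<in>children c par c. card (children c par w)) (card (children c par c) - 1))"
proof -
  have J: "(cover_ideal (parent_edges c par) :: ('v, 'k) mpoly set)
      = mon_ideal (\<lambda>m. (c \<in> keys m \<and> (\<forall>w\<in>children c par c. w \<in> keys m \<or> children c par w \<subseteq> keys m))
     \<or> (children c par c) \<subseteq> keys m)"
    unfolding cover_ideal_eq_mon_ideal vertex_cover_parent_edges ..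
  let ?r = "max (\<Sum>w\<in>children c par c. card (children c par w)) (card (children c par c) - 1)"
  obtain G \<delta> \<epsilon> d where R: "ideal_resolution (cover_ideal (parent_edges c par) :: ('v, 'k) mpoly set) G \<delta> \<epsilon> d"
    and m: "\<And>g. g \<in> G 0 \<Longrightarrow> lookup (\<epsilon> (unit_at g)) 0 = 0"
    and le: "\<And>i g. g \<in> G i \<Longrightarrow> \<delta> i g \<le> Suc i + ?r"
    and att: "\<exists>i. \<exists>g\<in>G i. \<delta> i g = Suc i + ?r" and fin: "\<exists>n. \<forall>i>n. G i = {}"
  proof -
    have "\<exists>G \<delta> \<epsilon> d. ideal_resolution (cover_ideal (parent_edges c par) :: ('v, 'k) mpoly set) G \<delta> \<epsilon> d \<and>
      (\<forall>g\<in>G 0. lookup (\<epsilon> (unit_at g)) 0 = 0) \<and>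
      (\<forall>i. \<forall>g\<in>G i. \<delta> i g \<le> Suc i + ?r) \<and> (\<exists>i. \<exists>g\<in>G i. \<delta> i g = Suc i + ?r) \<and> (\<exists>n. \<forall>i>n. G i = {})"
      unfolding J
      by (rule star_resolution)
        (rule children_facts N_nonempty[OF assms] | assumption)+
    then show ?thesis using that by blast
  qed
  interpret ideal_resolution "cover_ideal (parent_edges c par) :: ('v, 'k) mpoly set" G \<delta> \<epsilon> d by (rule R)
  obtain i g where ig: "g \<in> G i" "\<delta> i g = Suc i + ?r" using att by blast
  obtain n where n: "\<And>i. i > n \<Longrightarrow> G i = {}" using fin by blast
  show ?thesis by (rule regularity_quot_res[OF m le ig n])
qed

end

section \<open>The h-polynomial as a sum over non-covers\<close>

lemma krull_dim_cover_ideal: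
  fixes E :: "'v::finite set set"
  assumes simple: "simple_graph E" and ne: "E \<noteq> {}"
  shows "krull_dim_quot (cover_ideal E :: ('v, 'k::field) mpoly set) = card (UNIV :: 'v set) - 2"
    and "\<not> vertex_cover E S \<Longrightarrow> card S \<le> card (UNIV :: 'v set) - 2"
proof -
  have le: "card S \<le> card (UNIV :: 'v set) - 2" if nc: "\<not> vertex_cover E S" for S
  proof -
    obtain e where e: "e \<in> E" "e \<inter> S = {}" using nc by (auto simp: vertex_cover_def)
    have "card (S \<union> e) = card S + card e" using e(2) by (intro card_Un_disjoint) auto
    moreover have "card (S \<union> e) \<le> card (UNIV :: 'v set)" by (intro card_mono) auto
    moreover have "card e = 2" using simple e(1) by (simp add: simple_graph_def)
    ultimately show ?thesis by simp
  qed
  then show "\<not> vertex_cover E S \<Longrightarrow> card S \<le> card (UNIV :: 'v set) - 2" .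
  obtain e where e: "e \<in> E" using ne by blast
  show "krull_dim_quot (cover_ideal E :: ('v, 'k) mpoly set) = card (UNIV :: 'v set) - 2"
    unfolding cover_ideal_eq_mon_ideal
  proof (rule krull_dim_quot_mon_ideal[OF vertex_cover_mono le])
    show "\<not> vertex_cover E (- e)" using e by (auto simp: vertex_cover_def)
    show "card (- e) = card (UNIV :: 'v set) - 2"
      using simple e by (simp add: simple_graph_def Compl_eq_Diff_UNIV card_Diff_subset)
  qed
qed

text \<open>
  The polynomial \<open>\<Sum> t\<^bsup>|S|\<^esup> (1 - t)\<^bsup>|A - S|\<^esup>\<close> over the subsets \<open>S\<close> of \<open>A\<close> with property \<open>P\<close>. It behaves like the
  probability of \<open>P\<close> for a random subset of \<open>A\<close> that contains each element independently with probability
  \<open>t\<close>: it is 1 for the trivial property, additive over exclusive properties, and multiplicative over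
  disjoint parts of \<open>A\<close>.
\<close>

definition wsum :: "'v set \<Rightarrow> ('v set \<Rightarrow> bool) \<Rightarrow> int poly" where
  "wsum A P = (\<Sum>S | S \<subseteq> A \<and> P S. [:0, 1:] ^ card S * [:1, -1:] ^ (card A - card S))"

lemma wsum_True: "finite A \<Longrightarrow> wsum A (\<lambda>_. True) = 1"
  using sum_subset_weight[of A] by (simp add: wsum_def Pow_def)

lemma wsum_Un:
  assumes "finite A" "finite B" "A \<inter> B = {}"
  shows "wsum (A \<union> B) (\<lambda>S. P (S \<inter> A) \<and> Q (S \<inter> B)) = wsum A P * wsum B Q"
proof -
  let ?w = "\<lambda>A S :: 'a set. [:0, 1:] ^ card S * [:1, -1 :: int:] ^ (card A - card S)"
  have mult: "?w (A \<union> B) (X \<union> Y) = ?w A X * ?w B Y" if "X \<subseteq> A" "Y \<subseteq> B" for X Y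
  proof -
    have f: "finite X" "finite Y" using that assms finite_subset by blast+
    have c: "card (X \<union> Y) = card X + card Y" "card (A \<union> B) = card A + card B"
      using that assms f by (auto intro!: card_Un_disjoint)
    have le: "card X \<le> card A" "card Y \<le> card B" using that assms by (auto intro: card_mono)
    then have d: "card A + card B - (card X + card Y) = (card A - card X) + (card B - card Y)" by simp
    show ?thesis unfolding c d power_add by (simp only: mult.assoc mult.left_commute)
  qed
  have "wsum A P * wsum B Q = (\<Sum>(X, Y)\<in>{X. X \<subseteq> A \<and> P X} \<times> {Y. Y \<subseteq> B \<and> Q Y}. ?w A X * ?w B Y)"
    unfolding wsum_def by (simp add: sum_product sum.cartesian_product)
  also have "\<dots> = (\<Sum>S | S \<subseteq> A \<union> B \<and> P (S \<inter> A) \<and> Q (S \<inter> B). ?w (A \<union> B) S)"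
  proof (rule sum.reindex_bij_witness[of _ "\<lambda>S. (S \<inter> A, S \<inter> B)" "\<lambda>(X, Y). X \<union> Y"])
    fix p assume "p \<in> {X. X \<subseteq> A \<and> P X} \<times> {Y. Y \<subseteq> B \<and> Q Y}"
    then obtain X Y where p: "p = (X, Y)" "X \<subseteq> A" "P X" "Y \<subseteq> B" "Q Y" by blast
    have XY: "(X \<union> Y) \<inter> A = X" "(X \<union> Y) \<inter> B = Y" using p assms(3) by blast+
    show "(case p of (X, Y) \<Rightarrow> X \<union> Y) \<in> {S. S \<subseteq> A \<union> B \<and> P (S \<inter> A) \<and> Q (S \<inter> B)}"
      using p XY by auto
    show "((case p of (X, Y) \<Rightarrow> X \<union> Y) \<inter> A, (case p of (X, Y) \<Rightarrow> X \<union> Y) \<inter> B) = p"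
      using p XY by simp
    show "?w (A \<union> B) (case p of (X, Y) \<Rightarrow> X \<union> Y) = (case p of (X, Y) \<Rightarrow> ?w A X * ?w B Y)"
      using mult[OF p(2,4)] p(1) by simp
  qed auto
  finally show ?thesis unfolding wsum_def ..
qed

lemma wsum_cong: "(\<And>S. S \<subseteq> A \<Longrightarrow> P S \<longleftrightarrow> Q S) \<Longrightarrow> wsum A P = wsum A Q"
  unfolding wsum_def by (intro sum.cong) auto

lemma wsum_disj:
  assumes "finite A" "\<And>S. \<not> (P S \<and> Q S)"
  shows "wsum A (\<lambda>S. P S \<or> Q S) = wsum A P + wsum A Q"
proof -
  have "{S. S \<subseteq> A \<and> (P S \<or> Q S)} = {S. S \<subseteq> A \<and> P S} \<union> {S. S \<subseteq> A \<and> Q S}" by blast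
  then show ?thesis unfolding wsum_def using assms by (auto intro!: sum.union_disjoint)
qed

lemma wsum_eq:
  assumes "B \<subseteq> A" shows "wsum A (\<lambda>S. S = B) = [:0, 1:] ^ card B * [:1, -1:] ^ (card A - card B)"
proof -
  have "{S. S \<subseteq> A \<and> S = B} = {B}" using assms by blast
  then show ?thesis by (simp add: wsum_def)
qed

lemma wsum_UN:
  assumes "finite I" "\<And>i. i \<in> I \<Longrightarrow> finite (A i)"
    and "\<And>i j. i \<in> I \<Longrightarrow> j \<in> I \<Longrightarrow> i \<noteq> j \<Longrightarrow> A i \<inter> A j = {}"
  shows "wsum (\<Union>i\<in>I. A i) (\<lambda>S. \<forall>i\<in>I. P i (S \<inter> A i)) = (\<Prod>i\<in>I. wsum (A i) (P i))"
  using assms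
proof (induction I rule: finite_induct)
  case empty
  then show ?case by (simp add: wsum_True)
next
  case (insert i I)
  have disj: "A i \<inter> (\<Union>j\<in>I. A j) = {}" using insert.prems(2) insert.hyps(2) by fastforce
  have "wsum (\<Union>j\<in>insert i I. A j) (\<lambda>S. \<forall>j\<in>insert i I. P j (S \<inter> A j))
      = wsum (A i \<union> (\<Union>j\<in>I. A j)) (\<lambda>S. P i (S \<inter> A i) \<and> (\<forall>j\<in>I. P j ((S \<inter> (\<Union>j\<in>I. A j)) \<inter> A j)))"
  proof -
    have "(S \<inter> (\<Union>j\<in>I. A j)) \<inter> A j = S \<inter> A j" if "j \<in> I" for S j using that by blast
    then show ?thesis by (simp cong: ball_cong)
  qed
  also have "\<dots> = wsum (A i) (P i) * wsum (\<Union>j\<in>I. A j) (\<lambda>S. \<forall>j\<in>I. P j (S \<inter> A j))"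
    using insert.hyps insert.prems by (intro wsum_Un[OF _ _ disj]) auto
  also have "wsum (\<Union>j\<in>I. A j) (\<lambda>S. \<forall>j\<in>I. P j (S \<inter> A j)) = (\<Prod>j\<in>I. wsum (A j) (P j))"
    using insert.prems by (intro insert.IH) auto
  finally show ?case using insert.hyps by simp
qed

lemma wsum_block:
  assumes "w \<notin> B" "finite B"
  shows "wsum (insert w (B :: 'v set)) (\<lambda>S. w \<in> S \<or> B \<subseteq> S) = [:0, 1:] + [:1, -1:] * [:0, 1:] ^ card B"
proof -
  have "wsum (insert w B) (\<lambda>S. w \<in> S \<or> B \<subseteq> S)
      = wsum (insert w B) (\<lambda>S. w \<in> S \<or> (w \<notin> S \<and> B \<subseteq> S))" by (rule wsum_cong) blast
  also have "\<dots> = wsum (insert w B) (\<lambda>S. w \<in> S) + wsum (insert w B) (\<lambda>S. w \<notin> S \<and> B \<subseteq> S)"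
    using assms(2) by (intro wsum_disj) auto
  also have "wsum (insert w B) (\<lambda>S. w \<in> S) = wsum ({w} \<union> B) (\<lambda>S. S \<inter> {w} = {w} \<and> True)"
    by (simp, rule wsum_cong) blast
  also have "\<dots> = wsum {w} (\<lambda>S. S = {w}) * wsum B (\<lambda>_. True)"
    using assms by (intro wsum_Un) auto
  also have "\<dots> = [:0, 1:]" using assms(2) by (simp add: wsum_eq wsum_True)
  also have "wsum (insert w B) (\<lambda>S. w \<notin> S \<and> B \<subseteq> S) = wsum (insert w B) (\<lambda>S. S = B)"
    using assms by (intro wsum_cong) blast
  also have "\<dots> = [:1, -1:] * [:0, 1:] ^ card B"
    using assms by (subst wsum_eq) (auto simp: mult.commute)
  finally show ?thesis .
qed

text \<open>
  Multiplying by \<open>(1 - t)\<^sup>2\<close> turns the weights with exponent \<open>n - 2\<close> into those with exponent \<open>n\<close>, and the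
  non-covers have the complementary weight of the covers.
\<close>

lemma h_poly_cover_ideal:
  fixes E :: "'v::finite set set"
  assumes "simple_graph E" "E \<noteq> {}"
  shows "[:1, -1:] ^ 2 * h_poly (cover_ideal E :: ('v, 'k::field) mpoly set) = 1 - wsum UNIV (vertex_cover E)"
proof -
  let ?J = "cover_ideal E :: ('v, 'k) mpoly set" and ?n = "card (UNIV :: 'v set)"
  note k = krull_dim_cover_ideal(1)[OF assms, where 'k = 'k] and le = krull_dim_cover_ideal(2)[OF assms]
  obtain e where "e \<in> E" using assms(2) by blast
  then have "card e = 2" using assms(1) by (simp add: simple_graph_def)
  then have n2: "?n \<ge> 2" using card_mono[of UNIV e] by simp
  have h: "h_poly ?J = (\<Sum>S | \<not> vertex_cover E S. subset_weight (?n - 2) S)"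
    using h_poly_support[of ?J "vertex_cover E", OF cover_ideal_eq_mon_ideal] le unfolding k by blast
  have "[:1, -1:] ^ 2 * h_poly ?J = (\<Sum>S | \<not> vertex_cover E S. [:0, 1:] ^ card S * [:1, -1:] ^ (?n - card S))"
    unfolding h sum_distrib_left
  proof (intro sum.cong refl)
    fix S assume "S \<in> {S. \<not> vertex_cover E S}"
    then have "?n - card S = 2 + (?n - 2 - card S)" using le[of S] n2 by simp
    then show "[:1, -1:] ^ 2 * subset_weight (?n - 2) S = [:0, 1:] ^ card S * [:1, -1:] ^ (?n - card S)"
      unfolding subset_weight_def by (simp only: power_add mult.left_commute)
  qed
  also have "\<dots> = wsum UNIV (\<lambda>S. \<not> vertex_cover E S)" by (simp add: wsum_def)
  also have "\<dots> = 1 - wsum UNIV (vertex_cover E)"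
    using wsum_disj[of UNIV "\<lambda>S. \<not> vertex_cover E S" "vertex_cover E"] wsum_True[of "UNIV :: 'v set"]
    by simp
  finally show ?thesis .
qed

text \<open>
  Covers that contain \<open>c\<close> are independent choices of a cover for each block consisting of \<open>w\<close> and its
  children; covers that do not contain \<open>c\<close> are the sets containing all children of \<open>c\<close>.
\<close>

lemma wsum_vertex_cover_two_level:
  fixes c :: "'v::finite"
  assumes two: "two_level c par"
  shows "wsum UNIV (vertex_cover (parent_edges c par))
    = [:0, 1:] * (\<Prod>w\<in>children c par c. [:0, 1:] + [:1, -1:] * [:0, 1:] ^ card (children c par w))
      + [:1, -1:] * [:0, 1:] ^ card (children c par c)"
proof -
  let ?N = "children c par c" and ?L = "children c par"
  let ?U = "\<Union>w\<in>?N. insert w (?L w)"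
  note cf = children_facts[OF two]
  have U: "UNIV = {c} \<union> ?U" using UNIV_two_level[OF two] by simp
  have cU: "{c} \<inter> ?U = {}" by (auto simp: children_def)
  let ?P = "\<lambda>S. c \<in> S \<and> (\<forall>w\<in>?N. w \<in> S \<or> ?L w \<subseteq> S)"
  have "wsum UNIV (vertex_cover (parent_edges c par)) = wsum UNIV (\<lambda>S. ?P S \<or> (c \<notin> S \<and> ?N \<subseteq> S))"
    unfolding vertex_cover_parent_edges[OF two] by (rule wsum_cong) blast
  also have "\<dots> = wsum UNIV ?P + wsum UNIV (\<lambda>S. c \<notin> S \<and> ?N \<subseteq> S)"
    by (rule wsum_disj) auto
  also have "wsum UNIV ?P = wsum ({c} \<union> ?U) (\<lambda>S. S \<inter> {c} = {c} \<and>
      (\<forall>w\<in>?N. w \<in> (S \<inter> ?U) \<inter> insert w (?L w) \<or> ?L w \<subseteq> (S \<inter> ?U) \<inter> insert w (?L w)))"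
    unfolding U[symmetric] by (rule wsum_cong) blast
  also have "\<dots> = wsum {c} (\<lambda>S. S = {c}) *
      wsum ?U (\<lambda>S. \<forall>w\<in>?N. w \<in> S \<inter> insert w (?L w) \<or> ?L w \<subseteq> S \<inter> insert w (?L w))"
    by (rule wsum_Un[OF _ _ cU]) auto
  also have "wsum {c} (\<lambda>S. S = {c}) = [:0, 1:]" by (simp add: wsum_eq)
  also have "wsum ?U (\<lambda>S. \<forall>w\<in>?N. w \<in> S \<inter> insert w (?L w) \<or> ?L w \<subseteq> S \<inter> insert w (?L w))
      = (\<Prod>w\<in>?N. wsum (insert w (?L w)) (\<lambda>S. w \<in> S \<or> ?L w \<subseteq> S))"
    by (rule wsum_UN) (auto simp: children_def)
  also have "\<dots> = (\<Prod>w\<in>?N. [:0, 1:] + [:1, -1:] * [:0, 1:] ^ card (?L w))"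
    using cf(5) by (intro prod.cong refl wsum_block) simp_all
  also have "wsum UNIV (\<lambda>S. c \<notin> S \<and> ?N \<subseteq> S)
      = wsum (insert c ?N \<union> - insert c ?N) (\<lambda>S. S \<inter> insert c ?N = ?N \<and> True)"
    unfolding Compl_partition using cf(1) by (intro wsum_cong) blast
  also have "\<dots> = wsum (insert c ?N) (\<lambda>S. S = ?N) * wsum (- insert c ?N) (\<lambda>_. True)"
    by (rule wsum_Un) auto
  also have "\<dots> = [:1, -1:] * [:0, 1:] ^ card ?N"
    using cf(1) by (subst wsum_eq) (auto simp: wsum_True mult.commute)
  finally show ?thesis .
qed

section \<open>Degree of the h-polynomial\<close>

lemma degree_eqI:
  fixes p :: "int poly"
  assumes "poly.coeff p n \<noteq> 0" "\<And>j. j > n \<Longrightarrow> poly.coeff p j = 0"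
  shows "Polynomial.degree p = n"
  using assms by (intro antisym degree_le le_degree) auto

lemma X_power_eq_monom: "[:0, 1 :: int:] ^ k = Polynomial.monom 1 k"
  by (metis monom_altdef mult_1 smult_1_left)

lemma one_minus_X_mult: "[:1, -1 :: int:] * p = p - Polynomial.monom 1 1 * p"
proof -
  have "[:1, -1 :: int:] = 1 - Polynomial.monom 1 1"
    by (rule poly_eqI) (simp add: coeff_pCons split: nat.split)
  then show ?thesis by (simp add: left_diff_distrib)
qed

lemma coeff_block_mult:
  fixes p :: "int poly"
  assumes "j \<ge> a + 1" "a \<ge> 1"
  shows "poly.coeff (p * ([:0, 1:] + [:1, -1:] * [:0, 1:] ^ a)) j
    = poly.coeff p (j - 1) + poly.coeff p (j - a) - poly.coeff p (j - (a + 1))"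
proof -
  have "[:0, 1 :: int:] + [:1, -1:] * [:0, 1:] ^ a
      = Polynomial.monom 1 1 + Polynomial.monom 1 a - Polynomial.monom 1 (a + 1)"
    unfolding one_minus_X_mult X_power_eq_monom mult_monom
    using X_power_eq_monom[of 1] by simp
  then have "p * ([:0, 1:] + [:1, -1:] * [:0, 1:] ^ a)
      = Polynomial.monom 1 1 * p + Polynomial.monom 1 a * p - Polynomial.monom 1 (a + 1) * p"
    by (simp only: distrib_left right_diff_distrib mult.commute[of p])
  then show ?thesis using assms by (simp add: coeff_monom_mult)
qed

lemma sign_expand:
  assumes x: "(x :: int) = y + u - z" shows "(-1 * u) * x = - (u * y) - u * u + u * z"
  unfolding x by (simp add: algebra_simps)

text \<open>
  Each factor is \<open>t + t\<^sup>a - t\<^bsup>a + 1\<^esup>\<close>, so the leading coefficient of the product is \<open>(-1)\<^bsup>|W|\<^esup>\<close>. Up to this sign, each factor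
  lowers the next coefficient by at least 1. The additional factor \<open>t\<close> makes the next coefficient meaningful
  also for the empty product.
\<close>

lemma block_product_coeffs:
  fixes a :: "'w \<Rightarrow> nat"
  assumes "finite W" "\<And>w. w \<in> W \<Longrightarrow> a w \<ge> 1"
  defines "D \<equiv> (\<Sum>w\<in>W. a w) + card W"
    and "P \<equiv> [:0, 1 :: int:] * (\<Prod>w\<in>W. [:0, 1:] + [:1, -1:] * [:0, 1:] ^ a w)"
  shows "(\<forall>j>D + 1. poly.coeff P j = 0) \<and> poly.coeff P (D + 1) = (-1) ^ card W \<and>
    (-1) ^ card W * poly.coeff P D \<le> - int (card W)"
  using assms(1,2) unfolding D_def P_def
proof (induction W rule: finite_induct)
  case empty
  then show ?case by (auto simp: coeff_pCons split: nat.split)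
next
  case (insert w W)
  let ?D = "(\<Sum>w\<in>W. a w) + card W" and ?P = "[:0, 1 :: int:] * (\<Prod>w\<in>W. [:0, 1:] + [:1, -1:] * [:0, 1:] ^ a w)"
  have IH: "\<And>j. j > ?D + 1 \<Longrightarrow> poly.coeff ?P j = 0" "poly.coeff ?P (?D + 1) = (-1) ^ card W"
    "(-1) ^ card W * poly.coeff ?P ?D \<le> - int (card W)"
    using insert.IH insert.prems by auto
  have aw: "a w \<ge> 1" using insert.prems by simp
  have D': "(\<Sum>w\<in>insert w W. a w) + Suc (card W) = ?D + a w + 1" using insert.hyps by simp
  have cW: "card (insert w W) = Suc (card W)" using insert.hyps by simp
  have P': "[:0, 1 :: int:] * (\<Prod>w\<in>insert w W. [:0, 1:] + [:1, -1:] * [:0, 1:] ^ a w)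
      = ?P * ([:0, 1:] + [:1, -1:] * [:0, 1:] ^ a w)"
    unfolding prod.insert[OF insert.hyps(1,2)] by (subst mult.assoc[symmetric]) (rule mult_right_swap)
  define Q where "Q = ?P"
  define e where "e = ?D"
  note IH = IH[folded Q_def e_def]
  have c: "poly.coeff (Q * ([:0, 1:] + [:1, -1:] * [:0, 1:] ^ a w)) j
      = poly.coeff Q (j - 1) + poly.coeff Q (j - a w) - poly.coeff Q (j - (a w + 1))"
    if "j \<ge> a w + 1" for j by (rule coeff_block_mult[OF that aw])
  have 1: "poly.coeff (Q * ([:0, 1:] + [:1, -1:] * [:0, 1:] ^ a w)) j = 0" if "j > e + a w + 1 + 1" for j
    using c[of j] that aw IH(1)[of "j - 1"] IH(1)[of "j - a w"] IH(1)[of "j - (a w + 1)"] by simp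
  have 2: "poly.coeff (Q * ([:0, 1:] + [:1, -1:] * [:0, 1:] ^ a w)) (e + a w + 1 + 1) = (-1) ^ Suc (card W)"
    using c[of "e + a w + 1 + 1"] aw IH(1)[of "e + a w + 1"] IH(1)[of "e + 2"] IH(2) by simp
  have top: "(-1) ^ card W * poly.coeff Q (e + a w) \<ge> 0"
  proof (cases "a w = 1")
    case True
    then show ?thesis using IH(2) by (simp flip: power_mult_distrib)
  next
    case False
    then show ?thesis using IH(1)[of "e + a w"] aw by simp
  qed
  have "poly.coeff (Q * ([:0, 1:] + [:1, -1:] * [:0, 1:] ^ a w)) (e + a w + 1)
      = poly.coeff Q (e + a w) + (-1) ^ card W - poly.coeff Q e"
    using c[of "e + a w + 1"] IH(2) by (simp add: Suc_diff_le)
  then have "(-1) ^ Suc (card W) * poly.coeff (Q * ([:0, 1:] + [:1, -1:] * [:0, 1:] ^ a w)) (e + a w + 1)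
      = - ((-1) ^ card W * poly.coeff Q (e + a w)) - ((-1) ^ card W * (-1) ^ card W) + (-1) ^ card W * poly.coeff Q e"
    unfolding power_Suc by (rule sign_expand)
  also have "(-1 :: int) ^ card W * (-1) ^ card W = 1" by (simp flip: power_mult_distrib)
  finally have 3: "(-1) ^ Suc (card W) * poly.coeff (Q * ([:0, 1:] + [:1, -1:] * [:0, 1:] ^ a w)) (e + a w + 1)
      \<le> - int (Suc (card W))"
    using top IH(3) by linarith
  show ?case unfolding P' D' cW Q_def[symmetric] e_def[symmetric]
    by (intro conjI allI impI 1 2 3)
qed

text \<open>
  The coefficients of \<open>1 - K\<close> in the top degrees are those of \<open>- t \<Prod> (t + (1 - t) t\<^sup>a)\<close> plus those of \<open>t\<^bsup>n1 + 1\<^esup> - t\<^bsup>n1\<^esup>\<close>. If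
  both parts have degree \<open>n1 + 1\<close> and \<open>s\<close> is even, the leading terms cancel, and the coefficient of \<open>t\<^bsup>n1\<^esup>\<close> is at
  least \<open>s - 1\<close>. It is positive since \<open>s = 0\<close> would give \<open>n2 = 0\<close> and hence \<open>n1 = 0\<close>.
\<close>

theorem degree_cover_numerator:
  fixes a :: "'w \<Rightarrow> nat"
  assumes N: "finite N" "N \<noteq> {}"
  defines "n1 \<equiv> card N" and "n2 \<equiv> (\<Sum>w\<in>N. a w)" and "s \<equiv> card {w \<in> N. a w \<noteq> 0}"
    and "K \<equiv> [:0, 1 :: int:] * (\<Prod>w\<in>N. [:0, 1:] + [:1, -1:] * [:0, 1:] ^ a w) + [:1, -1:] * [:0, 1:] ^ card N"
  shows "Polynomial.degree (1 - K) = (if n2 + s = n1 \<and> even s then n1 else max (n2 + s) n1 + 1)"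
proof -
  define W where "W = {w \<in> N. a w \<noteq> 0}"
  define P where "P = [:0, 1 :: int:] * (\<Prod>w\<in>W. [:0, 1:] + [:1, -1:] * [:0, 1:] ^ a w)"
  define D where "D = n2 + s"
  have n2: "n2 = (\<Sum>w\<in>W. a w)" unfolding n2_def W_def by (rule sum.mono_neutral_right) (use N in auto)
  have s: "s = card W" by (simp add: s_def W_def)
  have P_eq: "(\<Prod>w\<in>N. [:0, 1 :: int:] + [:1, -1:] * [:0, 1:] ^ a w) = (\<Prod>w\<in>W. [:0, 1:] + [:1, -1:] * [:0, 1:] ^ a w)"
    unfolding W_def by (rule prod.mono_neutral_right) (use N in \<open>auto simp: one_pCons\<close>)
  have "(\<forall>j>D + 1. poly.coeff P j = 0) \<and> poly.coeff P (D + 1) = (-1) ^ s \<and>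
    (-1) ^ s * poly.coeff P D \<le> - int s"
    unfolding D_def n2 s P_def by (rule block_product_coeffs) (use N in \<open>auto simp: W_def\<close>)
  then have P1: "\<And>j. j > D + 1 \<Longrightarrow> poly.coeff P j = 0" and P2: "poly.coeff P (D + 1) = (-1) ^ s"
    and P3: "(-1) ^ s * poly.coeff P D \<le> - int s" by blast+
  have n1: "n1 \<ge> 1" using N by (simp add: n1_def Suc_le_eq card_gt_0_iff)
  have K: "K = P + Polynomial.monom 1 n1 - Polynomial.monom 1 (n1 + 1)"
  proof -
    have "K = P + [:1, -1:] * [:0, 1:] ^ n1" unfolding K_def P_eq P_def n1_def ..
    then show ?thesis unfolding one_minus_X_mult X_power_eq_monom by (simp add: mult_monom)
  qed
  have cf: "poly.coeff (1 - K) j = - poly.coeff P j - (if j = n1 then 1 else 0) + (if j = n1 + 1 then 1 else 0)"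
    if "j \<ge> 1" for j
    unfolding K using that by (simp add: coeff_monom)
  show ?thesis
  proof (cases "n2 + s = n1 \<and> even s")
    case True
    then have D: "D = n1" and ev: "even s" by (simp_all add: D_def)
    have "s \<noteq> 0"
    proof
      assume "s = 0"
      then have "W = {}" using N s by (simp add: W_def)
      then have "n2 = 0" unfolding n2 by simp
      then show False using True \<open>s = 0\<close> n1 by simp
    qed
    then have s2: "s \<ge> 2" using ev by presburger
    have "Polynomial.degree (1 - K) = n1"
    proof (rule degree_eqI)
      have "poly.coeff P n1 \<le> - int s" using P3 ev unfolding D by simp
      then show "poly.coeff (1 - K) n1 \<noteq> 0" using cf[of n1] n1 s2 by simp
      fix j assume j: "j > n1"
      show "poly.coeff (1 - K) j = 0"
      proof (cases "j = n1 + 1")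
        case True
        then show ?thesis using cf[of j] P2 ev D by simp
      next
        case False
        then show ?thesis using cf[of j] P1[of j] j D by simp
      qed
    qed
    then show ?thesis using True by simp
  next
    case False
    have "Polynomial.degree (1 - K) = max D n1 + 1"
    proof (rule degree_eqI)
      consider "D > n1" | "D < n1" | "D = n1" "odd s" using False unfolding D_def by linarith
      then show "poly.coeff (1 - K) (max D n1 + 1) \<noteq> 0"
      proof cases
        case 1
        then show ?thesis using cf[of "D + 1"] P2 by simp
      next
        case 2
        then show ?thesis using cf[of "n1 + 1"] P1[of "n1 + 1"] by simp
      next
        case 3
        then show ?thesis using cf[of "n1 + 1"] P2 by simp
      qed
      show "poly.coeff (1 - K) j = 0" if "j > max D n1 + 1" for j
      proof -
        have "j > D + 1" "j > n1 + 1" "j \<ge> 1" using that by auto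
        then show ?thesis using cf[of j] P1[of j] by simp
      qed
    qed
    then show ?thesis using False by (simp add: D_def)
  qed
qed

theorem degree_h_poly_two_level:
  fixes c :: "'v::finite"
  assumes two: "two_level c par" and n: "card (UNIV :: 'v set) \<ge> 2"
  defines "n1 \<equiv> card (children c par c)" and "n2 \<equiv> (\<Sum>w\<in>children c par c. card (children c par w))"
    and "s \<equiv> card {w \<in> children c par c. children c par w \<noteq> {}}"
  shows "Polynomial.degree (h_poly (cover_ideal (parent_edges c par) :: ('v, 'k::field) mpoly set)) + 2
    = (if n2 + s = n1 \<and> even s then n1 else max (n2 + s) n1 + 1)"
proof -
  let ?E = "parent_edges c par"
  let ?h = "h_poly (cover_ideal ?E :: ('v, 'k) mpoly set)"
  let ?N = "children c par c"
  let ?a = "\<lambda>w. card (children c par w)"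
  have Nne: "?N \<noteq> {}" by (rule N_nonempty[OF two n])
  then have E: "?E \<noteq> {}" by (auto simp: parent_edges_def children_def)
  have simple: "simple_graph ?E" using two_level_is_tree[OF two] by (simp add: is_tree_def)
  have s: "s = card {w \<in> ?N. ?a w \<noteq> 0}" unfolding s_def by simp
  have hK: "[:1, -1:] ^ 2 * ?h = 1 - ([:0, 1:] * (\<Prod>w\<in>?N. [:0, 1:] + [:1, -1:] * [:0, 1:] ^ ?a w) + [:1, -1:] * [:0, 1:] ^ card ?N)"
    unfolding h_poly_cover_ideal[OF simple E] wsum_vertex_cover_two_level[OF two] ..
  have deg: "Polynomial.degree ([:1, -1:] ^ 2 * ?h) = (if n2 + s = n1 \<and> even s then n1 else max (n2 + s) n1 + 1)"
    unfolding hK s n1_def n2_def by (rule degree_cover_numerator[OF finite Nne])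
  have "n1 \<ge> 1" using Nne by (simp add: n1_def Suc_le_eq card_gt_0_iff)
  then have "Polynomial.degree ([:1, -1:] ^ 2 * ?h) \<ge> 1" unfolding deg by simp
  then have "?h \<noteq> 0" by auto
  then have "Polynomial.degree ([:1, -1:] ^ 2 * ?h) = Polynomial.degree ([:1, -1 :: int:] ^ 2) + Polynomial.degree ?h"
    by (intro degree_mult_eq) simp_all
  also have "Polynomial.degree ([:1, -1 :: int:] ^ 2) = 2" by (simp add: degree_power_eq)
  finally show ?thesis unfolding deg by simp
qed

section \<open>Realising the parameters\<close>

text \<open>
  Number the vertices. Vertex 0 is the root and \<open>1, \<dots>, n1\<close> are its children; the remaining vertices are
  dealt out cyclically to the children \<open>1, \<dots>, s\<close>, and as there are at least \<open>s\<close> of them, exactly these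
  become parents.
\<close>

lemma two_level_exists:
  assumes n: "card (UNIV :: 'v::finite set) = 1 + n1 + n2" and s: "s \<le> n1" "s \<le> n2" "s = 0 \<Longrightarrow> n2 = 0"
  obtains c :: "'v::finite" and par where "two_level c par" "card (children c par c) = n1"
    "(\<Sum>w\<in>children c par c. card (children c par w)) = n2"
    "card {w \<in> children c par c. children c par w \<noteq> {}} = s"
proof -
  let ?n = "1 + n1 + n2"
  obtain f :: "nat \<Rightarrow> 'v" where f: "bij_betw f {0..<?n} UNIV"
    using ex_bij_betw_nat_finite[of "UNIV :: 'v set"] n by auto
  define g where "g = inv_into {0..<?n} f"
  have fg: "f (g v) = v" and g_lt: "g v < ?n" for v
    using f bij_betw_inv_into_right[OF f, of v] bij_betwE[OF bij_betw_inv_into[OF f]] by (auto simp: g_def)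
  have gf: "g (f i) = i" if "i < ?n" for i
    using bij_betw_inv_into_left[OF f, of i] that by (simp add: g_def)
  define q where "q i = (if i \<le> n1 then 0 else 1 + (i - n1 - 1) mod s)" for i
  have q_le: "q i \<le> n1" if "i < ?n" for i
  proof (cases "i \<le> n1")
    case False
    then have "s \<noteq> 0" using s(3) that by (cases "s = 0") auto
    then have "(i - n1 - 1) mod s < s" by simp
    then show ?thesis using False s(1) by (simp add: q_def)
  qed (simp add: q_def)
  define c where "c = f 0"
  define par where "par v = f (q (g v))" for v
  have gpar: "g (par v) = q (g v)" for v
    unfolding par_def using q_le[OF g_lt[of v]] by (intro gf) simp
  have gc: "g c = 0" unfolding c_def by (rule gf) simp
  have eqc: "v = c \<longleftrightarrow> g v = 0" for v using fg gc by (metis c_def)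
  have two: "two_level c par"
    unfolding two_level_def
  proof (intro conjI allI)
    show "par c = c" unfolding eqc gpar gc by (simp add: q_def)
    show "par (par v) = c" for v unfolding eqc gpar using q_le[OF g_lt[of v]] by (simp add: q_def)
  qed
  have ch: "children c par (f j) = f ` {i. 0 < i \<and> i < ?n \<and> q i = j}" if j: "j < ?n" for j
  proof (rule subset_antisym; rule subsetI)
    fix v assume v: "v \<in> children c par (f j)"
    then have "g v \<noteq> 0" "q (g v) = j" using gpar[of v] gf[OF j] by (auto simp: children_def eqc)
    then show "v \<in> f ` {i. 0 < i \<and> i < ?n \<and> q i = j}"
      using g_lt[of v] fg[of v] by (intro image_eqI[of _ _ "g v"]) auto
  next
    fix v assume "v \<in> f ` {i. 0 < i \<and> i < ?n \<and> q i = j}"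
    then obtain i where "v = f i" "0 < i" "i < ?n" "q i = j" by blast
    then show "v \<in> children c par (f j)" using gf by (simp add: children_def eqc par_def)
  qed
  have inj: "inj_on f X" if "X \<subseteq> {0..<?n}" for X
    using f that by (meson bij_betw_imp_inj_on inj_on_subset)
  have "{i. 0 < i \<and> i < ?n \<and> q i = 0} = {1..n1}" by (auto simp: q_def split: if_splits)
  then have chc: "children c par c = f ` {1..n1}" using ch[of 0] by (simp add: c_def)
  have c1: "card (children c par c) = n1"
    unfolding chc by (subst card_image[OF inj]) auto
  have c2: "(\<Sum>w\<in>children c par c. card (children c par w)) = n2"
    using card_two_level[OF two] c1 n by simp
  have ne: "children c par (f j) \<noteq> {} \<longleftrightarrow> j \<le> s" if j: "j \<in> {1..n1}" for j
  proof
    assume "children c par (f j) \<noteq> {}"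
    then obtain i where i: "i < ?n" "q i = j" using ch[of j] j by auto
    then have i': "i > n1" using j by (auto simp: q_def split: if_splits)
    then have "s \<noteq> 0" using s(3) i(1) by (cases "s = 0") auto
    then have "(i - n1 - 1) mod s < s" by simp
    then show "j \<le> s" using i(2) i' by (simp add: q_def)
  next
    assume js: "j \<le> s"
    have "(j - 1) mod s = j - 1" using j js by (intro mod_less) auto
    then have "q (n1 + j) = j" using j by (simp add: q_def)
    then have "n1 + j \<in> {i. 0 < i \<and> i < ?n \<and> q i = j}" using j js s(2) by simp
    moreover have "children c par (f j) = f ` {i. 0 < i \<and> i < ?n \<and> q i = j}"
      using j by (intro ch) simp
    ultimately show "children c par (f j) \<noteq> {}" by blast
  qed
  have "{w \<in> children c par c. children c par w \<noteq> {}} = f ` {1..s}"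
  proof -
    have "{w \<in> f ` {1..n1}. children c par w \<noteq> {}} = f ` {j \<in> {1..n1}. children c par (f j) \<noteq> {}}" by blast
    also have "{j \<in> {1..n1}. children c par (f j) \<noteq> {}} = {j \<in> {1..n1}. j \<le> s}"
      using ne by (intro Collect_cong conj_cong refl)
    also have "\<dots> = {1..s}" using s(1) by auto
    finally show ?thesis unfolding chc .
  qed
  then have c3: "card {w \<in> children c par c. children c par w \<noteq> {}} = s"
    using s(1) by (simp add: card_image[OF inj] subset_iff)
  show ?thesis by (rule that[OF two c1 c2 c3])
qed

section \<open>The set of pairs\<close>

text \<open>
  The possible values of the number \<open>n1\<close> of children of the root, the number \<open>n2\<close> of vertices at distance 2,
  and the number \<open>s\<close> of children of the root that are not leaves.
\<close>

definition tree_params :: "nat \<Rightarrow> nat \<Rightarrow> nat \<Rightarrow> nat \<Rightarrow> bool" where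
  "tree_params n n1 n2 s \<longleftrightarrow> n = 1 + n1 + n2 \<and> s \<le> n1 \<and> s \<le> n2 \<and> (s = 0 \<longrightarrow> n2 = 0)"

definition reg_of :: "nat \<Rightarrow> nat \<Rightarrow> int" where
  "reg_of n1 n2 = int (max n2 (n1 - 1))"

definition deg_of :: "nat \<Rightarrow> nat \<Rightarrow> nat \<Rightarrow> int" where
  "deg_of n1 n2 s = int (if n2 + s = n1 \<and> even s then n1 else max (n2 + s) n1 + 1) - 2"

lemma reg_deg_pairs_eq:
  assumes n: "n \<ge> 2" "card (UNIV :: 'v::finite set) = n"
  shows "reg_deg_pairs TYPE('v) TYPE('k::field) = {(reg_of n1 n2, deg_of n1 n2 s) | n1 n2 s. tree_params n n1 n2 s}"
proof -
  have key: "regularity_quot (cover_ideal (parent_edges c par) :: ('v, 'k) mpoly set)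
        = reg_of (card (children c par c)) (\<Sum>w\<in>children c par c. card (children c par w))"
      "int (Polynomial.degree (h_poly (cover_ideal (parent_edges c par) :: ('v, 'k) mpoly set)))
        = deg_of (card (children c par c)) (\<Sum>w\<in>children c par c. card (children c par w))
           (card {w \<in> children c par c. children c par w \<noteq> {}})"
    if two: "two_level c par" for c :: 'v and par
    using regularity_two_level[OF two, where 'k = 'k] degree_h_poly_two_level[OF two, where 'k = 'k] n
    unfolding reg_of_def deg_of_def by linarith+
  show ?thesis
  proof (rule subset_antisym; rule subsetI)
    fix x assume "x \<in> reg_deg_pairs TYPE('v) TYPE('k)"
    then obtain E :: "'v set set" where E: "is_tree E" "radius_at_most E 2"
      and x: "x = (regularity_quot (cover_ideal E :: ('v, 'k) mpoly set),
        int (Polynomial.degree (h_poly (cover_ideal E :: ('v, 'k) mpoly set))))"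
      unfolding reg_deg_pairs_def by blast
    obtain c par where two: "two_level c par" and Eq: "E = parent_edges c par"
      using tree_radius_2_two_level[OF E] by blast
    let ?N = "children c par c" and ?L = "children c par"
    have sub: "{w \<in> ?N. ?L w \<noteq> {}} \<subseteq> ?N" by blast
    have n2: "(\<Sum>w\<in>?N. card (?L w)) = (\<Sum>w\<in>{w \<in> ?N. ?L w \<noteq> {}}. card (?L w))"
      by (rule sum.mono_neutral_right) auto
    have "card {w \<in> ?N. ?L w \<noteq> {}} = (\<Sum>w\<in>{w \<in> ?N. ?L w \<noteq> {}}. 1)" by simp
    also have "\<dots> \<le> (\<Sum>w\<in>?N. card (?L w))"
      unfolding n2 by (rule sum_mono) (simp add: Suc_le_eq card_gt_0_iff)
    finally have "tree_params n (card ?N) (\<Sum>w\<in>?N. card (?L w)) (card {w \<in> ?N. ?L w \<noteq> {}})"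
      unfolding tree_params_def using card_two_level[OF two] n(2) card_mono[OF finite sub]
      by auto
    then show "x \<in> {(reg_of n1 n2, deg_of n1 n2 s) | n1 n2 s. tree_params n n1 n2 s}"
      unfolding x Eq key[OF two] by blast
  next
    fix x assume "x \<in> {(reg_of n1 n2, deg_of n1 n2 s) | n1 n2 s. tree_params n n1 n2 s}"
    then obtain n1 n2 s where x: "x = (reg_of n1 n2, deg_of n1 n2 s)" and p: "tree_params n n1 n2 s" by blast
    have pre: "card (UNIV :: 'v set) = 1 + n1 + n2" "s \<le> n1" "s \<le> n2" "s = 0 \<Longrightarrow> n2 = 0"
      using p n(2) by (simp_all add: tree_params_def)
    obtain c :: 'v and par where two: "two_level c par" and ch: "card (children c par c) = n1"
      "(\<Sum>w\<in>children c par c. card (children c par w)) = n2"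
      "card {w \<in> children c par c. children c par w \<noteq> {}} = s"
      by (rule two_level_exists[OF pre])
    show "x \<in> reg_deg_pairs TYPE('v) TYPE('k)"
      unfolding reg_deg_pairs_def x
      by (rule CollectI, rule exI[of _ "parent_edges c par"])
        (simp only: key[OF two] ch two_level_is_tree[OF two] two_level_radius[OF two] simp_thms)
  qed
qed

lemma mem_A_set:
  assumes "n \<ge> 2"
  shows "(r, d) \<in> A_set n \<longleftrightarrow> int n - 2 \<le> 2 * r \<and> r \<le> int n - 2 \<and> r \<le> d \<and> d \<le> int n - 2 \<and> d \<le> 2 * r - 1"
proof -
  have "\<lceil>(real n - 2) / 2\<rceil> \<le> r \<longleftrightarrow> (real n - 2) / 2 \<le> real_of_int r" by (rule ceiling_le_iff)
  also have "\<dots> \<longleftrightarrow> real_of_int (int n - 2) \<le> real_of_int (2 * r)" by (simp add: field_simps)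
  also have "\<dots> \<longleftrightarrow> int n - 2 \<le> 2 * r" by (rule of_int_le_iff)
  finally show ?thesis by (auto simp: A_set_def)
qed

lemma mem_B_set:
  shows "(r, d) \<in> B_set n \<longleftrightarrow> d = r - 1 \<and> int n - 2 \<le> 2 * r \<and> 3 * r \<le> 2 * int n - 5"
proof -
  have "\<lceil>(real n - 2) / 2\<rceil> \<le> r \<longleftrightarrow> (real n - 2) / 2 \<le> real_of_int r" by (rule ceiling_le_iff)
  also have "\<dots> \<longleftrightarrow> real_of_int (int n - 2) \<le> real_of_int (2 * r)" by (simp add: field_simps)
  also have "\<dots> \<longleftrightarrow> int n - 2 \<le> 2 * r" by (rule of_int_le_iff)
  finally have 1: "\<lceil>(real n - 2) / 2\<rceil> \<le> r \<longleftrightarrow> int n - 2 \<le> 2 * r" .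
  have "r \<le> \<lfloor>(2 * real n - 5) / 3\<rfloor> \<longleftrightarrow> real_of_int r \<le> (2 * real n - 5) / 3" by (rule le_floor_iff)
  also have "\<dots> \<longleftrightarrow> real_of_int (3 * r) \<le> real_of_int (2 * int n - 5)" by (simp add: field_simps)
  also have "\<dots> \<longleftrightarrow> 3 * r \<le> 2 * int n - 5" by (rule of_int_le_iff)
  finally show ?thesis using 1 by (auto simp: B_set_def)
qed

text \<open>
  In the exceptional case \<open>n = 2 n2 + s + 1\<close> with \<open>s\<close> even, hence \<open>n\<close> is odd; the bound \<open>s \<le> n2\<close> becomes
  \<open>3 r \<le> 2 n - 5\<close> for \<open>r = n1 - 1\<close>.
\<close>

lemma pair_in_sets:
  assumes n: "n \<ge> 4" and p: "tree_params n n1 n2 s"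
  shows "(reg_of n1 n2, deg_of n1 n2 s) \<in> A_set n \<or> odd n \<and> (reg_of n1 n2, deg_of n1 n2 s) \<in> B_set n"
proof (cases "n2 + s = n1 \<and> even s")
  case True
  then have "odd n" "s \<ge> 2" using p n unfolding tree_params_def by presburger+
  moreover have "(reg_of n1 n2, deg_of n1 n2 s) \<in> B_set n"
    unfolding mem_B_set using True p \<open>s \<ge> 2\<close> by (auto simp: tree_params_def reg_of_def deg_of_def max_def)
  ultimately show ?thesis by blast
next
  case False
  have n2: "n \<ge> 2" using n by simp
  have "(reg_of n1 n2, deg_of n1 n2 s) \<in> A_set n"
    unfolding mem_A_set[OF n2] using False p n
    by (cases "s = 0") (auto simp: tree_params_def reg_of_def deg_of_def max_def)
  then show ?thesis ..
qed

text \<open>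
  Take \<open>n2 = r\<close> and \<open>s = d - r + 1\<close>. The exceptional case does not arise, because \<open>2 r \<ge> n - 2\<close> would force \<open>s \<le> 1\<close>.
\<close>

lemma A_set_realised:
  assumes n: "n \<ge> 4" and rd: "(r, d) \<in> A_set n"
  shows "\<exists>n1 n2 s. tree_params n n1 n2 s \<and> r = reg_of n1 n2 \<and> d = deg_of n1 n2 s"
proof -
  have n2: "n \<ge> 2" using n by simp
  note A = rd[unfolded mem_A_set[OF n2]]
  have r: "r \<ge> 1" using A n by linarith
  define s where "s = nat (d - r + 1)"
  have "tree_params n (n - 1 - nat r) (nat r) s" using A r n by (auto simp: tree_params_def s_def)
  moreover have "r = reg_of (n - 1 - nat r) (nat r)" using A r n by (auto simp: reg_of_def max_def)
  moreover have "d = deg_of (n - 1 - nat r) (nat r) s"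
  proof -
    have nc: "\<not> (nat r + s = n - 1 - nat r \<and> even s)"
    proof
      assume a: "nat r + s = n - 1 - nat r \<and> even s"
      have "s \<ge> 1" unfolding s_def using A by linarith
      moreover have "s \<noteq> 1" using a by auto
      ultimately have "s \<ge> 2" "nat r + s = n - 1 - nat r" using a by simp_all
      then show False using A r n by linarith
    qed
    have mx: "max (nat r + s) (n - 1 - nat r) = nat r + s" using A r n by (auto simp: s_def max_def)
    show ?thesis unfolding deg_of_def if_not_P[OF nc] mx using A r by (simp add: s_def)
  qed
  ultimately show ?thesis by blast
qed

text \<open>
  For \<open>n = 2 k + 1\<close> the exceptional case with \<open>n1 = r + 1\<close> requires \<open>n2 = 2 k - 1 - r\<close> and \<open>s = 2 r + 2 - 2 k\<close>.
\<close>

lemma B_set_realised: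
  assumes n: "n \<ge> 4" "odd n" and rd: "(r, d) \<in> B_set n"
  shows "\<exists>n1 n2 s. tree_params n n1 n2 s \<and> r = reg_of n1 n2 \<and> d = deg_of n1 n2 s"
proof -
  note B = rd[unfolded mem_B_set]
  obtain k where k: "n = 2 * k + 1" using n(2) by (rule oddE)
  have "r \<ge> 0" using B n by linarith
  then obtain R where R: "r = int R" by (rule nonneg_int_cases)
  have le: "2 * k \<le> 2 * R + 1" "3 * R + 3 \<le> 4 * k" "d = int R - 1" using B k R by auto
  have kR: "k \<le> R" using le(1) by presburger
  define n2 where "n2 = 2 * k - 1 - R"
  define s where "s = 2 * R + 2 - 2 * k"
  have k2: "k \<ge> 2" using n k by simp
  have "tree_params n (R + 1) n2 s" using le kR k k2 by (auto simp: tree_params_def n2_def s_def)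
  moreover have "r = reg_of (R + 1) n2" using le kR k2 by (auto simp: reg_of_def R n2_def max_def)
  moreover have "d = deg_of (R + 1) n2 s"
  proof -
    have "n2 + s = R + 1" using le kR k2 by (simp add: n2_def s_def)
    moreover have "even s" unfolding s_def by (simp add: even_diff_nat)
    ultimately show ?thesis using le(3) by (simp add: deg_of_def)
  qed
  ultimately show ?thesis by blast
qed

theorem theorem5p9:
  fixes n :: nat
  assumes "n \<ge> 4"
    and "card (UNIV :: 'v::finite set) = n"
  shows "(even n \<longrightarrow> reg_deg_pairs TYPE('v) TYPE('k::field) = A_set n) \<and>
         (odd n \<longrightarrow> reg_deg_pairs TYPE('v) TYPE('k) = A_set n \<union> B_set n)"
proof -
  have n2: "n \<ge> 2" using assms(1) by simp
  have sub: "x \<in> A_set n \<or> odd n \<and> x \<in> B_set n" if "x \<in> reg_deg_pairs TYPE('v) TYPE('k)" for x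
    using that pair_in_sets[OF assms(1)] unfolding reg_deg_pairs_eq[OF n2 assms(2)] by blast
  have A: "x \<in> reg_deg_pairs TYPE('v) TYPE('k)" if "x \<in> A_set n" for x
    using that A_set_realised[OF assms(1), of "fst x" "snd x"]
    unfolding reg_deg_pairs_eq[OF n2 assms(2)] by (cases x) auto
  have B: "x \<in> reg_deg_pairs TYPE('v) TYPE('k)" if "x \<in> B_set n" "odd n" for x
    using that B_set_realised[OF assms(1) that(2), of "fst x" "snd x"]
    unfolding reg_deg_pairs_eq[OF n2 assms(2)] by (cases x) auto
  show ?thesis using sub A B by blast
qed

end
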